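(* Let $\mathcal{E}$ be an exact category with kernels. Let $\mathcal{P}$ be a class of objects of $\mathcal{E}$ such that for each object $X$ of $\mathcal{E}$ there is an object $P$ in $\mathcal{P}$ together with an admissible epimorphism $P\twoheadrightarrow X$. Suppose further that $\mathcal{P}$ is closed under countable coproducts and satisfies axiom AB4-$k$ for some $k\in\mathbb{Z}$. Then for any complex $X_\bullet\in Ch(\mathcal{E})$ there is a complex $P_\bullet\in Ch(\mathcal{P})$ and a (degree-wise) admissible epimorphism $P_\bullet\to X_\bullet$ which is a quasi-isomorphism. Moreover, $P_\bullet$ can be taken to be the colimit of a $Ch_+(\mathcal{P})$-special direct system.
   Context: Exact categories are in the sense of Quillen. Complexes are homologically graded, $d_n:X_n\to X_{n-1}$. $Ch(\mathcal{P})$ (resp. $Ch_+(\mathcal{P})$) is the class of complexes (resp. bounded below complexes, i.e. $X_n=0$ for $n\ll 0$) with entries in $\mathcal{P}$. Exactness in $Ch(\mathcal{E})$ is degree-wise. A complex $X_\bullet$ is acyclic if every $d_n$ factors as $X_n\twoheadrightarrow Z_{n-1}\rightarrowtail X_{n-1}$ (admissible epic followed by admissible monic) such that every $Z_n\rightarrowtail X_n\twoheadrightarrow Z_{n-1}$ is short exact. A map of complexes is a quasi-isomorphism if its mapping cone is acyclic. For $n\in\mathbb{Z}$, $\tau_{\ge n}X$ is the complex with $(\tau_{\ge n}X)_m=0$ for $m<n$, $(\tau_{\ge n}X)_n=\mathrm{Ker}(d_n)$, $(\tau_{\ge n}X)_m=X_m$ for $m>n$. A complex $X$ is homologically concentrated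 in degrees $\le k$ if $\tau_{\ge k}X$ is acyclic. The class $\mathcal{P}$ satisfies axiom AB4-$k$ if whenever $\{B_n\}_{n\in\mathbb{N}}$ is a countable collection of complexes in $Ch_+(\mathcal{P})$, each homologically concentrated in degrees $\le 0$, the coproduct $\bigoplus_{n}B_n$ exists and is homologically concentrated in degrees $\le -k+1$. For a class of complexes $\mathcal{B}$, a $\mathcal{B}$-special direct system is a direct system $(P^n_\bullet)_{n\in E}$ in $Ch(\mathcal{E})$ such that: (1) $E$ is well-ordered; (2) if $n\in E$ has no predecessor then $P^n_\bullet=\varinjlim_{m<n}P^m_\bullet$; (3) if $n\in E$ has a predecessor $n-1$, then $P^{n-1}_\bullet\to P^n_\bullet$ is injective, its cokernel $C^n_\bullet$ belongs to $\mathcal{B}$, and $0\to P^{n-1}_\bullet\to P^n_\bullet\to C^n_\bullet\to0$ is split exact in each degree. *)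

theory Defs
  imports "HOL-Algebra.Group"
begin

section \<open>Categories and universal constructions\<close>

record ('o, 'm) cat =
  Obj  :: "'o set"
  Arr  :: "'m set"
  Dom  :: "'m \<Rightarrow> 'o"
  Cod  :: "'m \<Rightarrow> 'o"
  Ident :: "'o \<Rightarrow> 'm"
  Comp :: "'m \<Rightarrow> 'm \<Rightarrow> 'm"  (infixr \<open>\<cdot>\<index>\<close> 70)

definition Hom :: "('o, 'm, 'z) cat_scheme \<Rightarrow> 'o \<Rightarrow> 'o \<Rightarrow> 'm set" where
  "Hom C A B = {f \<in> Arr C. Dom C f = A \<and> Cod C f = B}"

locale category =
  fixes C (structure)
  assumes dom_obj: "f \<in> Arr C \<Longrightarrow> Dom C f \<in> Obj C"
    and cod_obj: "f \<in> Arr C \<Longrightarrow> Cod C f \<in> Obj C"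
    and id_hom: "A \<in> Obj C \<Longrightarrow> Ident C A \<in> Hom C A A"
    and comp_hom: "f \<in> Hom C A B \<Longrightarrow> g \<in> Hom C B D \<Longrightarrow> g \<cdot> f \<in> Hom C A D"
    and comp_id_right: "f \<in> Hom C A B \<Longrightarrow> f \<cdot> Ident C A = f"
    and comp_id_left: "f \<in> Hom C A B \<Longrightarrow> Ident C B \<cdot> f = f"
    and comp_assoc:
      "f \<in> Hom C A B \<Longrightarrow> g \<in> Hom C B D \<Longrightarrow> h \<in> Hom C D F \<Longrightarrow> (h \<cdot> g) \<cdot> f = h \<cdot> (g \<cdot> f)"

definition monic :: "('o, 'm, 'z) cat_scheme \<Rightarrow> 'm \<Rightarrow> bool" where
  "monic C f \<longleftrightarrow> f \<in> Arr C \<and>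
     (\<forall>T \<in> Obj C. \<forall>g \<in> Hom C T (Dom C f). \<forall>h \<in> Hom C T (Dom C f).
        f \<cdot>\<^bsub>C\<^esub> g = f \<cdot>\<^bsub>C\<^esub> h \<longrightarrow> g = h)"

definition iso_arr :: "('o, 'm, 'z) cat_scheme \<Rightarrow> 'm \<Rightarrow> bool" where
  "iso_arr C f \<longleftrightarrow> f \<in> Arr C \<and>
     (\<exists>g \<in> Hom C (Cod C f) (Dom C f).
        g \<cdot>\<^bsub>C\<^esub> f = Ident C (Dom C f) \<and> f \<cdot>\<^bsub>C\<^esub> g = Ident C (Cod C f))"

definition is_zero_obj :: "('o, 'm, 'z) cat_scheme \<Rightarrow> 'o \<Rightarrow> bool" where
  "is_zero_obj C Z \<longleftrightarrow> Z \<in> Obj C \<and>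
     (\<forall>T \<in> Obj C. (\<exists>!f. f \<in> Hom C Z T) \<and> (\<exists>!f. f \<in> Hom C T Z))"

definition is_coproduct ::
  "('o, 'm, 'z) cat_scheme \<Rightarrow> 'i set \<Rightarrow> ('i \<Rightarrow> 'o) \<Rightarrow> 'o \<Rightarrow> ('i \<Rightarrow> 'm) \<Rightarrow> bool" where
  "is_coproduct C I A S \<iota> \<longleftrightarrow> S \<in> Obj C \<and> (\<forall>i \<in> I. \<iota> i \<in> Hom C (A i) S) \<and>
     (\<forall>T \<in> Obj C. \<forall>f. (\<forall>i \<in> I. f i \<in> Hom C (A i) T) \<longrightarrow>
        (\<exists>!h. h \<in> Hom C S T \<and> (\<forall>i \<in> I. h \<cdot>\<^bsub>C\<^esub> \<iota> i = f i)))"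

text \<open>
  In \<^term>\<open>is_pullback C f p f' p'\<close> the cospan is \<open>f : Y \<rightarrow> Z \<leftarrow> X : p\<close>, and
  \<open>p' : W \<rightarrow> Y\<close> is the base change of \<open>p\<close> along \<open>f\<close>, with \<open>f' : W \<rightarrow> X\<close>.
  In \<^term>\<open>is_pushout C f i f' i'\<close> the span is \<open>Y \<leftarrow> Z \<rightarrow> X\<close> with \<open>f : Z \<rightarrow> Y\<close>,
  \<open>i : Z \<rightarrow> X\<close>, and \<open>i' : Y \<rightarrow> W\<close> is the cobase change of \<open>i\<close> along \<open>f\<close>.
\<close>

definition is_pullback :: "('o, 'm, 'z) cat_scheme \<Rightarrow> 'm \<Rightarrow> 'm \<Rightarrow> 'm \<Rightarrow> 'm \<Rightarrow> bool" where
  "is_pullback C f p f' p' \<longleftrightarrow>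
     f \<in> Arr C \<and> p \<in> Arr C \<and> Cod C f = Cod C p \<and>
     p' \<in> Hom C (Dom C f') (Dom C f) \<and> f' \<in> Hom C (Dom C f') (Dom C p) \<and>
     f \<cdot>\<^bsub>C\<^esub> p' = p \<cdot>\<^bsub>C\<^esub> f' \<and>
     (\<forall>T \<in> Obj C. \<forall>u \<in> Hom C T (Dom C f). \<forall>v \<in> Hom C T (Dom C p).
        f \<cdot>\<^bsub>C\<^esub> u = p \<cdot>\<^bsub>C\<^esub> v \<longrightarrow>
        (\<exists>!h. h \<in> Hom C T (Dom C f') \<and> p' \<cdot>\<^bsub>C\<^esub> h = u \<and> f' \<cdot>\<^bsub>C\<^esub> h = v))"

definition is_pushout :: "('o, 'm, 'z) cat_scheme \<Rightarrow> 'm \<Rightarrow> 'm \<Rightarrow> 'm \<Rightarrow> 'm \<Rightarrow> bool" where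
  "is_pushout C f i f' i' \<longleftrightarrow>
     f \<in> Arr C \<and> i \<in> Arr C \<and> Dom C f = Dom C i \<and>
     i' \<in> Hom C (Cod C f) (Cod C f') \<and> f' \<in> Hom C (Cod C i) (Cod C f') \<and>
     i' \<cdot>\<^bsub>C\<^esub> f = f' \<cdot>\<^bsub>C\<^esub> i \<and>
     (\<forall>T \<in> Obj C. \<forall>u \<in> Hom C (Cod C f) T. \<forall>v \<in> Hom C (Cod C i) T.
        u \<cdot>\<^bsub>C\<^esub> f = v \<cdot>\<^bsub>C\<^esub> i \<longrightarrow>
        (\<exists>!h. h \<in> Hom C (Cod C f') T \<and> h \<cdot>\<^bsub>C\<^esub> i' = u \<and> h \<cdot>\<^bsub>C\<^esub> f' = v))"

text \<open>Direct systems are indexed by a set \<open>J\<close> with a reflexive order relation \<open>r\<close>;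
  \<open>\<phi> m n : P m \<rightarrow> P n\<close> for \<open>(m, n) \<in> r\<close>. The relation may be defined on more than \<open>J\<close>, so that
  a system can be restricted by shrinking \<open>J\<close>.\<close>

definition direct_system ::
  "('o, 'm, 'z) cat_scheme \<Rightarrow> 'i set \<Rightarrow> 'i rel \<Rightarrow> ('i \<Rightarrow> 'o) \<Rightarrow> ('i \<Rightarrow> 'i \<Rightarrow> 'm) \<Rightarrow> bool" where
  "direct_system C J r P \<phi> \<longleftrightarrow>
     (\<forall>n \<in> J. P n \<in> Obj C \<and> \<phi> n n = Ident C (P n)) \<and>
     (\<forall>m \<in> J. \<forall>n \<in> J. (m, n) \<in> r \<longrightarrow> \<phi> m n \<in> Hom C (P m) (P n)) \<and>
     (\<forall>l \<in> J. \<forall>m \<in> J. \<forall>n \<in> J. (l, m) \<in> r \<longrightarrow> (m, n) \<in> r \<longrightarrow> \<phi> m n \<cdot>\<^bsub>C\<^esub> \<phi> l m = \<phi> l n)"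

definition is_cocone ::
  "('o, 'm, 'z) cat_scheme \<Rightarrow> 'i set \<Rightarrow> 'i rel \<Rightarrow> ('i \<Rightarrow> 'o) \<Rightarrow> ('i \<Rightarrow> 'i \<Rightarrow> 'm) \<Rightarrow>
   'o \<Rightarrow> ('i \<Rightarrow> 'm) \<Rightarrow> bool" where
  "is_cocone C J r P \<phi> L \<iota> \<longleftrightarrow> L \<in> Obj C \<and> (\<forall>n \<in> J. \<iota> n \<in> Hom C (P n) L) \<and>
     (\<forall>m \<in> J. \<forall>n \<in> J. (m, n) \<in> r \<longrightarrow> \<iota> n \<cdot>\<^bsub>C\<^esub> \<phi> m n = \<iota> m)"

definition is_direct_limit ::
  "('o, 'm, 'z) cat_scheme \<Rightarrow> 'i set \<Rightarrow> 'i rel \<Rightarrow> ('i \<Rightarrow> 'o) \<Rightarrow> ('i \<Rightarrow> 'i \<Rightarrow> 'm) \<Rightarrow>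
   'o \<Rightarrow> ('i \<Rightarrow> 'm) \<Rightarrow> bool" where
  "is_direct_limit C J r P \<phi> L \<iota> \<longleftrightarrow> is_cocone C J r P \<phi> L \<iota> \<and>
     (\<forall>T f. is_cocone C J r P \<phi> T f \<longrightarrow>
        (\<exists>!h. h \<in> Hom C L T \<and> (\<forall>n \<in> J. h \<cdot>\<^bsub>C\<^esub> \<iota> n = f n)))"


section \<open>Additive categories\<close>

record ('o, 'm) addcat = "('o, 'm) cat" +
  Add  :: "'m \<Rightarrow> 'm \<Rightarrow> 'm"  (infixl \<open>\<^bold>+\<index>\<close> 65)
  Zero :: "'o \<Rightarrow> 'o \<Rightarrow> 'm"

definition hom_group :: "('o, 'm, 'z) addcat_scheme \<Rightarrow> 'o \<Rightarrow> 'o \<Rightarrow> 'm monoid" where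
  "hom_group C A B = \<lparr>carrier = Hom C A B, mult = Add C, one = Zero C A B\<rparr>"

definition Neg :: "('o, 'm, 'z) addcat_scheme \<Rightarrow> 'm \<Rightarrow> 'm" where
  "Neg C f = inv\<^bsub>hom_group C (Dom C f) (Cod C f)\<^esub> f"

definition is_kernel :: "('o, 'm, 'z) addcat_scheme \<Rightarrow> 'm \<Rightarrow> 'm \<Rightarrow> bool" where
  "is_kernel C f \<kappa> \<longleftrightarrow> f \<in> Arr C \<and> \<kappa> \<in> Arr C \<and> Cod C \<kappa> = Dom C f \<and>
     f \<cdot>\<^bsub>C\<^esub> \<kappa> = Zero C (Dom C \<kappa>) (Cod C f) \<and>
     (\<forall>T \<in> Obj C. \<forall>u \<in> Hom C T (Dom C f). f \<cdot>\<^bsub>C\<^esub> u = Zero C T (Cod C f) \<longrightarrow>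
        (\<exists>!h. h \<in> Hom C T (Dom C \<kappa>) \<and> \<kappa> \<cdot>\<^bsub>C\<^esub> h = u))"

definition is_cokernel :: "('o, 'm, 'z) addcat_scheme \<Rightarrow> 'm \<Rightarrow> 'm \<Rightarrow> bool" where
  "is_cokernel C f q \<longleftrightarrow> f \<in> Arr C \<and> q \<in> Arr C \<and> Dom C q = Cod C f \<and>
     q \<cdot>\<^bsub>C\<^esub> f = Zero C (Dom C f) (Cod C q) \<and>
     (\<forall>T \<in> Obj C. \<forall>u \<in> Hom C (Cod C f) T. u \<cdot>\<^bsub>C\<^esub> f = Zero C (Dom C f) T \<longrightarrow>
        (\<exists>!h. h \<in> Hom C (Cod C q) T \<and> h \<cdot>\<^bsub>C\<^esub> q = u))"

definition has_kernels :: "('o, 'm, 'z) addcat_scheme \<Rightarrow> bool" where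
  "has_kernels C \<longleftrightarrow> (\<forall>f \<in> Arr C. \<exists>\<kappa>. is_kernel C f \<kappa>)"

definition is_biproduct ::
  "('o, 'm, 'z) addcat_scheme \<Rightarrow> 'o \<Rightarrow> 'o \<Rightarrow> 'o \<Rightarrow> 'm \<Rightarrow> 'm \<Rightarrow> 'm \<Rightarrow> 'm \<Rightarrow> bool" where
  "is_biproduct C A B S i1 i2 p1 p2 \<longleftrightarrow>
     i1 \<in> Hom C A S \<and> i2 \<in> Hom C B S \<and> p1 \<in> Hom C S A \<and> p2 \<in> Hom C S B \<and>
     p1 \<cdot>\<^bsub>C\<^esub> i1 = Ident C A \<and> p2 \<cdot>\<^bsub>C\<^esub> i2 = Ident C B \<and>
     p2 \<cdot>\<^bsub>C\<^esub> i1 = Zero C A B \<and> p1 \<cdot>\<^bsub>C\<^esub> i2 = Zero C B A \<and>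
     (i1 \<cdot>\<^bsub>C\<^esub> p1) \<^bold>+\<^bsub>C\<^esub> (i2 \<cdot>\<^bsub>C\<^esub> p2) = Ident C S"

definition split_exact :: "('o, 'm, 'z) addcat_scheme \<Rightarrow> 'm \<Rightarrow> 'm \<Rightarrow> bool" where
  "split_exact C i p \<longleftrightarrow> (\<exists>s t. is_biproduct C (Dom C i) (Cod C p) (Cod C i) i s t p)"

locale additive_category = category C for C (structure) +
  assumes hom_comm_group: "A \<in> Obj C \<Longrightarrow> B \<in> Obj C \<Longrightarrow> comm_group (hom_group C A B)"
    and comp_add_right:
      "f \<in> Hom C A B \<Longrightarrow> f' \<in> Hom C A B \<Longrightarrow> g \<in> Hom C B D \<Longrightarrow>
       g \<cdot> (f \<^bold>+ f') = (g \<cdot> f) \<^bold>+ (g \<cdot> f')"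
    and comp_add_left:
      "f \<in> Hom C A B \<Longrightarrow> g \<in> Hom C B D \<Longrightarrow> g' \<in> Hom C B D \<Longrightarrow>
       (g \<^bold>+ g') \<cdot> f = (g \<cdot> f) \<^bold>+ (g' \<cdot> f)"
    and zero_obj_exists: "\<exists>Z. is_zero_obj C Z"
    and biproduct_exists:
      "A \<in> Obj C \<Longrightarrow> B \<in> Obj C \<Longrightarrow> \<exists>S i1 i2 p1 p2. is_biproduct C A B S i1 i2 p1 p2"


section \<open>Exact categories\<close>

text \<open>\<open>Ses\<close> is the class of short exact sequences, stored as pairs \<open>(i, p)\<close>.\<close>

record ('o, 'm) excat = "('o, 'm) addcat" +
  Ses :: "('m \<times> 'm) set"

definition adm_monic :: "('o, 'm, 'z) excat_scheme \<Rightarrow> 'm \<Rightarrow> bool" where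
  "adm_monic E i \<longleftrightarrow> (\<exists>p. (i, p) \<in> Ses E)"

definition adm_epic :: "('o, 'm, 'z) excat_scheme \<Rightarrow> 'm \<Rightarrow> bool" where
  "adm_epic E p \<longleftrightarrow> (\<exists>i. (i, p) \<in> Ses E)"

text \<open>Quillen's original axioms, including the ones (\<open>adm_epic_cancel\<close>, \<open>adm_monic_cancel\<close>)
  later shown by Keller to be redundant.\<close>

locale exact_category = additive_category E for E (structure) +
  assumes ses_kernel: "(i, p) \<in> Ses E \<Longrightarrow> is_kernel E p i"
    and ses_cokernel: "(i, p) \<in> Ses E \<Longrightarrow> is_cokernel E i p"
    and ses_split: "is_biproduct E A B S i1 i2 p1 p2 \<Longrightarrow> (i1, p2) \<in> Ses E"
    and ses_iso:
      "(i, p) \<in> Ses E \<Longrightarrow> iso_arr E a \<Longrightarrow> iso_arr E b \<Longrightarrow> iso_arr E c \<Longrightarrow>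
       Dom E a = Dom E i \<Longrightarrow> Dom E b = Cod E i \<Longrightarrow> Dom E c = Cod E p \<Longrightarrow>
       i' \<in> Hom E (Cod E a) (Cod E b) \<Longrightarrow> p' \<in> Hom E (Cod E b) (Cod E c) \<Longrightarrow>
       i' \<cdot> a = b \<cdot> i \<Longrightarrow> p' \<cdot> b = c \<cdot> p \<Longrightarrow> (i', p') \<in> Ses E"
    and adm_epic_comp:
      "adm_epic E p \<Longrightarrow> adm_epic E q \<Longrightarrow> Cod E p = Dom E q \<Longrightarrow> adm_epic E (q \<cdot> p)"
    and adm_monic_comp:
      "adm_monic E i \<Longrightarrow> adm_monic E j \<Longrightarrow> Cod E i = Dom E j \<Longrightarrow> adm_monic E (j \<cdot> i)"
    and base_change_exists:
      "adm_epic E p \<Longrightarrow> f \<in> Arr E \<Longrightarrow> Cod E f = Cod E p \<Longrightarrow> \<exists>f' p'. is_pullback E f p f' p'"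
    and base_change_adm_epic:
      "adm_epic E p \<Longrightarrow> is_pullback E f p f' p' \<Longrightarrow> adm_epic E p'"
    and cobase_change_exists:
      "adm_monic E i \<Longrightarrow> f \<in> Arr E \<Longrightarrow> Dom E f = Dom E i \<Longrightarrow> \<exists>f' i'. is_pushout E f i f' i'"
    and cobase_change_adm_monic:
      "adm_monic E i \<Longrightarrow> is_pushout E f i f' i' \<Longrightarrow> adm_monic E i'"
    and adm_epic_cancel:
      "f \<in> Arr E \<Longrightarrow> is_kernel E f \<kappa> \<Longrightarrow> g \<in> Arr E \<Longrightarrow> Cod E g = Dom E f \<Longrightarrow>
       adm_epic E (f \<cdot> g) \<Longrightarrow> adm_epic E f"
    and adm_monic_cancel:
      "f \<in> Arr E \<Longrightarrow> is_cokernel E f q \<Longrightarrow> g \<in> Arr E \<Longrightarrow> Dom E g = Cod E f \<Longrightarrow>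
       adm_monic E (g \<cdot> f) \<Longrightarrow> adm_monic E f"


section \<open>The category of complexes\<close>

text \<open>Homological grading: \<open>dif X n : ent X n \<rightarrow> ent X (n - 1)\<close>.\<close>

record ('o, 'm) cplx =
  ent :: "int \<Rightarrow> 'o"
  dif :: "int \<Rightarrow> 'm"

definition is_complex :: "('o, 'm, 'z) addcat_scheme \<Rightarrow> ('o, 'm) cplx \<Rightarrow> bool" where
  "is_complex C X \<longleftrightarrow>
     (\<forall>n. ent X n \<in> Obj C) \<and>
     (\<forall>n. dif X n \<in> Hom C (ent X n) (ent X (n - 1))) \<and>
     (\<forall>n. dif X (n - 1) \<cdot>\<^bsub>C\<^esub> dif X n = Zero C (ent X n) (ent X (n - 2)))"

text \<open>An arrow of the category of complexes carries its domain and codomain explicitly.\<close>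

type_synonym ('o, 'm) cmap = "('o, 'm) cplx \<times> ('o, 'm) cplx \<times> (int \<Rightarrow> 'm)"

abbreviation src :: "('o, 'm) cmap \<Rightarrow> ('o, 'm) cplx" where
  "src f \<equiv> fst f"

abbreviation tgt :: "('o, 'm) cmap \<Rightarrow> ('o, 'm) cplx" where
  "tgt f \<equiv> fst (snd f)"

abbreviation cmpt :: "('o, 'm) cmap \<Rightarrow> int \<Rightarrow> 'm" where
  "cmpt f \<equiv> snd (snd f)"

definition is_chain_map :: "('o, 'm, 'z) addcat_scheme \<Rightarrow> ('o, 'm) cmap \<Rightarrow> bool" where
  "is_chain_map C f \<longleftrightarrow> is_complex C (src f) \<and> is_complex C (tgt f) \<and>
     (\<forall>n. cmpt f n \<in> Hom C (ent (src f) n) (ent (tgt f) n)) \<and>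
     (\<forall>n. dif (tgt f) n \<cdot>\<^bsub>C\<^esub> cmpt f n = cmpt f (n - 1) \<cdot>\<^bsub>C\<^esub> dif (src f) n)"

definition Ch :: "('o, 'm, 'z) addcat_scheme \<Rightarrow> (('o, 'm) cplx, ('o, 'm) cmap) addcat" where
  "Ch C =
     \<lparr>Obj = {X. is_complex C X},
      Arr = {f. is_chain_map C f},
      Dom = src,
      Cod = tgt,
      Ident = (\<lambda>X. (X, X, \<lambda>n. Ident C (ent X n))),
      Comp = (\<lambda>g f. (src f, tgt g, \<lambda>n. cmpt g n \<cdot>\<^bsub>C\<^esub> cmpt f n)),
      Add = (\<lambda>f g. (src f, tgt f, \<lambda>n. cmpt f n \<^bold>+\<^bsub>C\<^esub> cmpt g n)),
      Zero = (\<lambda>X Y. (X, Y, \<lambda>n. Zero C (ent X n) (ent Y n)))\<rparr>"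

definition Ch_in :: "('o, 'm, 'z) addcat_scheme \<Rightarrow> 'o set \<Rightarrow> ('o, 'm) cplx set" where
  "Ch_in C P = {X. is_complex C X \<and> (\<forall>n. ent X n \<in> P)}"

definition Ch_plus_in :: "('o, 'm, 'z) addcat_scheme \<Rightarrow> 'o set \<Rightarrow> ('o, 'm) cplx set" where
  "Ch_plus_in C P = {X \<in> Ch_in C P. \<exists>N. \<forall>n < N. is_zero_obj C (ent X n)}"

definition acyclic_complex :: "('o, 'm, 'z) excat_scheme \<Rightarrow> ('o, 'm) cplx \<Rightarrow> bool" where
  "acyclic_complex E X \<longleftrightarrow> is_complex E X \<and>
     (\<exists>Z i e. (\<forall>n. e n \<in> Hom E (ent X n) (Z (n - 1)) \<and> i n \<in> Hom E (Z n) (ent X n) \<and>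
                   (i n, e n) \<in> Ses E \<and> dif X n = i (n - 1) \<cdot>\<^bsub>E\<^esub> e n))"

text \<open>The cone of \<open>f : X \<rightarrow> Y\<close> has entries \<open>X\<^bsub>n-1\<^esub> \<oplus> Y\<^bsub>n\<^esub>\<close> and differential
  \<open>(x, y) \<mapsto> (- d x, f x + d y)\<close>. It depends on a choice of biproducts, hence is a relation;
  likewise the truncation below depends on a choice of kernel and of zero objects. Different
  choices give isomorphic complexes.\<close>

definition is_mapping_cone ::
  "('o, 'm, 'z) addcat_scheme \<Rightarrow> ('o, 'm) cmap \<Rightarrow> ('o, 'm) cplx \<Rightarrow> bool" where
  "is_mapping_cone C f K \<longleftrightarrow> is_chain_map C f \<and> is_complex C K \<and>
     (\<exists>i1 i2 p1 p2. \<forall>n.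
        is_biproduct C (ent (src f) (n - 1)) (ent (tgt f) n) (ent K n)
          (i1 n) (i2 n) (p1 n) (p2 n) \<and>
        dif K n =
          (i1 (n - 1) \<cdot>\<^bsub>C\<^esub> Neg C (dif (src f) (n - 1)) \<cdot>\<^bsub>C\<^esub> p1 n) \<^bold>+\<^bsub>C\<^esub>
          (i2 (n - 1) \<cdot>\<^bsub>C\<^esub> ((cmpt f (n - 1) \<cdot>\<^bsub>C\<^esub> p1 n) \<^bold>+\<^bsub>C\<^esub> (dif (tgt f) n \<cdot>\<^bsub>C\<^esub> p2 n))))"

definition quasi_iso :: "('o, 'm, 'z) excat_scheme \<Rightarrow> ('o, 'm) cmap \<Rightarrow> bool" where
  "quasi_iso E f \<longleftrightarrow> (\<exists>K. is_mapping_cone E f K \<and> acyclic_complex E K)"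

definition is_truncation ::
  "('o, 'm, 'z) addcat_scheme \<Rightarrow> int \<Rightarrow> ('o, 'm) cplx \<Rightarrow> ('o, 'm) cplx \<Rightarrow> bool" where
  "is_truncation C n X T \<longleftrightarrow> is_complex C X \<and> is_complex C T \<and>
     (\<forall>m < n. is_zero_obj C (ent T m)) \<and>
     (\<forall>m > n. ent T m = ent X m) \<and>
     (\<forall>m > n + 1. dif T m = dif X m) \<and>
     (\<exists>\<kappa>. is_kernel C (dif X n) \<kappa> \<and> Dom C \<kappa> = ent T n \<and>
          \<kappa> \<cdot>\<^bsub>C\<^esub> dif T (n + 1) = dif X (n + 1))"

definition homologically_le :: "('o, 'm, 'z) excat_scheme \<Rightarrow> int \<Rightarrow> ('o, 'm) cplx \<Rightarrow> bool" where
  "homologically_le E k X \<longleftrightarrow> (\<exists>T. is_truncation E k X T \<and> acyclic_complex E T)"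


section \<open>Coproduct conditions and special direct systems\<close>

definition closed_under_countable_coproducts ::
  "('o, 'm, 'z) cat_scheme \<Rightarrow> 'o set \<Rightarrow> bool" where
  "closed_under_countable_coproducts C P \<longleftrightarrow>
     (\<forall>(I :: nat set) A. (\<forall>i \<in> I. A i \<in> P) \<longrightarrow>
        (\<exists>S \<iota>. is_coproduct C I A S \<iota>) \<and> (\<forall>S \<iota>. is_coproduct C I A S \<iota> \<longrightarrow> S \<in> P))"

definition AB4 :: "('o, 'm, 'z) excat_scheme \<Rightarrow> int \<Rightarrow> 'o set \<Rightarrow> bool" where
  "AB4 E k P \<longleftrightarrow>
     (\<forall>B :: nat \<Rightarrow> ('o, 'm) cplx.
        (\<forall>n. B n \<in> Ch_plus_in E P \<and> homologically_le E 0 (B n)) \<longrightarrow>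
        (\<exists>S \<iota>. is_coproduct (Ch E) UNIV B S \<iota> \<and> homologically_le E (- k + 1) S))"

definition is_predecessor :: "'i set \<Rightarrow> 'i rel \<Rightarrow> 'i \<Rightarrow> 'i \<Rightarrow> bool" where
  "is_predecessor J r m n \<longleftrightarrow> m \<in> J \<and> n \<in> J \<and> (m, n) \<in> r \<and> m \<noteq> n \<and>
     (\<forall>l \<in> J. (l, n) \<in> r \<and> l \<noteq> n \<longrightarrow> (l, m) \<in> r)"

text \<open>The least element of \<open>J\<close> has no predecessor, so the corresponding complex is the colimit
  of the empty system, i.e. a zero complex.\<close>

definition special_direct_system ::
  "('o, 'm, 'z) addcat_scheme \<Rightarrow> ('o, 'm) cplx set \<Rightarrow> 'i set \<Rightarrow> 'i rel \<Rightarrow>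
   ('i \<Rightarrow> ('o, 'm) cplx) \<Rightarrow> ('i \<Rightarrow> 'i \<Rightarrow> ('o, 'm) cmap) \<Rightarrow> bool" where
  "special_direct_system C \<B> J r P \<phi> \<longleftrightarrow>
     direct_system (Ch C) J r P \<phi> \<and>
     well_order_on J r \<and>
     (\<forall>n \<in> J. (\<nexists>m. is_predecessor J r m n) \<longrightarrow>
        is_direct_limit (Ch C) (underS r n) r P \<phi> (P n) (\<lambda>m. \<phi> m n)) \<and>
     (\<forall>m n. is_predecessor J r m n \<longrightarrow>
        monic (Ch C) (\<phi> m n) \<and>
        (\<exists>q. is_cokernel (Ch C) (\<phi> m n) q \<and> tgt q \<in> \<B> \<and>
             (\<forall>j. split_exact C (cmpt (\<phi> m n) j) (cmpt q j))))"

end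

theory Submission
  imports Defs
begin

text \<open>
  Exactness of complexes can be checked on generalized elements \<open>T \<rightarrow> X\<^sub>j\<close> that may be refined
  along admissible epimorphisms \<open>T' \<rightarrow> T\<close>; since kernels exist, this allows diagram chases as in an
  abelian category.

  Starting from \<open>S\<^sub>0 = 0\<close>, one attaches to \<open>S\<^sub>n \<rightarrow> X\<close> in each degree \<open>j \<ge> -n\<close>, inductively, an
  object of \<open>P\<close> covering the pairs \<open>(x, b)\<close> with \<open>x \<in> X\<^sub>j\<close>, \<open>b\<close> a cycle of degree \<open>j - 1\<close> in
  \<open>S\<^bsub>n+1\<^esub>\<close>, and \<open>d x = f b\<close>. Hence every such pair lifts locally to \<open>S\<^bsub>n+1\<^esub>\<close>, and \<open>S\<^bsub>n+1\<^esub> \<rightarrow> X\<close> is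
  in degrees \<open>> -n\<close> an epimorphism with acyclic kernel. It follows that the cone of \<open>S\<^sub>m \<rightarrow> S\<^sub>n\<close> is
  exact in degrees \<open>> -m\<close>, independently of \<open>n \<ge> m\<close>. The cone of \<open>S\<^sub>m \<rightarrow> colim S\<^sub>n\<close> is the colimit
  of these cones, and the degreewise split telescope sequence together with AB4-\<open>k\<close> shows that it
  is exact in degrees \<open>> -m - k + 2\<close> as well. Therefore the local lifting property passes to
  \<open>colim S\<^sub>n \<rightarrow> X\<close> in degrees that tend to \<open>-\<infinity>\<close> with \<open>m \<rightarrow> \<infinity>\<close>, i.e. in all degrees.
\<close>

section \<open>Additive categories\<close>

text \<open>The obstacle is that neither countable coproducts nor sequential colimits in
  \<open>E\<close> are assumed exact, so lifting properties of the finite stages do not simply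
  survive in the colimit. AB4-k is a bounded substitute, but it speaks only of bounded below
  complexes whose homology stops at a fixed degree. The stages themselves are unsuitable, since they
  reproduce the homology of X in all high degrees; the relative cones between stages lose this
  homology, and they are bounded below because each layer stops at a finite degree. The price of
  AB4-k and of the telescope is a shift that does not depend on the stage, so starting the colimit
  later makes up for it. Covers in \<open>P\<close> need not be projective, hence every lift exists
  only after a refinement. Attaching pairs rather than cycles of X alone gives surjectivity and
  vanishing of the relative homology in one step. Besides being demanded of the system, degreewise
  splitting makes the telescope exact in each degree and exhibits the colimit as a coproduct of the
  layers, so that it exists and has entries in \<open>P\<close>.\<close>

context category
begin

lemma comp_arr: "f \<in> Arr C \<Longrightarrow> g \<in> Arr C \<Longrightarrow> Cod C f = Dom C g \<Longrightarrow> g \<cdot> f \<in> Arr C"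
  and dom_comp: "f \<in> Arr C \<Longrightarrow> g \<in> Arr C \<Longrightarrow> Cod C f = Dom C g \<Longrightarrow> Dom C (g \<cdot> f) = Dom C f"
  and cod_comp: "f \<in> Arr C \<Longrightarrow> g \<in> Arr C \<Longrightarrow> Cod C f = Dom C g \<Longrightarrow> Cod C (g \<cdot> f) = Cod C g"
  using comp_hom[of f "Dom C f" "Cod C f" g "Cod C g"] by (auto simp: Hom_def)

lemma assoc: "f \<in> Arr C \<Longrightarrow> g \<in> Arr C \<Longrightarrow> h \<in> Arr C \<Longrightarrow> Cod C f = Dom C g \<Longrightarrow>
    Cod C g = Dom C h \<Longrightarrow> (h \<cdot> g) \<cdot> f = h \<cdot> (g \<cdot> f)"
  using comp_assoc[of f "Dom C f" "Cod C f" g "Cod C g" h "Cod C h"] by (auto simp: Hom_def)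

lemma id_arr: "A \<in> Obj C \<Longrightarrow> Ident C A \<in> Arr C"
  and dom_id: "A \<in> Obj C \<Longrightarrow> Dom C (Ident C A) = A"
  and cod_id: "A \<in> Obj C \<Longrightarrow> Cod C (Ident C A) = A"
  using id_hom[of A] by (auto simp: Hom_def)

lemma id_left: "f \<in> Arr C \<Longrightarrow> Cod C f = A \<Longrightarrow> Ident C A \<cdot> f = f"
  and id_right: "f \<in> Arr C \<Longrightarrow> Dom C f = A \<Longrightarrow> f \<cdot> Ident C A = f"
  using comp_id_left[of f "Dom C f" A] comp_id_right[of f A "Cod C f"] by (auto simp: Hom_def)

lemmas cat_simps = comp_arr dom_comp cod_comp assoc id_arr dom_id cod_id id_left id_right
  dom_obj cod_obj

lemma Hom_obj: "f \<in> Hom C A B \<Longrightarrow> A \<in> Obj C \<and> B \<in> Obj C"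
  using dom_obj cod_obj by (auto simp: Hom_def)

text \<open>Simplification nests composites to the right, so an equation for
  \<open>g \<cdot> f\<close> no longer matches inside \<open>g \<cdot> (f \<cdot> h)\<close>; this
  form makes it applicable again.\<close>

lemma comp_reassoc:
  assumes "g \<cdot> f = k" "f \<in> Arr C" "g \<in> Arr C" "Cod C f = Dom C g" "h \<in> Arr C" "Cod C h = Dom C f"
  shows "g \<cdot> (f \<cdot> h) = k \<cdot> h"
  using assms assoc by metis

end

context additive_category
begin

lemma hom_group_facts:
  assumes "A \<in> Obj C" "B \<in> Obj C"
  shows "comm_group (hom_group C A B)" "carrier (hom_group C A B) = Hom C A B"
    "mult (hom_group C A B) = Add C" "one (hom_group C A B) = Zero C A B"
  using hom_comm_group[OF assms] by (auto simp: hom_group_def)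

lemma zero_arr: "A \<in> Obj C \<Longrightarrow> B \<in> Obj C \<Longrightarrow> Zero C A B \<in> Arr C"
  and dom_zero: "A \<in> Obj C \<Longrightarrow> B \<in> Obj C \<Longrightarrow> Dom C (Zero C A B) = A"
  and cod_zero: "A \<in> Obj C \<Longrightarrow> B \<in> Obj C \<Longrightarrow> Cod C (Zero C A B) = B"
  using hom_group_facts[of A B]
    monoid.one_closed[OF group.is_monoid[OF comm_group.axioms(2)], of "hom_group C A B"]
  by (auto simp: Hom_def)

lemma add_hom: "f \<in> Hom C A B \<Longrightarrow> g \<in> Hom C A B \<Longrightarrow> f \<^bold>+ g \<in> Hom C A B"
  using Hom_obj[of f A B] hom_group_facts[of A B]
    monoid.m_closed[OF group.is_monoid[OF comm_group.axioms(2)], of "hom_group C A B" f g]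
  by auto

lemma add_arr: "f \<in> Arr C \<Longrightarrow> g \<in> Arr C \<Longrightarrow> Dom C f = Dom C g \<Longrightarrow> Cod C f = Cod C g \<Longrightarrow> f \<^bold>+ g \<in> Arr C"
  and dom_add: "f \<in> Arr C \<Longrightarrow> g \<in> Arr C \<Longrightarrow> Dom C f = Dom C g \<Longrightarrow> Cod C f = Cod C g \<Longrightarrow> Dom C (f \<^bold>+ g) =
      Dom C g"
  and cod_add: "f \<in> Arr C \<Longrightarrow> g \<in> Arr C \<Longrightarrow> Dom C f = Dom C g \<Longrightarrow> Cod C f = Cod C g \<Longrightarrow> Cod C (f \<^bold>+ g) =
      Cod C g"
  using add_hom[of f "Dom C f" "Cod C f" g] by (auto simp: Hom_def)

lemma add_assoc: "f \<in> Arr C \<Longrightarrow> g \<in> Arr C \<Longrightarrow> h \<in> Arr C \<Longrightarrow> Dom C f = Dom C g \<Longrightarrow> Cod C f = Cod C g \<Longrightarrow>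
   Dom C g = Dom C h \<Longrightarrow> Cod C g = Cod C h \<Longrightarrow> (f \<^bold>+ g) \<^bold>+ h = f \<^bold>+ (g \<^bold>+ h)"
  using hom_group_facts[of "Dom C h" "Cod C h"] dom_obj cod_obj
    monoid.m_assoc[OF group.is_monoid[OF comm_group.axioms(2)], of "hom_group C (Dom C h) (Cod C
        h)" f g h]
  by (auto simp: Hom_def)

lemma add_comm: "f \<in> Arr C \<Longrightarrow> g \<in> Arr C \<Longrightarrow> Dom C f = Dom C g \<Longrightarrow> Cod C f = Cod C g \<Longrightarrow> f \<^bold>+ g = g \<^bold>+ f"
  using hom_group_facts[of "Dom C g" "Cod C g"] dom_obj cod_obj
    comm_monoid.m_comm[OF comm_group.axioms(1), of "hom_group C (Dom C g) (Cod C g)" f g]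
  by (auto simp: Hom_def)

lemma add_left_comm: "f \<in> Arr C \<Longrightarrow> g \<in> Arr C \<Longrightarrow> h \<in> Arr C \<Longrightarrow> Dom C f = Dom C g \<Longrightarrow> Cod C f = Cod C g \<Longrightarrow>
   Dom C g = Dom C h \<Longrightarrow> Cod C g = Cod C h \<Longrightarrow> f \<^bold>+ (g \<^bold>+ h) = g \<^bold>+ (f \<^bold>+ h)"
  using add_assoc[of f g h] add_assoc[of g f h] add_comm[of f g] by simp

lemma zero_add: "f \<in> Arr C \<Longrightarrow> Dom C f = A \<Longrightarrow> Cod C f = B \<Longrightarrow> Zero C A B \<^bold>+ f = f"
  using hom_group_facts[of "Dom C f" "Cod C f"] dom_obj cod_obj
    monoid.l_one[OF group.is_monoid[OF comm_group.axioms(2)], of "hom_group C (Dom C f) (Cod C f)"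
        f]
  by (auto simp: Hom_def)

lemma add_zero: "f \<in> Arr C \<Longrightarrow> Dom C f = A \<Longrightarrow> Cod C f = B \<Longrightarrow> f \<^bold>+ Zero C A B = f"
  using zero_add[of f A B] add_comm[of f "Zero C A B"] zero_arr dom_zero cod_zero dom_obj cod_obj
      by metis

lemma neg_hom: "f \<in> Hom C A B \<Longrightarrow> Neg C f \<in> Hom C A B"
  using Hom_obj[of f A B] hom_group_facts[of A B] group.inv_closed[OF comm_group.axioms(2), of
      "hom_group C A B" f]
  by (auto simp: Neg_def Hom_def)

lemma neg_arr: "f \<in> Arr C \<Longrightarrow> Neg C f \<in> Arr C"
  and dom_neg: "f \<in> Arr C \<Longrightarrow> Dom C (Neg C f) = Dom C f"
  and cod_neg: "f \<in> Arr C \<Longrightarrow> Cod C (Neg C f) = Cod C f"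
  using neg_hom[of f "Dom C f" "Cod C f"] by (auto simp: Hom_def)

lemma neg_add: "f \<in> Arr C \<Longrightarrow> Neg C f \<^bold>+ f = Zero C (Dom C f) (Cod C f)"
  using hom_group_facts[of "Dom C f" "Cod C f"] dom_obj cod_obj
    group.l_inv[OF comm_group.axioms(2), of "hom_group C (Dom C f) (Cod C f)" f]
  by (auto simp: Hom_def Neg_def)

lemma add_neg: "f \<in> Arr C \<Longrightarrow> f \<^bold>+ Neg C f = Zero C (Dom C f) (Cod C f)"
  using neg_add add_comm[of f "Neg C f"] neg_arr dom_neg cod_neg by simp

lemma neg_add_cancel: "f \<in> Arr C \<Longrightarrow> g \<in> Arr C \<Longrightarrow> Dom C f = Dom C g \<Longrightarrow> Cod C f = Cod C g \<Longrightarrow>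
    Neg C f \<^bold>+ (f \<^bold>+ g) = g"
  and add_neg_cancel: "f \<in> Arr C \<Longrightarrow> g \<in> Arr C \<Longrightarrow> Dom C f = Dom C g \<Longrightarrow> Cod C f = Cod C g \<Longrightarrow>
      f \<^bold>+ (Neg C f \<^bold>+ g) = g"
  using add_assoc[of "Neg C f" f g] add_assoc[of f "Neg C f" g] neg_add[of f] add_neg[of f] zero_add
  by (auto simp: neg_arr dom_neg cod_neg)

lemma add_left_cancel:
  assumes "f \<^bold>+ g = f \<^bold>+ h" "f \<in> Arr C" "g \<in> Arr C" "h \<in> Arr C" "Dom C f = Dom C g" "Cod C f =
      Cod C g"
    "Dom C f = Dom C h" "Cod C f = Cod C h"
  shows "g = h"
  using assms neg_add_cancel by metis

lemma eq_neg: "f \<^bold>+ g = Zero C A B \<Longrightarrow> f \<in> Arr C \<Longrightarrow> g \<in> Arr C \<Longrightarrow> Dom C f = A \<Longrightarrow> Dom C g = A \<Longrightarrow>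
   Cod C f = B \<Longrightarrow> Cod C g = B \<Longrightarrow> g = Neg C f"
  by (rule add_left_cancel[of f]) (simp_all add: add_neg neg_arr dom_neg cod_neg)

lemma comp_add: "f \<in> Arr C \<Longrightarrow> f' \<in> Arr C \<Longrightarrow> g \<in> Arr C \<Longrightarrow> Dom C f = Dom C f' \<Longrightarrow> Cod C f = Cod C f' \<Longrightarrow>
    Dom C g = Cod C f' \<Longrightarrow> g \<cdot> (f \<^bold>+ f') = (g \<cdot> f) \<^bold>+ (g \<cdot> f')"
  using comp_add_right[of f "Dom C f" "Cod C f" f' g "Cod C g"] by (auto simp: Hom_def)

lemma add_comp: "f \<in> Arr C \<Longrightarrow> g \<in> Arr C \<Longrightarrow> g' \<in> Arr C \<Longrightarrow> Dom C g = Dom C g' \<Longrightarrow> Cod C g = Cod C g' \<Longrightarrow>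
    Dom C g' = Cod C f \<Longrightarrow> (g \<^bold>+ g') \<cdot> f = (g \<cdot> f) \<^bold>+ (g' \<cdot> f)"
  using comp_add_left[of f "Dom C f" "Cod C f" g "Cod C g" g'] by (auto simp: Hom_def)

lemma idem_zero: "f \<^bold>+ f = f \<Longrightarrow> f \<in> Arr C \<Longrightarrow> f = Zero C (Dom C f) (Cod C f)"
  by (rule add_left_cancel[of f]) (simp_all add: add_zero zero_arr dom_zero cod_zero dom_obj
      cod_obj)

lemma comp_zero: "g \<in> Arr C \<Longrightarrow> A \<in> Obj C \<Longrightarrow> Dom C g = B \<Longrightarrow> g \<cdot> Zero C A B = Zero C A (Cod C g)"
  using comp_add[of "Zero C A B" "Zero C A B" g] idem_zero[of "g \<cdot> Zero C A B"]
  by (auto simp: zero_arr dom_zero cod_zero dom_obj cod_obj cat_simps zero_add)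

lemma zero_comp: "f \<in> Arr C \<Longrightarrow> B \<in> Obj C \<Longrightarrow> Cod C f = A \<Longrightarrow> Zero C A B \<cdot> f = Zero C (Dom C f) B"
  using add_comp[of f "Zero C A B" "Zero C A B"] idem_zero[of "Zero C A B \<cdot> f"]
  by (auto simp: zero_arr dom_zero cod_zero dom_obj cod_obj cat_simps zero_add)

lemma comp_neg: "f \<in> Arr C \<Longrightarrow> g \<in> Arr C \<Longrightarrow> Cod C f = Dom C g \<Longrightarrow> g \<cdot> Neg C f = Neg C (g \<cdot> f)"
  by (rule eq_neg[of _ _ "Dom C f" "Cod C g"])
    (simp_all add: comp_add[symmetric] cat_simps neg_arr dom_neg cod_neg add_neg comp_zero dom_obj)

lemma neg_comp: "f \<in> Arr C \<Longrightarrow> g \<in> Arr C \<Longrightarrow> Cod C f = Dom C g \<Longrightarrow> Neg C g \<cdot> f = Neg C (g \<cdot> f)"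
  by (rule eq_neg[of _ _ "Dom C f" "Cod C g"])
    (simp_all add: add_comp[symmetric] cat_simps neg_arr dom_neg cod_neg add_neg zero_comp cod_obj)

lemma neg_zero: "A \<in> Obj C \<Longrightarrow> B \<in> Obj C \<Longrightarrow> Neg C (Zero C A B) = Zero C A B"
  by (rule eq_neg[symmetric]) (auto simp: zero_arr dom_zero cod_zero zero_add)

lemma neg_neg: "f \<in> Arr C \<Longrightarrow> Neg C (Neg C f) = f"
  by (rule eq_neg[symmetric]) (auto simp: neg_arr dom_neg cod_neg neg_add)

lemma neg_distrib: "f \<in> Arr C \<Longrightarrow> g \<in> Arr C \<Longrightarrow> Dom C f = Dom C g \<Longrightarrow> Cod C f = Cod C g \<Longrightarrow>
    Neg C (f \<^bold>+ g) = Neg C f \<^bold>+ Neg C g"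
  by (rule eq_neg[symmetric, of _ _ "Dom C g" "Cod C g"])
     (auto simp: neg_arr dom_neg cod_neg add_arr dom_add cod_add add_assoc add_neg add_neg_cancel
        add_left_comm[of g "Neg C f"] zero_arr dom_zero cod_zero add_zero dom_obj cod_obj)

text \<open>A normal form: composites nested to the right and distributed over sums, negation moved
  out of composites and into sums. The side conditions on domains and codomains are discharged by
  the facts that the proofs below collect under the name \<open>ty\<close>.\<close>

lemmas add_simps = cat_simps zero_arr dom_zero cod_zero add_arr dom_add cod_add neg_arr dom_neg
    cod_neg
  add_assoc zero_add add_zero neg_add add_neg neg_add_cancel add_neg_cancel comp_add add_comp
      comp_zero
  zero_comp comp_neg neg_comp neg_zero neg_neg neg_distrib

lemmas add_ac = add_comm add_left_comm

end


section \<open>Exactness tested on generalized elements\<close>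

text \<open>When kernels exist, the single test element given by the kernel of
  \<open>dif X j\<close> already shows that the map from degree \<open>j + 1\<close> to the cycles
  in degree \<open>j\<close> is an admissible epimorphism. Letting \<open>T\<close> vary is what
  makes diagram chases possible.\<close>

definition exact_at :: "('o, 'm, 'z) excat_scheme \<Rightarrow> ('o, 'm) cplx \<Rightarrow> int \<Rightarrow> bool" where
  "exact_at E X j \<longleftrightarrow>
     (\<forall>T z. z \<in> Hom E T (ent X j) \<and> dif X j \<cdot>\<^bsub>E\<^esub> z = Zero E T (ent X (j - 1)) \<longrightarrow>
        (\<exists>T' q y. q \<in> Hom E T' T \<and> adm_epic E q \<and> y \<in> Hom E T' (ent X (j + 1)) \<and>
           dif X (j + 1) \<cdot>\<^bsub>E\<^esub> y = z \<cdot>\<^bsub>E\<^esub> q))"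

context additive_category
begin

text \<open>The index equation is a premise so that the rules apply however the lower degree happens
  to be written, for instance \<open>j - 1\<close> below \<open>j\<close> or \<open>j\<close> below
  \<open>j + 1\<close>.\<close>

lemma cplxD:
  assumes "is_complex C X"
  shows "ent X n \<in> Obj C" "dif X n \<in> Arr C" "Dom C (dif X n) = ent X n" "Cod C (dif X n) =
      ent X (n - 1)"
    "m = n - 1 \<Longrightarrow> dif X m \<cdot> dif X n = Zero C (ent X n) (ent X (m - 1))"
    "m = n - 1 \<Longrightarrow> h \<in> Arr C \<Longrightarrow> Cod C h = ent X n \<Longrightarrow>
       dif X m \<cdot> (dif X n \<cdot> h) = Zero C (Dom C h) (ent X (m - 1))"
proof -
  show *: "ent X n \<in> Obj C" "dif X n \<in> Arr C" "Dom C (dif X n) = ent X n" "Cod C (dif X n) =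
      ent X (n - 1)"
    for n
    using assms by (auto simp: is_complex_def Hom_def)
  show dd: "dif X m \<cdot> dif X n = Zero C (ent X n) (ent X (m - 1))" if "m = n - 1" for m
    using assms that by (auto simp: is_complex_def Hom_def)
  show "dif X m \<cdot> (dif X n \<cdot> h) = Zero C (Dom C h) (ent X (m - 1))"
    if "m = n - 1" "h \<in> Arr C" "Cod C h = ent X n"
    using comp_reassoc[OF dd[OF that(1)], of h] * that by (simp add: zero_comp)
qed

lemma chain_mapD:
  assumes "is_chain_map C (A, B, f)"
  shows "is_complex C A" "is_complex C B" "f n \<in> Arr C" "Dom C (f n) = ent A n" "Cod C (f n) =
      ent B n"
    "dif B n \<cdot> f n = f (n - 1) \<cdot> dif A n"
    "h \<in> Arr C \<Longrightarrow> Cod C h = ent A n \<Longrightarrow> dif B n \<cdot> (f n \<cdot> h) = f (n - 1) \<cdot> (dif A n \<cdot> h)"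
proof -
  show *: "is_complex C A" "is_complex C B" "f n \<in> Arr C" "Dom C (f n) = ent A n" "Cod C (f n) =
      ent B n"
    "dif B n \<cdot> f n = f (n - 1) \<cdot> dif A n" for n
    using assms by (auto simp: is_chain_map_def Hom_def)
  show "dif B n \<cdot> (f n \<cdot> h) = f (n - 1) \<cdot> (dif A n \<cdot> h)" if "h \<in> Arr C" "Cod C h = ent A n"
    using comp_reassoc[OF *(6), of n h] *(3-5) cplxD[OF *(1)] cplxD[OF *(2)] that
        by (simp add: assoc)
qed

lemma chain_mapI:
  assumes "is_complex C A" "is_complex C B" "\<And>n. f n \<in> Hom C (ent A n) (ent B n)"
    "\<And>n. dif B n \<cdot> f n = f (n - 1) \<cdot> dif A n"
  shows "is_chain_map C (A, B, f)"
  using assms by (simp add: is_chain_map_def)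

lemma zero_objD:
  assumes "is_zero_obj C Z"
  shows "Z \<in> Obj C"
    "f \<in> Arr C \<Longrightarrow> Cod C f = Z \<Longrightarrow> f = Zero C (Dom C f) Z"
    "f \<in> Arr C \<Longrightarrow> Dom C f = Z \<Longrightarrow> f = Zero C Z (Cod C f)"
proof -
  show Z: "Z \<in> Obj C" using assms by (simp add: is_zero_obj_def)
  show "f = Zero C (Dom C f) Z" if "f \<in> Arr C" "Cod C f = Z"
  proof -
    have "\<exists>!g. g \<in> Hom C (Dom C f) Z" using assms that dom_obj by (simp add: is_zero_obj_def)
    moreover have "f \<in> Hom C (Dom C f) Z" "Zero C (Dom C f) Z \<in> Hom C (Dom C f) Z"
      using that Z by (simp_all add: Hom_def add_simps)
    ultimately show ?thesis by blast
  qed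
  show "f = Zero C Z (Cod C f)" if "f \<in> Arr C" "Dom C f = Z"
  proof -
    have "\<exists>!g. g \<in> Hom C Z (Cod C f)" using assms that cod_obj by (simp add: is_zero_obj_def)
    moreover have "f \<in> Hom C Z (Cod C f)" "Zero C Z (Cod C f) \<in> Hom C Z (Cod C f)"
      using that Z by (simp_all add: Hom_def add_simps)
    ultimately show ?thesis by blast
  qed
qed

lemma kernelD:
  assumes "is_kernel C f \<kappa>"
  shows "f \<in> Arr C" "\<kappa> \<in> Arr C" "Cod C \<kappa> = Dom C f" "f \<cdot> \<kappa> = Zero C (Dom C \<kappa>) (Cod C f)"
  using assms by (simp_all add: is_kernel_def)

lemma kernel_lift:
  assumes "is_kernel C f \<kappa>" "u \<in> Hom C T (Dom C f)" "f \<cdot> u = Zero C T (Cod C f)"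
  shows "\<exists>h \<in> Hom C T (Dom C \<kappa>). \<kappa> \<cdot> h = u"
  using assms Hom_obj[OF assms(2)] unfolding is_kernel_def by blast

lemma kernel_monic:
  assumes "is_kernel C f \<kappa>" "h \<in> Hom C T (Dom C \<kappa>)" "h' \<in> Hom C T (Dom C \<kappa>)" "\<kappa> \<cdot> h = \<kappa> \<cdot> h'"
  shows "h = h'"
proof -
  note k = kernelD[OF assms(1)]
  have "f \<cdot> (\<kappa> \<cdot> h) = Zero C T (Cod C f)"
    using k assms(2) comp_reassoc[OF k(4), of h] by (simp add: Hom_def add_simps)
  moreover have "\<kappa> \<cdot> h \<in> Hom C T (Dom C f)"
    using k assms(2) by (simp add: Hom_def add_simps)
  ultimately have "\<exists>!g. g \<in> Hom C T (Dom C \<kappa>) \<and> \<kappa> \<cdot> g = \<kappa> \<cdot> h"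
    using assms(1) Hom_obj[OF assms(2)] unfolding is_kernel_def by blast
  with assms(2-4) show ?thesis by metis
qed

lemma kernelI:
  assumes "f \<in> Arr C" "\<kappa> \<in> Arr C" "Cod C \<kappa> = Dom C f" "f \<cdot> \<kappa> = Zero C (Dom C \<kappa>) (Cod C f)"
    "\<And>T u. u \<in> Hom C T (Dom C f) \<Longrightarrow> f \<cdot> u = Zero C T (Cod C f) \<Longrightarrow> \<exists>h \<in> Hom C T (Dom C \<kappa>). \<kappa> \<cdot> h = u"
    "\<And>T h h'. h \<in> Hom C T (Dom C \<kappa>) \<Longrightarrow> h' \<in> Hom C T (Dom C \<kappa>) \<Longrightarrow> \<kappa> \<cdot> h = \<kappa> \<cdot> h' \<Longrightarrow> h = h'"
  shows "is_kernel C f \<kappa>"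
  unfolding is_kernel_def using assms by (metis (no_types, lifting))

text \<open>Since \<open>\<mu>\<close> is monic, composing with it does not change which elements
  \<open>e\<close> kills. It is applied to a differential \<open>\<mu> \<cdot> e\<close>
  corestricted to the cycles.\<close>

lemma kernel_of_comp_kernel:
  assumes "is_kernel C g \<mu>" "e \<in> Hom C A (Dom C \<mu>)" "is_kernel C (\<mu> \<cdot> e) \<kappa>"
  shows "is_kernel C e \<kappa>"
proof -
  note m = kernelD[OF assms(1)] and k = kernelD[OF assms(3)]
  have e: "e \<in> Arr C" "Dom C e = A" "Cod C e = Dom C \<mu>" using assms(2) by (auto simp: Hom_def)
  have ko: "Cod C \<kappa> = A" using k e m by (simp add: add_simps)
  show ?thesis
  proof (rule kernelI)
    have "\<mu> \<cdot> (e \<cdot> \<kappa>) = \<mu> \<cdot> Zero C (Dom C \<kappa>) (Cod C e)"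
      using k e m ko by (simp add: add_simps)
    then show "e \<cdot> \<kappa> = Zero C (Dom C \<kappa>) (Cod C e)"
      by (rule kernel_monic[OF assms(1), rotated -1]) (use e k m ko in \<open>simp_all add: Hom_def
          add_simps\<close>)
  next
    fix T u assume u: "u \<in> Hom C T (Dom C e)" "e \<cdot> u = Zero C T (Cod C e)"
    then have "(\<mu> \<cdot> e) \<cdot> u = Zero C T (Cod C (\<mu> \<cdot> e))" "u \<in> Hom C T (Dom C (\<mu> \<cdot> e))"
      using e m Hom_obj[OF u(1)] by (auto simp: Hom_def add_simps)
    then show "\<exists>h\<in>Hom C T (Dom C \<kappa>). \<kappa> \<cdot> h = u"
      using kernel_lift[OF assms(3)] by metis
  next
    fix T h h' assume "h \<in> Hom C T (Dom C \<kappa>)" "h' \<in> Hom C T (Dom C \<kappa>)" "\<kappa> \<cdot> h = \<kappa> \<cdot> h'"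
    then show "h = h'" using kernel_monic[OF assms(3)] by metis
  qed (use e k m ko in auto)
qed

lemma kernel_unique:
  assumes "is_kernel C f \<kappa>" "is_kernel C f \<kappa>'"
  obtains a where "iso_arr C a" "a \<in> Hom C (Dom C \<kappa>) (Dom C \<kappa>')" "\<kappa>' \<cdot> a = \<kappa>"
proof -
  note k = kernelD[OF assms(1)] and k' = kernelD[OF assms(2)]
  obtain a where a: "a \<in> Hom C (Dom C \<kappa>) (Dom C \<kappa>')" "\<kappa>' \<cdot> a = \<kappa>"
    using kernel_lift[OF assms(2), of \<kappa> "Dom C \<kappa>"] k by (auto simp: Hom_def)
  obtain b where b: "b \<in> Hom C (Dom C \<kappa>') (Dom C \<kappa>)" "\<kappa> \<cdot> b = \<kappa>'"
    using kernel_lift[OF assms(1), of \<kappa>' "Dom C \<kappa>'"] k' by (auto simp: Hom_def)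
  have ab: "a \<in> Arr C" "Dom C a = Dom C \<kappa>" "Cod C a = Dom C \<kappa>'" "b \<in> Arr C" "Dom C b = Dom C \<kappa>'"
      "Cod C b = Dom C \<kappa>"
    using a b by (auto simp: Hom_def)
  have "\<kappa> \<cdot> (b \<cdot> a) = \<kappa> \<cdot> Ident C (Dom C \<kappa>)"
    using comp_reassoc[OF b(2), of a] a(2) ab k by (simp add: add_simps)
  then have 1: "b \<cdot> a = Ident C (Dom C \<kappa>)"
    by (rule kernel_monic[OF assms(1), rotated -1]) (use ab k in \<open>simp_all add: Hom_def add_simps\<close>)
  have "\<kappa>' \<cdot> (a \<cdot> b) = \<kappa>' \<cdot> Ident C (Dom C \<kappa>')"
    using comp_reassoc[OF a(2), of b] b(2) ab k' by (simp add: add_simps)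
  then have 2: "a \<cdot> b = Ident C (Dom C \<kappa>')"
    by (rule kernel_monic[OF assms(2), rotated -1]) (use ab k' in \<open>simp_all add: Hom_def add_simps\<close>)
  have "iso_arr C a" unfolding iso_arr_def using ab b(1) 1 2 by auto
  with a that show ?thesis by blast
qed

lemma iso_id: "A \<in> Obj C \<Longrightarrow> iso_arr C (Ident C A)"
  unfolding iso_arr_def by (auto simp: Hom_def add_simps intro!: bexI[of _ "Ident C A"])

end

context exact_category
begin

text \<open>Admissible epimorphisms act as surjections on generalized elements: the refinement
  \<open>q\<close> is the base change of \<open>p\<close> along \<open>h\<close>.\<close>

lemma adm_epic_lift:
  assumes "adm_epic E p" "p \<in> Hom E A B" "h \<in> Hom E T B"
  obtains T' q y where "q \<in> Hom E T' T" "adm_epic E q" "y \<in> Hom E T' A" "p \<cdot> y = h \<cdot> q"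
proof -
  have h: "h \<in> Arr E" "Cod E h = Cod E p" "Dom E h = T" "Dom E p = A"
      using assms by (auto simp: Hom_def)
  from base_change_exists[OF assms(1) h(1,2)] obtain f' p' where pb: "is_pullback E h p f' p'"
      by blast
  from base_change_adm_epic[OF assms(1) pb] have "adm_epic E p'" .
  with pb that[of p' "Dom E f'" f'] h show ?thesis unfolding is_pullback_def by auto
qed

text \<open>Kernels are unique up to isomorphism, and \<open>Ses\<close> is closed under
  isomorphism.\<close>

lemma ses_kernelI:
  assumes "adm_epic E p" "is_kernel E p \<kappa>"
  shows "(\<kappa>, p) \<in> Ses E"
proof -
  from assms(1) obtain i where i: "(i, p) \<in> Ses E" unfolding adm_epic_def by blast
  note ki = ses_kernel[OF i]
  note k = kernelD[OF assms(2)] and k' = kernelD[OF ki]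
  obtain a where a: "iso_arr E a" "a \<in> Hom E (Dom E i) (Dom E \<kappa>)" "\<kappa> \<cdot> a = i"
    using kernel_unique[OF ki assms(2)] .
  show ?thesis
    by (rule ses_iso[OF i a(1) iso_id iso_id, of "Cod E i" "Cod E p"])
       (use k k' a in \<open>auto simp: Hom_def add_simps\<close>)
qed

text \<open>A cycle is killed by \<open>e j\<close>, because \<open>i (j - 1)\<close> is monic;
  hence it factors through \<open>i j\<close>, and the factor lifts locally along the admissible
  epimorphism \<open>e (j + 1)\<close>.\<close>

lemma acyclic_imp_exact_at:
  assumes "acyclic_complex E X"
  shows "exact_at E X j"
  unfolding exact_at_def
proof (intro allI impI, elim conjE)
  fix T z assume z: "z \<in> Hom E T (ent X j)" "dif X j \<cdot> z = Zero E T (ent X (j - 1))"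
  from assms obtain Z i e where X: "is_complex E X"
    and ie: "\<And>n. e n \<in> Hom E (ent X n) (Z (n - 1))" "\<And>n. i n \<in> Hom E (Z n) (ent X n)"
    "\<And>n. (i n, e n) \<in> Ses E" "\<And>n. dif X n = i (n - 1) \<cdot> e n"
    unfolding acyclic_complex_def by blast
  have h: "e n \<in> Arr E" "Dom E (e n) = ent X n" "Cod E (e n) = Z (n - 1)"
    "i n \<in> Arr E" "Dom E (i n) = Z n" "Cod E (i n) = ent X n" for n
    using ie by (auto simp: Hom_def)
  have zz: "z \<in> Arr E" "Dom E z = T" "Cod E z = ent X j" "T \<in> Obj E"
    using z Hom_obj[OF z(1)] by (auto simp: Hom_def)
  have Zo: "Z n \<in> Obj E" for n using h dom_obj by metis
  have "i (j - 1) \<cdot> (e j \<cdot> z) = i (j - 1) \<cdot> Zero E T (Z (j - 1))"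
    using z(2) ie(4)[of j] h zz by (simp add: add_simps)
  then have "e j \<cdot> z = Zero E T (Z (j - 1))"
    by (rule kernel_monic[OF ses_kernel[OF ie(3)], rotated -1])
       (use h zz Zo in \<open>simp_all add: Hom_def add_simps\<close>)
  then obtain w where w: "w \<in> Hom E T (Z j)" "i j \<cdot> w = z"
    using kernel_lift[OF ses_kernel[OF ie(3)], of z T j] h zz by (auto simp: Hom_def)
  have "adm_epic E (e (j + 1))" "e (j + 1) \<in> Hom E (ent X (j + 1)) (Z j)"
    using ie(3) h unfolding adm_epic_def by (auto simp: Hom_def)
  from adm_epic_lift[OF this w(1)] obtain T' q y where
    q: "q \<in> Hom E T' T" "adm_epic E q" "y \<in> Hom E T' (ent X (j + 1))" "e (j + 1) \<cdot> y = w \<cdot> q" .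
  have "dif X (j + 1) \<cdot> y = z \<cdot> q"
    using ie(4)[of "j + 1"] h w q comp_reassoc[OF w(2), of q] by (auto simp: Hom_def add_simps)
  with q show "\<exists>T' q y. q \<in> Hom E T' T \<and> adm_epic E q \<and> y \<in> Hom E T' (ent X (j + 1)) \<and>
      dif X (j + 1) \<cdot> y = z \<cdot> q"
    by blast
qed

end

section \<open>Acyclicity and truncations in the presence of kernels\<close>

locale exact_category_with_kernels = exact_category +
  assumes kernels: "has_kernels E"
begin

lemma kernel_ex: "f \<in> Arr E \<Longrightarrow> \<exists>\<kappa>. is_kernel E f \<kappa>"
  using kernels by (simp add: has_kernels_def)

text \<open>The cancellation axiom asks for a kernel of \<open>f\<close>, which now always exists.
  This is what turns surjectivity on generalized elements into admissibility.\<close>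

lemma adm_epic_cancel_right:
  assumes "f \<in> Arr E" "g \<in> Arr E" "Cod E g = Dom E f" "adm_epic E (f \<cdot> g)"
  shows "adm_epic E f"
  using adm_epic_cancel assms kernel_ex by blast

text \<open>The objects \<open>Z n\<close> are the kernels of the differentials. Exactness tested on
  the inclusion \<open>\<kappa> (n - 1)\<close> of the cycles yields
  \<open>e n \<cdot> y = q\<close> with \<open>q\<close> an admissible epimorphism, so the
  corestricted differential \<open>e n\<close> is one by cancellation.\<close>

lemma acyclicI:
  assumes X: "is_complex E X" and ex: "\<And>j. exact_at E X j"
  shows "acyclic_complex E X"
proof -
  note d = cplxD[OF X]
  have "\<forall>n. \<exists>\<kappa>. is_kernel E (dif X n) \<kappa>" using kernel_ex d by blast
  then obtain \<kappa> where \<kappa>: "\<And>n. is_kernel E (dif X n) (\<kappa> n)" by metis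
  note k = kernelD(2-4)[OF \<kappa>, unfolded d]
  have "\<exists>e \<in> Hom E (ent X n) (Dom E (\<kappa> (n - 1))). \<kappa> (n - 1) \<cdot> e = dif X n" for n
    using kernel_lift[OF \<kappa>[of "n - 1"], of "dif X n" "ent X n"] d by (auto simp: Hom_def)
  then obtain e where e: "\<And>n. e n \<in> Hom E (ent X n) (Dom E (\<kappa> (n - 1)))" "\<And>n. \<kappa> (n - 1) \<cdot> e n =
      dif X n"
    by metis
  have h: "e n \<in> Arr E" "Dom E (e n) = ent X n" "Cod E (e n) = Dom E (\<kappa> (n - 1))" for n
    using e by (auto simp: Hom_def)
  have ke: "is_kernel E (e n) (\<kappa> n)" for n
    by (rule kernel_of_comp_kernel[OF \<kappa> e(1)]) (simp add: e \<kappa>)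
  have epi: "adm_epic E (e n)" for n
  proof -
    have "\<kappa> (n - 1) \<in> Hom E (Dom E (\<kappa> (n - 1))) (ent X (n - 1))"
      "dif X (n - 1) \<cdot> \<kappa> (n - 1) = Zero E (Dom E (\<kappa> (n - 1))) (ent X (n - 1 - 1))"
      using k by (auto simp: Hom_def)
    then obtain T' q y where q: "q \<in> Hom E T' (Dom E (\<kappa> (n - 1)))" "adm_epic E q"
        "y \<in> Hom E T' (ent X n)"
      "dif X n \<cdot> y = \<kappa> (n - 1) \<cdot> q"
      using ex[of "n - 1"] unfolding exact_at_def by fastforce
    have "\<kappa> (n - 1) \<cdot> (e n \<cdot> y) = \<kappa> (n - 1) \<cdot> q"
      using comp_reassoc[OF e(2), of n y] q h k by (simp add: Hom_def)
    then have "e n \<cdot> y = q"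
      by (rule kernel_monic[OF \<kappa>, rotated -1]) (use q h in \<open>auto simp: Hom_def add_simps\<close>)
    then show ?thesis using adm_epic_cancel_right[of "e n" y] q h by (simp add: Hom_def)
  qed
  show ?thesis unfolding acyclic_complex_def
  proof (intro conjI X exI allI)
    fix n
    show "e n \<in> Hom E (ent X n) (Dom E (\<kappa> (n - 1)))" by fact
    show "\<kappa> n \<in> Hom E (Dom E (\<kappa> n)) (ent X n)" using k by (simp add: Hom_def)
    show "(\<kappa> n, e n) \<in> Ses E" using ses_kernelI[OF epi ke] .
    show "dif X n = \<kappa> (n - 1) \<cdot> e n" using e by simp
  qed
qed

text \<open>Acyclicity of the truncation in degree \<open>k\<close> means that the differential of X
  maps onto the kernel of \<open>dif X k\<close>. Therefore the bound degree \<open>j = k\<close>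
  itself is included.\<close>

lemma homologically_le_imp_exact_at:
  assumes "homologically_le E k X" "k \<le> j"
  shows "exact_at E X j"
  unfolding exact_at_def
proof (intro allI impI, elim conjE)
  fix T z assume z: "z \<in> Hom E T (ent X j)" "dif X j \<cdot> z = Zero E T (ent X (j - 1))"
  from assms(1) obtain Y \<kappa> where X: "is_complex E X" and Y: "is_complex E Y" "acyclic_complex E Y"
    and Ym: "\<And>m. m > k \<Longrightarrow> ent Y m = ent X m" "\<And>m. m > k + 1 \<Longrightarrow> dif Y m = dif X m"
    and \<kappa>: "is_kernel E (dif X k) \<kappa>" "Dom E \<kappa> = ent Y k" "\<kappa> \<cdot> dif Y (k + 1) = dif X (k + 1)"
      and Ym0: "\<And>m. m < k \<Longrightarrow> is_zero_obj E (ent Y m)"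
    unfolding homologically_le_def is_truncation_def by auto
  note d = cplxD[OF X] and d' = cplxD[OF Y(1)] and kk = kernelD(2-4)[OF \<kappa>(1), unfolded d \<kappa>(2)]
  have zz: "z \<in> Arr E" "Dom E z = T" "Cod E z = ent X j" "T \<in> Obj E"
    using z Hom_obj[OF z(1)] by (auto simp: Hom_def)
  show "\<exists>T' q y. q \<in> Hom E T' T \<and> adm_epic E q \<and> y \<in> Hom E T' (ent X (j + 1)) \<and>
      dif X (j + 1) \<cdot> y = z \<cdot> q"
  proof (cases "j = k")
    case True
    then obtain w where w: "w \<in> Hom E T (ent Y j)" "\<kappa> \<cdot> w = z"
      using kernel_lift[OF \<kappa>(1), of z T] \<kappa>(2) zz z d by (auto simp: Hom_def)
    \<comment> \<open>Automatic: the truncation vanishes below degree \<open>k\<close>.\<close>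
    have "dif Y j \<cdot> w = Zero E T (ent Y (j - 1))"
      using zero_objD(2)[OF Ym0[of "j - 1"], of "dif Y j \<cdot> w"] w(1) True d'
          by (auto simp: Hom_def add_simps)
    with acyclic_imp_exact_at[OF Y(2), of j] w(1) obtain T' q y where
      q: "q \<in> Hom E T' T" "adm_epic E q" "y \<in> Hom E T' (ent Y (j + 1))" "dif Y (j + 1) \<cdot> y = w \<cdot> q"
      unfolding exact_at_def by blast
    have "dif X (j + 1) \<cdot> y = z \<cdot> q"
      using comp_reassoc[OF \<kappa>(3), of y] comp_reassoc[OF w(2), of q] q w(1) d' kk True \<kappa>(2)
          by (auto simp: Hom_def)
    then show ?thesis using q Ym(1)[of "j + 1"] True by auto
  next
    case False
    then have j: "j > k" using assms by simp
    have "dif Y j \<cdot> z = Zero E T (ent Y (j - 1))"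
    proof (cases "j = k + 1")
      case True
      \<comment> \<open>In degree \<open>k + 1\<close> the truncation has the corestricted
        differential, so the cycle condition has to be cancelled through the monic
        \<open>\<kappa>\<close>.\<close>
      have "\<kappa> \<cdot> (dif Y j \<cdot> z) = \<kappa> \<cdot> Zero E T (ent Y (j - 1))"
        using comp_reassoc[OF \<kappa>(3), of z] z(2) zz d' kk True \<kappa>(2) Ym(1)[of j]
            by (auto simp: add_simps)
      then show ?thesis
        by (rule kernel_monic[OF \<kappa>(1), rotated -1]) (use zz d' True \<kappa> Ym(1)[of j] in \<open>auto simp:
            Hom_def add_simps\<close>)
    qed (use j Ym z in simp)
    with acyclic_imp_exact_at[OF Y(2), of j] z(1) j Ym show ?thesis
      unfolding exact_at_def by simp
  qed
qed

text \<open>The truncation is zero below \<open>k\<close>, starts with a chosen kernel of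
  \<open>dif X k\<close>, has the corestriction \<open>e\<close> as differential in degree
  \<open>k + 1\<close>, and agrees with X above. Exactness of X at \<open>k\<close> makes
  \<open>e\<close> locally surjective.\<close>

lemma homologically_leI:
  assumes X: "is_complex E X" and ex: "\<And>j. k \<le> j \<Longrightarrow> exact_at E X j"
  shows "homologically_le E k X"
proof -
  note d = cplxD[OF X]
  obtain \<kappa> where \<kappa>: "is_kernel E (dif X k) \<kappa>" using kernel_ex d by blast
  note kk = kernelD(2-4)[OF \<kappa>, unfolded d]
  obtain Zo where Zo: "is_zero_obj E Zo" using zero_obj_exists by blast
  obtain e where e: "e \<in> Hom E (ent X (k + 1)) (Dom E \<kappa>)" "\<kappa> \<cdot> e = dif X (k + 1)"
    using kernel_lift[OF \<kappa>, of "dif X (k + 1)" "ent X (k + 1)"] d by (auto simp: Hom_def)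
  note ee = e(1)[unfolded Hom_def, simplified]
  let ?ent = "\<lambda>m. if m < k then Zo else if m = k then Dom E \<kappa> else ent X m"
  define Y where "Y = \<lparr>ent = ?ent,
    dif = \<lambda>m. if m > k + 1 then dif X m else if m = k + 1 then e else Zero E (?ent m) (?ent (m -
        1))\<rparr>"
  have Yo: "ent Y m \<in> Obj E" for m
    using zero_objD[OF Zo] kk d by (auto simp: Y_def add_simps)
  have Y1: "m < k \<Longrightarrow> is_zero_obj E (ent Y m)" for m using Zo by (simp add: Y_def)
  have Y2: "m > k \<Longrightarrow> ent Y m = ent X m" for m by (simp add: Y_def)
  have Y3: "m > k + 1 \<Longrightarrow> dif Y m = dif X m" for m by (simp add: Y_def)
  have Y4: "ent Y k = Dom E \<kappa>" "dif Y (k + 1) = e" by (simp_all add: Y_def)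
  have Y5: "m \<le> k \<Longrightarrow> dif Y m = Zero E (ent Y m) (ent Y (m - 1))" for m by (simp add: Y_def)
  have cases: "m \<le> k \<or> m = k + 1 \<or> m > k + 1" for m by linarith
  have Yd: "dif Y m \<in> Hom E (ent Y m) (ent Y (m - 1))" for m
    using cases[of m] Y2[of m] Y2[of "m - 1"] Y3[of m] Y4 Y5[of m] Yo[of m] Yo[of "m - 1"] e(1) d
    by (auto simp: Hom_def add_simps)
  note Yd' = Yd[unfolded Hom_def, simplified]
  have Ydd: "dif Y (m - 1) \<cdot> dif Y m = Zero E (ent Y m) (ent Y (m - 2))" for m
  proof -
    consider "m - 1 \<le> k" | "m = k + 2" | "m > k + 2" by linarith
    then show ?thesis
    proof cases
      case 1
      then show ?thesis using Y5[OF 1] Yd'[of m] Yo by (simp add: add_simps)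
    next
      case 2
      have "\<kappa> \<cdot> (e \<cdot> dif X m) = \<kappa> \<cdot> Zero E (ent X m) (Dom E \<kappa>)"
        using comp_reassoc[OF e(2), of "dif X m"] kk ee 2 d Yo
            by (simp add: add_simps add.commute[of 1 k])
      then have "e \<cdot> dif X m = Zero E (ent X m) (Dom E \<kappa>)"
        by (rule kernel_monic[OF \<kappa>, rotated -1])
          (use d kk ee 2 in \<open>simp_all add: Hom_def add_simps add.commute[of 1 k]\<close>)
      then show ?thesis using 2 Y3[of m] Y4 Y2[of m] by (simp add: add.commute[of 1 k])
    next
      case 3
      then show ?thesis using Y3[of m] Y3[of "m - 1"] d Y2[of m] Y2[of "m - 2"] by simp
    qed
  qed
  have Yc: "is_complex E Y" unfolding is_complex_def using Yo Yd Ydd by blast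
  have "exact_at E Y j" for j
    unfolding exact_at_def
  proof (intro allI impI, elim conjE)
    fix T z assume z: "z \<in> Hom E T (ent Y j)" "dif Y j \<cdot> z = Zero E T (ent Y (j - 1))"
    have zz: "z \<in> Arr E" "Dom E z = T" "Cod E z = ent Y j" "T \<in> Obj E"
      using z Hom_obj[OF z(1)] by (auto simp: Hom_def)
    consider "j < k" | "j = k" | "j = k + 1" | "j > k + 1" by linarith
    then show "\<exists>T' q y. q \<in> Hom E T' T \<and> adm_epic E q \<and> y \<in> Hom E T' (ent Y (j + 1)) \<and>
        dif Y (j + 1) \<cdot> y = z \<cdot> q"
    proof cases
      case 1
      \<comment> \<open>From the decomposition of \<open>T\<close> as the biproduct of
        \<open>Zo\<close> and \<open>T\<close>: the second projection is the identity.\<close>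
      have id: "adm_epic E (Ident E T)"
        unfolding adm_epic_def using ses_split[of Zo T T "Zero E Zo T" "Ident E T" "Zero E T Zo"
            "Ident E T"]
          zero_objD[OF Zo] zero_objD(3)[OF Zo, of "Ident E Zo"] zz
        by (auto simp: is_biproduct_def Hom_def add_simps)
      have "z = Zero E T (ent Y j)" using zero_objD(2)[OF Y1[OF 1], of z] zz by simp
      then show ?thesis
        using id 1 zz Y5[of "j + 1"] Yo Yd'[of "j + 1"]
        by (intro exI[of _ T] exI[of _ "Ident E T"] exI[of _ "Zero E T (ent Y (j + 1))"]) (auto
            simp: Hom_def add_simps)
    next
      case 2
      have "dif X k \<cdot> (\<kappa> \<cdot> z) = Zero E T (ent X (k - 1))" "\<kappa> \<cdot> z \<in> Hom E T (ent X k)"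
        using comp_reassoc[OF kk(3), of z] kk zz 2 Y4 d by (auto simp: Hom_def add_simps)
      with ex[of k] obtain T' q y where q: "q \<in> Hom E T' T" "adm_epic E q"
          "y \<in> Hom E T' (ent X (k + 1))"
        "dif X (k + 1) \<cdot> y = (\<kappa> \<cdot> z) \<cdot> q" unfolding exact_at_def by blast
      have "\<kappa> \<cdot> (e \<cdot> y) = \<kappa> \<cdot> (z \<cdot> q)"
        using comp_reassoc[OF e(2), of y] q ee kk zz Y4 2 by (auto simp: Hom_def add_simps)
      then have "e \<cdot> y = z \<cdot> q"
        by (rule kernel_monic[OF \<kappa>, rotated -1])
          (use q zz d kk ee 2 Y4 in \<open>auto simp add: Hom_def add_simps\<close>)
      then show ?thesis using q 2 Y2[of "j + 1"] Y4 by auto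
    next
      case 3
      have "dif X j \<cdot> z = Zero E T (ent X (j - 1))"
        using comp_reassoc[OF e(2), of z] z(2) zz 3 Y4 kk ee Y2[of j] by (auto simp: add_simps)
      then show ?thesis using ex[of j] z(1) 3 Y2[of j] Y2[of "j + 1"] Y3[of "j + 1"]
        unfolding exact_at_def by simp
    next
      case 4
      then show ?thesis using ex[of j] z Y2[of j] Y2[of "j + 1"] Y2[of "j - 1"] Y3[of "j + 1"]
          Y3[of j]
        unfolding exact_at_def by simp
    qed
  qed
  then have "acyclic_complex E Y" by (rule acyclicI[OF Yc])
  moreover have "is_truncation E k X Y"
    unfolding is_truncation_def using X Yc Y1 Y2 Y3 Y4 \<kappa> e by auto
  ultimately show ?thesis unfolding homologically_le_def by blast
qed

end


section \<open>Sequential colimits and the telescope\<close>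

text \<open>Only the consecutive maps enter, which avoids composite transition maps in the
  degreewise arguments; \<open>direct_limit_transition\<close> passes to the full order on the
  naturals.\<close>

definition seq_colim ::
  "('o, 'm, 'z) cat_scheme \<Rightarrow> (nat \<Rightarrow> 'o) \<Rightarrow> (nat \<Rightarrow> 'm) \<Rightarrow> 'o \<Rightarrow> (nat \<Rightarrow> 'm) \<Rightarrow> bool" where
  "seq_colim C A \<alpha> L \<iota> \<longleftrightarrow> L \<in> Obj C \<and> (\<forall>n. \<iota> n \<in> Hom C (A n) L) \<and> (\<forall>n. \<iota> (Suc n) \<cdot>\<^bsub>C\<^esub> \<alpha> n = \<iota> n) \<and>
     (\<forall>T f. T \<in> Obj C \<and> (\<forall>n. f n \<in> Hom C (A n) T) \<and> (\<forall>n. f (Suc n) \<cdot>\<^bsub>C\<^esub> \<alpha> n = f n) \<longrightarrow>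
        (\<exists>!h. h \<in> Hom C L T \<and> (\<forall>n. h \<cdot>\<^bsub>C\<^esub> \<iota> n = f n)))"

context category
begin

lemma seq_colimD:
  assumes "seq_colim C A \<alpha> L \<iota>"
  shows "L \<in> Obj C" "\<iota> n \<in> Arr C" "Dom C (\<iota> n) = A n" "Cod C (\<iota> n) = L" "\<iota> (Suc n) \<cdot> \<alpha> n = \<iota> n"
  using assms by (auto simp: seq_colim_def Hom_def)

lemma seq_colim_desc:
  assumes "seq_colim C A \<alpha> L \<iota>" "\<And>n. f n \<in> Hom C (A n) T" "\<And>n. f (Suc n) \<cdot> \<alpha> n = f n"
  shows "\<exists>h \<in> Hom C L T. \<forall>n. h \<cdot> \<iota> n = f n"
  using assms Hom_obj[OF assms(2)] unfolding seq_colim_def by blast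

lemma seq_colim_eqI:
  assumes "seq_colim C A \<alpha> L \<iota>" "\<And>n. \<alpha> n \<in> Hom C (A n) (A (Suc n))"
    "h \<in> Hom C L T" "h' \<in> Hom C L T" "\<And>n. h \<cdot> \<iota> n = h' \<cdot> \<iota> n"
  shows "h = h'"
proof -
  note c = seq_colimD[OF assms(1)]
  have "h \<cdot> \<iota> n \<in> Hom C (A n) T" for n using assms c by (simp add: Hom_def cat_simps)
  moreover have "(h \<cdot> \<iota> (Suc n)) \<cdot> \<alpha> n = h \<cdot> \<iota> n" for n
    using assms(2)[of n] assms(3) c by (simp add: Hom_def cat_simps)
  ultimately have "\<exists>!k. k \<in> Hom C L T \<and> (\<forall>n. k \<cdot> \<iota> n = h \<cdot> \<iota> n)"
    using assms(1) Hom_obj[OF assms(3)] unfolding seq_colim_def by simp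
  with assms(3-5) show ?thesis by metis
qed

text \<open>Needed because lifting in a given degree is available only from some stage on, while the
  colimit must stay the same.\<close>

lemma seq_colim_tail:
  assumes "seq_colim C A \<alpha> L \<iota>" "\<And>n. \<alpha> n \<in> Hom C (A n) (A (Suc n))"
  shows "seq_colim C (\<lambda>n. A (n + m)) (\<lambda>n. \<alpha> (n + m)) L (\<lambda>n. \<iota> (n + m))"
  using assms
proof (induction m arbitrary: A \<alpha> \<iota>)
  case (Suc m)
  note c = seq_colimD[OF Suc.prems(1)] and a = Suc.prems(2)[unfolded Hom_def, simplified]
  have "seq_colim C (\<lambda>n. A (Suc n)) (\<lambda>n. \<alpha> (Suc n)) L (\<lambda>n. \<iota> (Suc n))"
    unfolding seq_colim_def
  proof (intro conjI allI impI, goal_cases)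
    case (4 T f)
    \<comment> \<open>A cocone on the tail extends to stage 0 by precomposing its first leg with
      \<open>\<alpha> 0\<close>; the induction then drops one stage at a time.\<close>
    have "\<exists>!h. h \<in> Hom C L T \<and> (\<forall>n. h \<cdot> \<iota> n = case_nat (f 0 \<cdot> \<alpha> 0) f n)"
    proof -
      have "\<forall>n. case_nat (f 0 \<cdot> \<alpha> 0) f n \<in> Hom C (A n) T"
        using 4 a by (auto split: nat.split simp: Hom_def cat_simps)
      moreover have "\<forall>n. case_nat (f 0 \<cdot> \<alpha> 0) f (Suc n) \<cdot> \<alpha> n = case_nat (f 0 \<cdot> \<alpha> 0) f n"
        using 4 by (auto split: nat.split)
      ultimately show ?thesis
        using Suc.prems(1) 4 unfolding seq_colim_def by blast
    qed
    moreover have "(\<forall>n. h \<cdot> \<iota> n = case_nat (f 0 \<cdot> \<alpha> 0) f n) \<longleftrightarrow> (\<forall>n. h \<cdot> \<iota> (Suc n) = f n)"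
      if "h \<in> Hom C L T" for h
    proof
      assume *: "\<forall>n. h \<cdot> \<iota> (Suc n) = f n"
      have "h \<cdot> \<iota> 0 = f 0 \<cdot> \<alpha> 0"
        using *[rule_format, of 0, symmetric] that c a by (simp add: Hom_def cat_simps)
      then show "\<forall>n. h \<cdot> \<iota> n = case_nat (f 0 \<cdot> \<alpha> 0) f n"
        using * by (auto split: nat.split)
    next
      assume "\<forall>n. h \<cdot> \<iota> n = case_nat (f 0 \<cdot> \<alpha> 0) f n"
      then show "\<forall>n. h \<cdot> \<iota> (Suc n) = f n" by (metis old.nat.simps(5))
    qed
    ultimately show ?case by (metis (no_types, lifting))
  qed (use c in \<open>auto simp: Hom_def\<close>)
  from Suc.IH[OF this Suc.prems(2)] show ?case by simp
qed simp

lemma coproductD: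
  assumes "is_coproduct C I A S \<kappa>"
  shows "S \<in> Obj C" "i \<in> I \<Longrightarrow> \<kappa> i \<in> Arr C" "i \<in> I \<Longrightarrow> Dom C (\<kappa> i) = A i" "i \<in> I \<Longrightarrow> Cod C (\<kappa> i) = S"
  using assms by (auto simp: is_coproduct_def Hom_def)

lemma coproduct_desc:
  assumes "is_coproduct C I A S \<kappa>" "T \<in> Obj C" "\<And>i. i \<in> I \<Longrightarrow> f i \<in> Hom C (A i) T"
  shows "\<exists>h \<in> Hom C S T. \<forall>i\<in>I. h \<cdot> \<kappa> i = f i"
  using assms unfolding is_coproduct_def by blast

lemma coproduct_eqI:
  assumes "is_coproduct C I A S \<kappa>" "h \<in> Hom C S T" "h' \<in> Hom C S T" "\<And>i. i \<in> I \<Longrightarrow> h \<cdot> \<kappa> i = h' \<cdot> \<kappa> i"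
  shows "h = h'"
proof -
  note c = coproductD[OF assms(1)]
  have "\<forall>i\<in>I. h \<cdot> \<kappa> i \<in> Hom C (A i) T" using assms c by (simp add: Hom_def cat_simps)
  then have "\<exists>!k. k \<in> Hom C S T \<and> (\<forall>i\<in>I. k \<cdot> \<kappa> i = h \<cdot> \<kappa> i)"
    using assms(1) Hom_obj[OF assms(2)] unfolding is_coproduct_def by simp
  with assms(2-4) show ?thesis by metis
qed

end

context additive_category
begin

text \<open>The telescope \<open>0 \<rightarrow> S \<rightarrow> S \<rightarrow> L \<rightarrow> 0\<close> with \<open>S = \<Oplus> A n\<close> and first map \<open>\<theta> = 1 - shift\<close> is
  contractible as soon as every \<open>\<alpha> n\<close> has a retraction \<open>t n\<close>.\<close>

lemma telescope_split:
  assumes \<alpha>: "\<And>n. \<alpha> n \<in> Hom C (A n) (A (Suc n))" and t: "\<And>n. t n \<in> Hom C (A (Suc n)) (A n)"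
    and ta0: "\<And>n. t n \<cdot> \<alpha> n = Ident C (A n)"
    and L: "seq_colim C A \<alpha> L \<iota>" and S: "is_coproduct C UNIV A S \<kappa>"
  shows "\<exists>\<sigma> \<in> Hom C L S. \<exists>\<pi> \<in> Hom C S L. \<exists>\<theta> \<in> Hom C S S. \<exists>\<rho> \<in> Hom C S S.
    (\<forall>n. \<pi> \<cdot> \<kappa> n = \<iota> n) \<and> (\<forall>n. \<theta> \<cdot> \<kappa> n = \<kappa> n \<^bold>+ Neg C (\<kappa> (Suc n) \<cdot> \<alpha> n)) \<and>
    \<pi> \<cdot> \<sigma> = Ident C L \<and> \<pi> \<cdot> \<theta> = Zero C S L \<and> \<rho> \<cdot> \<theta> = Ident C S \<and> (\<theta> \<cdot> \<rho>) \<^bold>+ (\<sigma> \<cdot> \<pi>) = Ident C S"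
proof -
  note l = seq_colimD[OF L] and s = coproductD[OF S, simplified]
  have a: "\<alpha> n \<in> Arr C" "Dom C (\<alpha> n) = A n" "Cod C (\<alpha> n) = A (Suc n)"
    "t n \<in> Arr C" "Dom C (t n) = A (Suc n)" "Cod C (t n) = A n" "A n \<in> Obj C" for n
    using \<alpha> t Hom_obj[OF \<alpha>] by (auto simp: Hom_def)
  note ty = l(1-4) s a
  \<comment> \<open>The legs of \<open>\<rho>\<close>. The wanted equation
    \<open>\<rho> \<cdot> \<theta> = 1\<close> reads
    \<open>r n - r (Suc n) \<cdot> \<alpha> n = \<kappa> n\<close>; since \<open>t n\<close>
    retracts \<open>\<alpha> n\<close>, this recursion solves it, with the start value chosen to be
    zero.\<close>
  define r where "r = rec_nat (Zero C (A 0) S) (\<lambda>n x. (x \<^bold>+ Neg C (\<kappa> n)) \<cdot> t n)"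
  have r: "r 0 = Zero C (A 0) S" "r (Suc n) = (r n \<^bold>+ Neg C (\<kappa> n)) \<cdot> t n" for n
    by (simp_all add: r_def)
  have rt: "r n \<in> Arr C \<and> Dom C (r n) = A n \<and> Cod C (r n) = S" for n
    by (induction n) (simp_all add: r add_simps ty)
  \<comment> \<open>The legs of the section \<open>\<sigma>\<close>. On \<open>A (Suc n)\<close> the
    part coming from \<open>A n\<close> through \<open>t n\<close> follows \<open>g n\<close>, and
    the complementary part \<open>1 - \<alpha> n \<cdot> t n\<close> enters the new summand. This is
    also the value of \<open>\<kappa> n - \<theta> \<cdot> r n\<close>, which gives the last
    identity of the contraction.\<close>
  define g where "g = rec_nat (\<kappa> 0) (\<lambda>n x. (x \<cdot> t n) \<^bold>+ (\<kappa> (Suc n) \<^bold>+ Neg C (\<kappa> (Suc n) \<cdot> (\<alpha> n \<cdot> t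
      n))))"
  have g: "g 0 = \<kappa> 0" "g (Suc n) = (g n \<cdot> t n) \<^bold>+ (\<kappa> (Suc n) \<^bold>+ Neg C (\<kappa> (Suc n) \<cdot> (\<alpha> n \<cdot> t n)))"
      for n
    by (simp_all add: g_def)
  have gt: "g n \<in> Arr C \<and> Dom C (g n) = A n \<and> Cod C (g n) = S" for n
    by (induction n) (simp_all add: g add_simps ty)
  have "g (Suc n) \<cdot> \<alpha> n = g n" for n
    using gt[of n] by (simp add: g add_simps ty ta0)
  then obtain \<sigma> where \<sigma>: "\<sigma> \<in> Hom C L S" "\<And>n. \<sigma> \<cdot> \<iota> n = g n"
    using seq_colim_desc[OF L, of g S] gt by (auto simp: Hom_def)
  obtain \<pi> where \<pi>: "\<pi> \<in> Hom C S L" "\<And>n. \<pi> \<cdot> \<kappa> n = \<iota> n"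
    using coproduct_desc[OF S, of L \<iota>] l by (auto simp: Hom_def)
  obtain \<rho> where \<rho>: "\<rho> \<in> Hom C S S" "\<And>n. \<rho> \<cdot> \<kappa> n = r n"
    using coproduct_desc[OF S, of S r] s rt by (auto simp: Hom_def)
  obtain \<theta> where \<theta>: "\<theta> \<in> Hom C S S" "\<And>n. \<theta> \<cdot> \<kappa> n = \<kappa> n \<^bold>+ Neg C (\<kappa> (Suc n) \<cdot> \<alpha> n)"
    using coproduct_desc[OF S, of S "\<lambda>n. \<kappa> n \<^bold>+ Neg C (\<kappa> (Suc n) \<cdot> \<alpha> n)"] ty
    by (auto simp: Hom_def add_simps)
  note ty2 = ty \<sigma>(1)[unfolded Hom_def, simplified] \<pi>(1)[unfolded Hom_def, simplified]
     \<rho>(1)[unfolded Hom_def, simplified] \<theta>(1)[unfolded Hom_def, simplified] gt rt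
  have re: "h \<in> Arr C \<Longrightarrow> Cod C h = A n \<Longrightarrow> \<pi> \<cdot> (\<kappa> n \<cdot> h) = \<iota> n \<cdot> h"
     "h \<in> Arr C \<Longrightarrow> Cod C h = A n \<Longrightarrow> \<rho> \<cdot> (\<kappa> n \<cdot> h) = r n \<cdot> h"
     "h \<in> Arr C \<Longrightarrow> Cod C h = A n \<Longrightarrow> \<theta> \<cdot> (\<kappa> n \<cdot> h) = (\<kappa> n \<^bold>+ Neg C (\<kappa> (Suc n) \<cdot> \<alpha> n)) \<cdot> h"
     "h \<in> Arr C \<Longrightarrow> Cod C h = A n \<Longrightarrow> \<sigma> \<cdot> (\<iota> n \<cdot> h) = g n \<cdot> h"
     "h \<in> Arr C \<Longrightarrow> Cod C h = A n \<Longrightarrow> \<iota> (Suc n) \<cdot> (\<alpha> n \<cdot> h) = \<iota> n \<cdot> h" for h n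
    using comp_reassoc[OF \<pi>(2), of n h] comp_reassoc[OF \<rho>(2), of n h] comp_reassoc[OF \<theta>(2), of n h]
      comp_reassoc[OF \<sigma>(2), of n h] comp_reassoc[OF l(5), of n h] ty2 by simp_all
  have \<pi>g: "\<pi> \<cdot> g n = \<iota> n" for n
  proof (induction n)
    case (Suc n)
    have "\<pi> \<cdot> (g n \<cdot> t n) = \<iota> n \<cdot> t n" using comp_reassoc[OF Suc, of "t n"] ty2 by simp
    then show ?case
      by (simp add: g add_simps ty2 re \<pi> add_left_comm[of "\<iota> n \<cdot> t n" "\<iota> (Suc n)"])
  qed (simp add: g \<pi>)
  have 1: "\<pi> \<cdot> \<sigma> = Ident C L"
    by (rule seq_colim_eqI[OF L \<alpha>]) (auto simp: Hom_def add_simps ty2 \<sigma> \<pi>g)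
  have 2: "\<pi> \<cdot> \<theta> = Zero C S L"
    by (rule coproduct_eqI[OF S]) (auto simp: Hom_def add_simps ty2 \<pi> \<theta> re l(5))
  have 3: "\<rho> \<cdot> \<theta> = Ident C S"
    by (rule coproduct_eqI[OF S])
       (auto simp: Hom_def add_simps ty2 \<rho> \<theta> re r ta0)
  have \<theta>r: "(\<theta> \<cdot> r n) \<^bold>+ g n = \<kappa> n" for n
  proof (induction n)
    case (Suc n)
    have *: "\<theta> \<cdot> (r n \<cdot> t n) \<^bold>+ g n \<cdot> t n = \<kappa> n \<cdot> t n"
      using arg_cong[OF Suc, of "\<lambda>x. x \<cdot> t n"] ty2 by (simp add: add_simps)
    have "\<theta> \<cdot> r (Suc n) \<^bold>+ g (Suc n) =
      (\<theta> \<cdot> (r n \<cdot> t n) \<^bold>+ g n \<cdot> t n) \<^bold>+ (Neg C (\<kappa> n \<cdot> t n) \<^bold>+ (\<kappa> (Suc n) \<cdot> (\<alpha> n \<cdot> t n) \<^bold>+ (\<kappa> (Suc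
          n) \<^bold>+ Neg C (\<kappa> (Suc n) \<cdot> (\<alpha> n \<cdot> t n)))))"
      unfolding r g by (simp add: add_simps ty2 re add_ac)
    also have "\<dots> = \<kappa> (Suc n)"
      unfolding * by (simp add: add_simps ty2 add_left_comm[of _ "\<kappa> (Suc n)"])
    finally show ?case .
  qed (simp add: g r add_simps ty2)
  have 4: "(\<theta> \<cdot> \<rho>) \<^bold>+ (\<sigma> \<cdot> \<pi>) = Ident C S"
    by (rule coproduct_eqI[OF S]) (auto simp: Hom_def add_simps ty2 \<rho> \<pi> \<sigma> \<theta>r)
  show ?thesis using \<sigma>(1) \<pi> \<theta> \<rho>(1) 1 2 3 4 by blast
qed

end

context exact_category
begin

lemma adm_epic_comp_hom:
  "q \<in> Hom E B D \<Longrightarrow> adm_epic E q \<Longrightarrow> q' \<in> Hom E A B \<Longrightarrow> adm_epic E q' \<Longrightarrow>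
    q \<cdot> q' \<in> Hom E A D \<and> adm_epic E (q \<cdot> q')"
  using adm_epic_comp[of q' q] by (simp add: Hom_def cat_simps)

text \<open>The chase behind the long exact sequence of the telescope: homology of \<open>L\<close>
  in degree \<open>j\<close> is controlled by that of \<open>S\<close> in degrees \<open>j\<close>
  and \<open>j - 1\<close>. The maps \<open>\<pi>\<close> and \<open>\<theta>\<close> are chain
  maps, whereas \<open>\<sigma>\<close> and \<open>\<rho>\<close> are only chosen degree by
  degree.\<close>

lemma telescope_exact:
  assumes \<alpha>: "\<And>n. is_chain_map E (A n, A (Suc n), \<alpha> n)" and \<iota>: "\<And>n. is_chain_map E (A n, L, \<iota> n)"
    and t: "\<And>n j. t n j \<in> Hom E (ent (A (Suc n)) j) (ent (A n) j)"
    and ta0: "\<And>n j. t n j \<cdot> \<alpha> n j = Ident E (ent (A n) j)"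
    and L: "\<And>j. seq_colim E (\<lambda>n. ent (A n) j) (\<lambda>n. \<alpha> n j) (ent L j) (\<lambda>n. \<iota> n j)"
    and \<kappa>: "\<And>n. is_chain_map E (A n, S, \<kappa> n)"
    and S: "\<And>j. is_coproduct E UNIV (\<lambda>n. ent (A n) j) (ent S j) (\<lambda>n. \<kappa> n j)"
    and ex: "exact_at E S j" "exact_at E S (j - 1)"
  shows "exact_at E L j"
proof -
  note Ac = chain_mapD(1)[OF \<alpha>] and Lc = chain_mapD(2)[OF \<iota>] and Sc = chain_mapD(2)[OF \<kappa>]
  have \<alpha>h: "\<alpha> n j \<in> Hom E (ent (A n) j) (ent (A (Suc n)) j)" for n j
    using chain_mapD[OF \<alpha>] by (simp add: Hom_def)
  have "\<forall>j. \<exists>\<sigma> \<pi> \<theta> \<rho>. \<sigma> \<in> Hom E (ent L j) (ent S j) \<and> \<pi> \<in> Hom E (ent S j) (ent L j) \<and>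
      \<theta> \<in> Hom E (ent S j) (ent S j) \<and> \<rho> \<in> Hom E (ent S j) (ent S j) \<and>
    (\<forall>n. \<pi> \<cdot> \<kappa> n j = \<iota> n j) \<and> (\<forall>n. \<theta> \<cdot> \<kappa> n j = \<kappa> n j \<^bold>+ Neg E (\<kappa> (Suc n) j \<cdot> \<alpha> n j)) \<and>
    \<pi> \<cdot> \<sigma> = Ident E (ent L j) \<and> \<pi> \<cdot> \<theta> = Zero E (ent S j) (ent L j) \<and> \<rho> \<cdot> \<theta> = Ident E (ent S j) \<and>
    (\<theta> \<cdot> \<rho>) \<^bold>+ (\<sigma> \<cdot> \<pi>) = Ident E (ent S j)"
    using telescope_split[OF \<alpha>h t ta0 L S] by (fastforce simp: Bex_def)
  then obtain \<sigma> \<pi> \<theta> \<rho> where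
    h: "\<And>j. \<sigma> j \<in> Hom E (ent L j) (ent S j)" "\<And>j. \<pi> j \<in> Hom E (ent S j) (ent L j)"
      "\<And>j. \<theta> j \<in> Hom E (ent S j) (ent S j)" "\<And>j. \<rho> j \<in> Hom E (ent S j) (ent S j)"
    and \<pi>\<kappa>: "\<And>n j. \<pi> j \<cdot> \<kappa> n j = \<iota> n j"
    and \<theta>\<kappa>: "\<And>n j. \<theta> j \<cdot> \<kappa> n j = \<kappa> n j \<^bold>+ Neg E (\<kappa> (Suc n) j \<cdot> \<alpha> n j)"
    and \<pi>\<sigma>: "\<And>j. \<pi> j \<cdot> \<sigma> j = Ident E (ent L j)" and \<pi>\<theta>: "\<And>j. \<pi> j \<cdot> \<theta> j = Zero E (ent S j) (ent L j)"
    and \<rho>\<theta>: "\<And>j. \<rho> j \<cdot> \<theta> j = Ident E (ent S j)"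
    and one: "\<And>j. (\<theta> j \<cdot> \<rho> j) \<^bold>+ (\<sigma> j \<cdot> \<pi> j) = Ident E (ent S j)"
    by metis
  note ty = h[unfolded Hom_def, simplified] cplxD(1-4)[OF Ac] cplxD(1-4)[OF Lc] cplxD(1-4)[OF Sc]
    chain_mapD(3-5)[OF \<alpha>] chain_mapD(3-5)[OF \<iota>] chain_mapD(3-5)[OF \<kappa>]
  have \<pi>\<kappa>': "u \<in> Arr E \<Longrightarrow> Cod E u = ent (A n) j \<Longrightarrow> \<pi> j \<cdot> (\<kappa> n j \<cdot> u) = \<iota> n j \<cdot> u"
    and \<theta>\<kappa>': "u \<in> Arr E \<Longrightarrow> Cod E u = ent (A n) j \<Longrightarrow>
      \<theta> j \<cdot> (\<kappa> n j \<cdot> u) = (\<kappa> n j \<^bold>+ Neg E (\<kappa> (Suc n) j \<cdot> \<alpha> n j)) \<cdot> u" for u n j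
    using comp_reassoc[OF \<pi>\<kappa>, of n j u] comp_reassoc[OF \<theta>\<kappa>, of n j u] ty by simp_all
  have d\<pi>: "dif L j \<cdot> \<pi> j = \<pi> (j - 1) \<cdot> dif S j" for j
    by (rule coproduct_eqI[OF S])
      (auto simp: Hom_def add_simps ty \<pi>\<kappa> \<pi>\<kappa>' chain_mapD(6)[OF \<iota>] chain_mapD(6)[OF \<kappa>])
  have d\<theta>: "dif S j \<cdot> \<theta> j = \<theta> (j - 1) \<cdot> dif S j" for j
    by (rule coproduct_eqI[OF S])
      (auto simp: Hom_def add_simps ty \<theta>\<kappa> \<theta>\<kappa>' chain_mapD(6,7)[OF \<kappa>] chain_mapD(6)[OF \<alpha>])
  show ?thesis
    unfolding exact_at_def
  proof (intro allI impI, elim conjE)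
    fix T z assume z: "z \<in> Hom E T (ent L j)" "dif L j \<cdot> z = Zero E T (ent L (j - 1))"
    have zz: "z \<in> Arr E" "Dom E z = T" "Cod E z = ent L j" "T \<in> Obj E"
      using z Hom_obj[OF z(1)] by (auto simp: Hom_def)
    \<comment> \<open>A lift of \<open>z\<close> that need not be a cycle. Its boundary dies in
      \<open>L\<close>, so it is \<open>\<theta>\<close> of the element \<open>w\<close>
      below.\<close>
    define y where "y = \<sigma> j \<cdot> z"
    have y: "y \<in> Arr E" "Dom E y = T" "Cod E y = ent S j" by (simp_all add: y_def add_simps ty zz)
    have \<pi>y: "\<pi> j \<cdot> y = z" using comp_reassoc[OF \<pi>\<sigma>, of j z] by (simp add: y_def ty zz add_simps)
    have \<pi>dy: "\<pi> (j - 1) \<cdot> (dif S j \<cdot> y) = Zero E T (ent L (j - 1))"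
      using comp_reassoc[OF d\<pi>, of j y] \<pi>y z(2) by (simp add: ty y add_simps)
    define w where "w = \<rho> (j - 1) \<cdot> (dif S j \<cdot> y)"
    have w: "w \<in> Arr E" "Dom E w = T" "Cod E w = ent S (j - 1)"
        by (simp_all add: w_def add_simps ty y)
    have \<theta>w: "\<theta> (j - 1) \<cdot> w = dif S j \<cdot> y"
      using arg_cong[OF one[of "j - 1"], of "\<lambda>x. x \<cdot> (dif S j \<cdot> y)"]
      by (simp add: w_def add_simps ty y \<pi>dy zz)
    \<comment> \<open>The left inverse \<open>\<rho>\<close> reduces the claim to
      \<open>\<theta>\<close> of the boundary of \<open>w\<close>, which is a double boundary of
      \<open>y\<close>.\<close>
    have "dif S (j - 1) \<cdot> w = \<rho> (j - 1 - 1) \<cdot> (\<theta> (j - 1 - 1) \<cdot> (dif S (j - 1) \<cdot> w))"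
      using comp_reassoc[OF \<rho>\<theta>, of "j - 1 - 1" "dif S (j - 1) \<cdot> w"] by (simp add: ty w add_simps)
    also have "\<theta> (j - 1 - 1) \<cdot> (dif S (j - 1) \<cdot> w) = dif S (j - 1) \<cdot> (\<theta> (j - 1) \<cdot> w)"
      using comp_reassoc[OF d\<theta>, of "j - 1" w] by (simp add: ty w add_simps)
    finally have "dif S (j - 1) \<cdot> w = Zero E T (ent S (j - 1 - 1))"
      using cplxD(6)[OF Sc, of "j - 1" j y] by (simp add: \<theta>w ty y add_simps zz)
    with ex(2)[unfolded exact_at_def, rule_format, of w T] w obtain T1 q1 w' where
      q1: "q1 \<in> Hom E T1 T" "adm_epic E q1" and w': "w' \<in> Hom E T1 (ent S j)" "dif S j \<cdot> w' =
          w \<cdot> q1"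
      by (auto simp: Hom_def)
    \<comment> \<open>Subtracting \<open>\<theta> j \<cdot> w'\<close> removes the boundary of
      \<open>y\<close> without changing the image in \<open>L\<close>.\<close>
    define y' where "y' = (y \<cdot> q1) \<^bold>+ Neg E (\<theta> j \<cdot> w')"
    note ty2 = ty y w zz Hom_obj[OF q1(1)] q1(1)[unfolded Hom_def, simplified]
        w'(1)[unfolded Hom_def, simplified]
    have y': "y' \<in> Hom E T1 (ent S j)" by (simp add: y'_def Hom_def ty2 add_simps)
    have "dif S j \<cdot> (\<theta> j \<cdot> w') = dif S j \<cdot> (y \<cdot> q1)"
      using comp_reassoc[OF d\<theta>, of j w'] comp_reassoc[OF \<theta>w, of q1] w'(2)
          by (simp add: ty2 add_simps)
    then have "dif S j \<cdot> y' = Zero E T1 (ent S (j - 1))"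
      by (simp add: y'_def ty2 add_simps)
    with ex(1) y' obtain T2 q2 y'' where
      q2: "q2 \<in> Hom E T2 T1" "adm_epic E q2" and y'': "y'' \<in> Hom E T2 (ent S (j + 1))"
          "dif S (j + 1) \<cdot> y'' = y' \<cdot> q2"
      unfolding exact_at_def by blast
    note ty3 = ty2 Hom_obj[OF q2(1)] q2(1)[unfolded Hom_def, simplified]
        y''(1)[unfolded Hom_def, simplified]
    have "\<pi> j \<cdot> y' = z \<cdot> q1"
      using comp_reassoc[OF \<pi>y, of q1] comp_reassoc[OF \<pi>\<theta>, of j w']
          by (simp add: y'_def ty3 add_simps)
    then have "dif L (j + 1) \<cdot> (\<pi> (j + 1) \<cdot> y'') = z \<cdot> (q1 \<cdot> q2)"
      using comp_reassoc[OF d\<pi>, of "j + 1" y''] comp_reassoc[of "\<pi> j" y' "z \<cdot> q1" q2] y''(2) y'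
      by (simp add: ty3 add_simps Hom_def)
    then show "\<exists>T' q y. q \<in> Hom E T' T \<and> adm_epic E q \<and> y \<in> Hom E T' (ent L (j + 1)) \<and>
        dif L (j + 1) \<cdot> y = z \<cdot> q"
      using adm_epic_comp_hom[OF q1 q2]
      by (intro exI[of _ T2] exI[of _ "q1 \<cdot> q2"] exI[of _ "\<pi> (j + 1) \<cdot> y''"]) (simp add: Hom_def
          ty3 add_simps)
  qed
qed

end


section \<open>Mapping cones and coproducts of complexes\<close>

text \<open>The biproduct data hidden existentially in \<open>is_mapping_cone\<close> become
  parameters, so that maps into and out of cones can be written in coordinates.\<close>

definition is_cone ::
  "('o, 'm, 'z) addcat_scheme \<Rightarrow> ('o, 'm) cplx \<Rightarrow> ('o, 'm) cplx \<Rightarrow> (int \<Rightarrow> 'm) \<Rightarrow> ('o, 'm) cplx \<Rightarrow>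
   (int \<Rightarrow> 'm) \<Rightarrow> (int \<Rightarrow> 'm) \<Rightarrow> (int \<Rightarrow> 'm) \<Rightarrow> (int \<Rightarrow> 'm) \<Rightarrow> bool" where
  "is_cone C A B f K i1 i2 p1 p2 \<longleftrightarrow> is_chain_map C (A, B, f) \<and> is_complex C K \<and>
     (\<forall>n. is_biproduct C (ent A (n - 1)) (ent B n) (ent K n) (i1 n) (i2 n) (p1 n) (p2 n) \<and>
        dif K n =
          (i1 (n - 1) \<cdot>\<^bsub>C\<^esub> Neg C (dif A (n - 1)) \<cdot>\<^bsub>C\<^esub> p1 n) \<^bold>+\<^bsub>C\<^esub>
          (i2 (n - 1) \<cdot>\<^bsub>C\<^esub> ((f (n - 1) \<cdot>\<^bsub>C\<^esub> p1 n) \<^bold>+\<^bsub>C\<^esub> (dif B n \<cdot>\<^bsub>C\<^esub> p2 n))))"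

lemma mapping_cone_iff:
  "is_mapping_cone C (A, B, f) K \<longleftrightarrow> (\<exists>i1 i2 p1 p2. is_cone C A B f K i1 i2 p1 p2)"
  by (simp add: is_mapping_cone_def is_cone_def)

context additive_category
begin

lemma biproductD:
  assumes "is_biproduct C A B S i1 i2 p1 p2"
  shows "A \<in> Obj C" "B \<in> Obj C" "S \<in> Obj C"
    "i1 \<in> Arr C" "Dom C i1 = A" "Cod C i1 = S" "i2 \<in> Arr C" "Dom C i2 = B" "Cod C i2 = S"
    "p1 \<in> Arr C" "Dom C p1 = S" "Cod C p1 = A" "p2 \<in> Arr C" "Dom C p2 = S" "Cod C p2 = B"
    "p1 \<cdot> i1 = Ident C A" "p2 \<cdot> i2 = Ident C B" "p2 \<cdot> i1 = Zero C A B" "p1 \<cdot> i2 = Zero C B A"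
    "h \<in> Arr C \<Longrightarrow> Cod C h = A \<Longrightarrow> p1 \<cdot> (i1 \<cdot> h) = h"
    "h \<in> Arr C \<Longrightarrow> Cod C h = B \<Longrightarrow> p2 \<cdot> (i2 \<cdot> h) = h"
    "h \<in> Arr C \<Longrightarrow> Cod C h = A \<Longrightarrow> p2 \<cdot> (i1 \<cdot> h) = Zero C (Dom C h) B"
    "h \<in> Arr C \<Longrightarrow> Cod C h = B \<Longrightarrow> p1 \<cdot> (i2 \<cdot> h) = Zero C (Dom C h) A"
proof -
  have i: "i1 \<in> Hom C A S" "i2 \<in> Hom C B S" using assms by (auto simp: is_biproduct_def)
  show o: "A \<in> Obj C" "B \<in> Obj C" "S \<in> Obj C" using Hom_obj[OF i(1)] Hom_obj[OF i(2)] by auto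
  show *: "i1 \<in> Arr C" "Dom C i1 = A" "Cod C i1 = S" "i2 \<in> Arr C" "Dom C i2 = B" "Cod C i2 = S"
    "p1 \<in> Arr C" "Dom C p1 = S" "Cod C p1 = A" "p2 \<in> Arr C" "Dom C p2 = S" "Cod C p2 = B"
    and e: "p1 \<cdot> i1 = Ident C A" "p2 \<cdot> i2 = Ident C B" "p2 \<cdot> i1 = Zero C A B" "p1 \<cdot> i2 = Zero C B A"
    using assms by (auto simp: is_biproduct_def Hom_def)
  show "h \<in> Arr C \<Longrightarrow> Cod C h = A \<Longrightarrow> p1 \<cdot> (i1 \<cdot> h) = h"
    "h \<in> Arr C \<Longrightarrow> Cod C h = B \<Longrightarrow> p2 \<cdot> (i2 \<cdot> h) = h"
    "h \<in> Arr C \<Longrightarrow> Cod C h = A \<Longrightarrow> p2 \<cdot> (i1 \<cdot> h) = Zero C (Dom C h) B"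
    "h \<in> Arr C \<Longrightarrow> Cod C h = B \<Longrightarrow> p1 \<cdot> (i2 \<cdot> h) = Zero C (Dom C h) A"
    using comp_reassoc[OF e(1), of h] comp_reassoc[OF e(2), of h] comp_reassoc[OF e(3), of h]
        comp_reassoc[OF e(4), of h] o *
    by (simp_all add: add_simps)
qed

lemma biproduct_sum: "is_biproduct C A B S i1 i2 p1 p2 \<Longrightarrow> (i1 \<cdot> p1) \<^bold>+ (i2 \<cdot> p2) = Ident C S"
  by (simp add: is_biproduct_def)

lemma biproduct_eq_in:
  assumes "is_biproduct C A B S i1 i2 p1 p2" "h \<in> Hom C T S" "h' \<in> Hom C T S"
    "p1 \<cdot> h = p1 \<cdot> h'" "p2 \<cdot> h = p2 \<cdot> h'"
  shows "h = h'"
proof -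
  note b = biproductD[OF assms(1)]
  have "h = (i1 \<cdot> (p1 \<cdot> h)) \<^bold>+ (i2 \<cdot> (p2 \<cdot> h))" if "h \<in> Hom C T S" for h
    using arg_cong[OF biproduct_sum[OF assms(1)], of "\<lambda>x. x \<cdot> h"] that b
        by (simp add: Hom_def add_simps)
  from this[OF assms(2)] this[OF assms(3)] show ?thesis using assms by simp
qed

lemma biproduct_eq_out:
  assumes "is_biproduct C A B S i1 i2 p1 p2" "h \<in> Hom C S T" "h' \<in> Hom C S T"
    "h \<cdot> i1 = h' \<cdot> i1" "h \<cdot> i2 = h' \<cdot> i2"
  shows "h = h'"
proof -
  note b = biproductD[OF assms(1)]
  have "h = ((h \<cdot> i1) \<cdot> p1) \<^bold>+ ((h \<cdot> i2) \<cdot> p2)" if "h \<in> Hom C S T" for h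
    using arg_cong[OF biproduct_sum[OF assms(1)], of "\<lambda>x. h \<cdot> x"] that b
        by (simp add: Hom_def add_simps)
  from this[OF assms(2)] this[OF assms(3)] show ?thesis using assms by simp
qed

lemma cone_simps:
  assumes "is_cone C A B f K i1 i2 p1 p2"
  shows "m = j - 1 \<Longrightarrow> p1 m \<cdot> dif K j = Neg C (dif A m \<cdot> p1 j)"
    "m = j - 1 \<Longrightarrow> p2 m \<cdot> dif K j = (f m \<cdot> p1 j) \<^bold>+ (dif B j \<cdot> p2 j)"
    "m = j - 1 \<Longrightarrow> h \<in> Arr C \<Longrightarrow> Cod C h = ent K j \<Longrightarrow> p1 m \<cdot> (dif K j \<cdot> h) =
        Neg C (dif A m \<cdot> (p1 j \<cdot> h))"
    "m = j - 1 \<Longrightarrow> h \<in> Arr C \<Longrightarrow> Cod C h = ent K j \<Longrightarrow> p2 m \<cdot> (dif K j \<cdot> h) =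
        (f m \<cdot> (p1 j \<cdot> h)) \<^bold>+ (dif B j \<cdot> (p2 j \<cdot> h))"
proof -
  have f: "is_chain_map C (A, B, f)" and K: "is_complex C K"
    and b: "\<And>n. is_biproduct C (ent A (n - 1)) (ent B n) (ent K n) (i1 n) (i2 n) (p1 n) (p2 n)"
    and d: "\<And>n. dif K n =
          (i1 (n - 1) \<cdot> Neg C (dif A (n - 1)) \<cdot> p1 n) \<^bold>+ (i2 (n - 1) \<cdot> ((f (n - 1) \<cdot> p1 n) \<^bold>+ (dif
              B n \<cdot> p2 n)))"
    using assms by (auto simp: is_cone_def)
  note ty = biproductD[OF b] chain_mapD(3-5)[OF f] cplxD(1-4)[OF chain_mapD(1)[OF f]]
      cplxD(1-4)[OF chain_mapD(2)[OF f]]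
  have 1: "p1 m \<cdot> dif K j = Neg C (dif A m \<cdot> p1 j)" "p2 m \<cdot> dif K j =
      (f m \<cdot> p1 j) \<^bold>+ (dif B j \<cdot> p2 j)"
    if "m = j - 1"
    using that unfolding d by (simp_all add: add_simps ty)
  then show "m = j - 1 \<Longrightarrow> p1 m \<cdot> dif K j = Neg C (dif A m \<cdot> p1 j)"
    "m = j - 1 \<Longrightarrow> p2 m \<cdot> dif K j = (f m \<cdot> p1 j) \<^bold>+ (dif B j \<cdot> p2 j)" by auto
  assume m: "m = j - 1" and h: "h \<in> Arr C" "Cod C h = ent K j"
  show "p1 m \<cdot> (dif K j \<cdot> h) = Neg C (dif A m \<cdot> (p1 j \<cdot> h))"
    using comp_reassoc[OF 1(1)[OF m], of h] m h cplxD(1-4)[OF K] by (simp add: ty add_simps)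
  show "p2 m \<cdot> (dif K j \<cdot> h) = (f m \<cdot> (p1 j \<cdot> h)) \<^bold>+ (dif B j \<cdot> (p2 j \<cdot> h))"
    using comp_reassoc[OF 1(2)[OF m], of h] m h cplxD(1-4)[OF K] by (simp add: ty add_simps)
qed

lemma coneD:
  assumes "is_cone C A B f K i1 i2 p1 p2"
  shows "is_chain_map C (A, B, f)" "is_complex C K" "is_complex C A" "is_complex C B"
    "is_biproduct C (ent A (n - 1)) (ent B n) (ent K n) (i1 n) (i2 n) (p1 n) (p2 n)"
  using assms chain_mapD(1,2) by (auto simp: is_cone_def)

lemma cone_exists:
  assumes f: "is_chain_map C (A, B, f)"
  shows "\<exists>K i1 i2 p1 p2. is_cone C A B f K i1 i2 p1 p2"
proof -
  note fD = chain_mapD[OF f]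
  note A = cplxD[OF fD(1)] and B = cplxD[OF fD(2)]
  have "\<forall>n. \<exists>S i1 i2 p1 p2. is_biproduct C (ent A (n - 1)) (ent B n) S i1 i2 p1 p2"
    using biproduct_exists A B by blast
  then obtain S i1 i2 p1 p2 where b: "\<And>n. is_biproduct C (ent A (n - 1)) (ent B n) (S n) (i1 n)
      (i2 n) (p1 n) (p2 n)"
    by metis
  define K where "K = \<lparr>ent = S, dif = \<lambda>n.
    (i1 (n - 1) \<cdot> Neg C (dif A (n - 1)) \<cdot> p1 n) \<^bold>+ (i2 (n - 1) \<cdot> ((f (n - 1) \<cdot> p1 n) \<^bold>+ (dif B
        n \<cdot> p2 n)))\<rparr>"
  note ty = biproductD[OF b] A B fD(3-7)
  have "is_complex C K"
    unfolding is_complex_def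
  proof (intro conjI allI)
    fix n
    show "dif K (n - 1) \<cdot> dif K n = Zero C (ent K n) (ent K (n - 2))"
      by (rule biproduct_eq_in[OF b[of "n - 2"]]) (auto simp: K_def ty add_simps Hom_def)
  qed (auto simp: K_def ty add_simps Hom_def)
  then have "is_cone C A B f K i1 i2 p1 p2"
    using f b by (simp add: is_cone_def K_def)
  then show ?thesis by blast
qed

text \<open>Functoriality in the target over a fixed source: the cones of maps from one stage to all
  later ones then form a sequence with a constant first summand.\<close>

lemma cone_map:
  assumes c1: "is_cone C A B f K i1 i2 p1 p2" and c2: "is_cone C A B' f' K' i1' i2' p1' p2'"
    and g: "is_chain_map C (B, B', g)" and gf: "\<And>n. g n \<cdot> f n = f' n"
  shows "is_chain_map C (K, K', \<lambda>n. (i1' n \<cdot> p1 n) \<^bold>+ (i2' n \<cdot> (g n \<cdot> p2 n)))"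
proof (rule chain_mapI[OF coneD(2)[OF c1] coneD(2)[OF c2]])
  fix n
  note ty = biproductD[OF coneD(5)[OF c1]] biproductD[OF coneD(5)[OF c2]]
    cplxD[OF coneD(2)[OF c1]] cplxD[OF coneD(2)[OF c2]] cplxD[OF coneD(3)[OF c1]]
    cplxD[OF coneD(4)[OF c1]] cplxD[OF coneD(4)[OF c2]]
    chain_mapD(3-5)[OF coneD(1)[OF c1]] chain_mapD(3-5)[OF coneD(1)[OF c2]] chain_mapD(3-7)[OF g]
  have gf': "h \<in> Arr C \<Longrightarrow> Cod C h = ent A n \<Longrightarrow> g n \<cdot> (f n \<cdot> h) = f' n \<cdot> h" for h n
    using comp_reassoc[OF gf, of n h] by (simp add: ty)
  show "(i1' n \<cdot> p1 n) \<^bold>+ (i2' n \<cdot> (g n \<cdot> p2 n)) \<in> Hom C (ent K n) (ent K' n)"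
    by (simp add: Hom_def ty add_simps)
  show "dif K' n \<cdot> (i1' n \<cdot> p1 n \<^bold>+ i2' n \<cdot> g n \<cdot> p2 n) =
      (i1' (n - 1) \<cdot> p1 (n - 1) \<^bold>+ i2' (n - 1) \<cdot> g (n - 1) \<cdot> p2 (n - 1)) \<cdot> dif K n"
    by (rule biproduct_eq_in[OF coneD(5)[OF c2, of "n - 1"]])
      (simp_all add: Hom_def ty add_simps cone_simps[OF c1] cone_simps[OF c2] gf gf')
qed

text \<open>Adding a constant summand commutes with sequential colimits, because compatibility
  forces all legs of a cocone to agree on that summand (\<open>fi1\<close>).\<close>

lemma seq_colim_biproduct:
  assumes L: "seq_colim C A \<alpha> L \<iota>" and \<alpha>: "\<And>n. \<alpha> n \<in> Hom C (A n) (A (Suc n))"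
    and b: "\<And>n. is_biproduct C K (A n) (S n) (i1 n) (i2 n) (p1 n) (p2 n)"
    and M: "is_biproduct C K L M j1 j2 r1 r2"
  shows "seq_colim C S (\<lambda>n. (i1 (Suc n) \<cdot> p1 n) \<^bold>+ (i2 (Suc n) \<cdot> (\<alpha> n \<cdot> p2 n))) M
     (\<lambda>n. (j1 \<cdot> p1 n) \<^bold>+ (j2 \<cdot> (\<iota> n \<cdot> p2 n)))"
proof -
  note l = seq_colimD[OF L]
  note ty = biproductD[OF b] biproductD[OF M] l \<alpha>[unfolded Hom_def, simplified]
  have i\<alpha>: "h \<in> Arr C \<Longrightarrow> Cod C h = A n \<Longrightarrow> \<iota> (Suc n) \<cdot> (\<alpha> n \<cdot> h) = \<iota> n \<cdot> h" for h n
    using comp_reassoc[OF l(5), of n h] by (simp add: ty)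
  show ?thesis
    unfolding seq_colim_def
  proof (intro conjI allI impI)
    fix T f
    assume f0: "T \<in> Obj C \<and> (\<forall>n. f n \<in> Hom C (S n) T) \<and>
      (\<forall>n. f (Suc n) \<cdot> (i1 (Suc n) \<cdot> p1 n \<^bold>+ i2 (Suc n) \<cdot> \<alpha> n \<cdot> p2 n) = f n)"
    then have f: "T \<in> Obj C" "f n \<in> Arr C" "Dom C (f n) = S n" "Cod C (f n) = T"
      "(f (Suc n) \<cdot> (i1 (Suc n) \<cdot> p1 n)) \<^bold>+ (f (Suc n) \<cdot> (i2 (Suc n) \<cdot> (\<alpha> n \<cdot> p2 n))) = f n" for n
      by (auto simp: Hom_def ty add_simps comp_add[symmetric])
    have 1: "f (Suc n) \<cdot> i1 (Suc n) = f n \<cdot> i1 n" for n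
      using arg_cong[OF f(5)[of n], of "\<lambda>x. x \<cdot> i1 n"] by (simp add: ty f(1-4) add_simps)
    have 2: "f (Suc n) \<cdot> (i2 (Suc n) \<cdot> \<alpha> n) = f n \<cdot> i2 n" for n
      using arg_cong[OF f(5)[of n], of "\<lambda>x. x \<cdot> i2 n"] by (simp add: ty f(1-4) add_simps)
    have fi1: "f n \<cdot> i1 n = f 0 \<cdot> i1 0" for n by (induction n) (simp_all add: 1)
    obtain h where h: "h \<in> Hom C L T" "\<And>n. h \<cdot> \<iota> n = f n \<cdot> i2 n"
      using seq_colim_desc[OF L, of "\<lambda>n. f n \<cdot> i2 n" T]
          by (auto simp: Hom_def ty f(1-4) add_simps 2)
    note ty2 = ty f(1-4) h(1)[unfolded Hom_def, simplified]
    define H where "H = ((f 0 \<cdot> i1 0) \<cdot> r1) \<^bold>+ (h \<cdot> r2)"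
    show "\<exists>!h. h \<in> Hom C M T \<and> (\<forall>n. h \<cdot> (j1 \<cdot> p1 n \<^bold>+ j2 \<cdot> \<iota> n \<cdot> p2 n) = f n)"
    proof (rule ex1I[of _ H], intro conjI allI)
      show H: "H \<in> Hom C M T" by (simp add: H_def ty2 add_simps Hom_def)
      show "H \<cdot> (j1 \<cdot> p1 n \<^bold>+ j2 \<cdot> \<iota> n \<cdot> p2 n) = f n" for n
        by (rule biproduct_eq_out[OF b[of n]]) (simp_all add: H_def ty2 add_simps Hom_def h(2)
            fi1[of n])
      fix k assume k: "k \<in> Hom C M T \<and> (\<forall>n. k \<cdot> (j1 \<cdot> p1 n \<^bold>+ j2 \<cdot> \<iota> n \<cdot> p2 n) = f n)"
      note ty3 = ty2 conjunct1[OF k, unfolded Hom_def, simplified]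
      have k1: "k \<cdot> j1 = f 0 \<cdot> i1 0"
        using arg_cong[OF conjunct2[OF k, rule_format, of 0], of "\<lambda>x. x \<cdot> i1 0"]
            by (simp add: ty3 add_simps)
      have k2: "(k \<cdot> j2) \<cdot> \<iota> n = f n \<cdot> i2 n" for n
        using arg_cong[OF conjunct2[OF k, rule_format, of n], of "\<lambda>x. x \<cdot> i2 n"]
            by (simp add: ty3 add_simps)
      have k3: "k \<cdot> j2 = h"
        by (rule seq_colim_eqI[OF L \<alpha>]) (use k2 h in \<open>auto simp: ty3 add_simps Hom_def\<close>)
      show "k = H"
        by (rule biproduct_eq_out[OF M conjunct1[OF k] H]) (simp_all add: H_def ty3 add_simps k1 k3)
    qed
  qed (auto simp: ty add_simps Hom_def i\<alpha>)
qed

section \<open>Coproducts of complexes are computed degreewise\<close>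

lemma Hom_Ch: "f \<in> Hom (Ch C) A B \<longleftrightarrow> (\<exists>g. f = (A, B, g) \<and> is_chain_map C (A, B, g))"
  by (cases f) (auto simp: Hom_def Ch_def)

lemma Ch_simps:
  "X \<in> Obj (Ch C) \<longleftrightarrow> is_complex C X" "f \<in> Arr (Ch C) \<longleftrightarrow> is_chain_map C f" "Dom (Ch C) f = src f"
  "Cod (Ch C) f = tgt f" "Ident (Ch C) X = (X, X, \<lambda>n. Ident C (ent X n))"
  "g \<cdot>\<^bsub>Ch C\<^esub> f = (src f, tgt g, \<lambda>n. cmpt g n \<cdot> cmpt f n)"
  "Zero (Ch C) X Y = (X, Y, \<lambda>n. Zero C (ent X n) (ent Y n))"
  by (simp_all add: Ch_def)

text \<open>Evaluation in degree \<open>j\<close> is left adjoint to \<open>T \<mapsto> (\<dots> 0 \<rightarrow> T = T \<rightarrow> 0 \<dots>)\<close> placed in degrees \<open>j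
  + 1\<close> and \<open>j\<close>, hence preserves coproducts.\<close>

lemma coproduct_Ch_degreewise:
  assumes S: "is_coproduct (Ch C) I B S \<iota>"
  shows "is_coproduct C I (\<lambda>i. ent (B i) j) (ent S j) (\<lambda>i. cmpt (\<iota> i) j)"
proof -
  have Sc: "is_complex C S" using S by (simp add: is_coproduct_def Ch_simps)
  have \<iota>: "\<exists>g. \<iota> i = (B i, S, g) \<and> is_chain_map C (B i, S, g)" if "i \<in> I" for i
    using S that by (simp add: is_coproduct_def Hom_Ch)
  then have \<iota>: "\<iota> i = (B i, S, cmpt (\<iota> i))" "is_chain_map C (B i, S, cmpt (\<iota> i))" if "i \<in> I" for i
    using that by fastforce+
  note \<iota>D = chain_mapD(3-7)[OF \<iota>(2)]
  obtain Zo where Zo: "is_zero_obj C Zo" using zero_obj_exists by blast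
  note Zoo = zero_objD(1)[OF Zo]
  have "\<exists>!h. h \<in> Hom C (ent S j) T \<and> (\<forall>i\<in>I. h \<cdot> cmpt (\<iota> i) j = f i)"
    if T: "T \<in> Obj C" and f: "\<And>i. i \<in> I \<Longrightarrow> f i \<in> Hom C (ent (B i) j) T" for T f
  proof -
    define e where "e n = (if n = j \<or> n = j + 1 then T else Zo)" for n
    have e: "e n \<in> Obj C" for n using T Zoo by (simp add: e_def)
    define D where "D = \<lparr>ent = e, dif = \<lambda>n. if n = j + 1 then Ident C T else Zero C (e n) (e (n -
        1))\<rparr>"
    have D: "is_complex C D"
      unfolding is_complex_def D_def using e T Zoo
          by (auto simp: Hom_def add_simps) (auto simp: e_def add_simps)
    define dm where "dm X u n = (if n = j then u else
        if n = j + 1 then u \<cdot> dif X (j + 1) else Zero C (ent X n) (e n))"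
      for X :: "('a, 'b) cplx" and u n
    have dm: "is_chain_map C (X, D, dm X u)" if X: "is_complex C X" and u: "u \<in> Hom C (ent X j) T"
        for X u
    proof (rule chain_mapI[OF X D])
      fix n
      note ty = cplxD[OF X] u[unfolded Hom_def, simplified] T e
      have eT: "e j = T" "e (j + 1) = T" by (simp_all add: e_def)
      show "dm X u n \<in> Hom C (ent X n) (ent D n)"
        by (auto simp: dm_def D_def Hom_def ty eT add_simps)
      consider "n = j" | "n = j + 1" | "n = j + 2" | "n < j" | "n > j + 2" by linarith
      then show "dif D n \<cdot> dm X u n = dm X u (n - 1) \<cdot> dif X n"
        by cases (auto simp: dm_def D_def ty eT add_simps add.commute[of 1 j])
    qed
    have Bc: "is_complex C (B i)" if "i \<in> I" for i using chain_mapD(1)[OF \<iota>(2)[OF that]] .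
    have "(B i, D, dm (B i) (f i)) \<in> Hom (Ch C) (B i) D" if "i \<in> I" for i
      using dm[OF Bc[OF that] f[OF that]] by (simp add: Hom_Ch)
    moreover have "D \<in> Obj (Ch C)" using D by (simp add: Ch_simps)
    ultimately have ex1: "\<exists>!h. h \<in> Hom (Ch C) S D \<and> (\<forall>i\<in>I. h \<cdot>\<^bsub>Ch C\<^esub> \<iota> i =
        (B i, D, dm (B i) (f i)))"
      using S[unfolded is_coproduct_def, THEN conjunct2, THEN conjunct2, rule_format, of D "\<lambda>i. (B
          i, D, dm (B i) (f i))"]
      by simp
    then obtain h where h: "is_chain_map C (S, D, h)" "\<And>i. i \<in> I \<Longrightarrow> (S, D, h) \<cdot>\<^bsub>Ch C\<^esub> \<iota> i =
        (B i, D, dm (B i) (f i))"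
      by (auto simp: Hom_Ch)
    have "h j \<in> Hom C (ent S j) T" using chain_mapD(3-5)[OF h(1), of j]
        by (simp add: Hom_def D_def e_def)
    moreover have "h j \<cdot> cmpt (\<iota> i) j = f i" if "i \<in> I" for i
      using fun_cong[OF arg_cong[OF h(2)[OF that], of cmpt], of j] by (simp add: Ch_simps dm_def)
    \<comment> \<open>Two candidates in degree \<open>j\<close> have adjoint chain maps
      \<open>S \<rightarrow> D\<close> with the same restrictions to all \<open>B i\<close>, so
      these chain maps coincide.\<close>
    moreover have "k = k'"
      if k: "k \<in> Hom C (ent S j) T" "\<And>i. i \<in> I \<Longrightarrow> k \<cdot> cmpt (\<iota> i) j = f i" and
         k': "k' \<in> Hom C (ent S j) T" "\<And>i. i \<in> I \<Longrightarrow> k' \<cdot> cmpt (\<iota> i) j = f i" for k k'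
    proof -
      have *: "(S, D, dm S k) \<in> Hom (Ch C) S D \<and> (\<forall>i\<in>I. (S, D, dm S k) \<cdot>\<^bsub>Ch C\<^esub> \<iota> i =
          (B i, D, dm (B i) (f i)))"
        if k: "k \<in> Hom C (ent S j) T" "\<And>i. i \<in> I \<Longrightarrow> k \<cdot> cmpt (\<iota> i) j = f i" for k
      proof (intro conjI ballI)
        show "(S, D, dm S k) \<in> Hom (Ch C) S D" using dm[OF Sc k(1)] by (simp add: Hom_Ch)
        fix i assume i: "i \<in> I"
        note ty = \<iota>D[OF i] k(1)[unfolded Hom_def, simplified] cplxD[OF Sc]
            cplxD[OF chain_mapD(1)[OF \<iota>(2)[OF i]]] e
        have "dm S k n \<cdot> cmpt (\<iota> i) n = dm (B i) (f i) n" for n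
          using comp_reassoc[OF k(2)[OF i], of "dif (B i) (j + 1)"]
              by (auto simp: dm_def ty add_simps k(2)[OF i])
        moreover have "src (\<iota> i) = B i" using \<iota>(1)[OF i] by (metis fst_conv)
        ultimately show "(S, D, dm S k) \<cdot>\<^bsub>Ch C\<^esub> \<iota> i = (B i, D, dm (B i) (f i))"
          by (simp add: Ch_simps)
      qed
      have "(S, D, dm S k) = (S, D, dm S k')"
        using ex1 *[OF k] *[OF k'] by (metis (no_types, lifting))
      then show ?thesis by (auto simp: dm_def dest: fun_cong[of _ _ j])
    qed
    ultimately show ?thesis by (intro ex1I[of _ "h j"]) blast+
  qed
  then show ?thesis
    unfolding is_coproduct_def using cplxD[OF Sc] \<iota>D by (auto simp: Hom_def)
qed

end

context exact_category
begin

text \<open>An element of the cone bounding \<open>(a, b)\<close> is \<open>(- a', b')\<close>; the sign of \<open>a'\<close> is flipped here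
  so that no negations occur.\<close>

lemma cone_exactI:
  assumes c: "is_cone E A B f K i1 i2 p1 p2"
    and ex: "\<And>T a b. a \<in> Hom E T (ent A (j - 1)) \<Longrightarrow> b \<in> Hom E T (ent B j) \<Longrightarrow>
      dif A (j - 1) \<cdot> a = Zero E T (ent A (j - 2)) \<Longrightarrow>
      (f (j - 1) \<cdot> a) \<^bold>+ (dif B j \<cdot> b) = Zero E T (ent B (j - 1)) \<Longrightarrow>
      \<exists>T' q a' b'. q \<in> Hom E T' T \<and> adm_epic E q \<and> a' \<in> Hom E T' (ent A j) \<and>
          b' \<in> Hom E T' (ent B (j + 1)) \<and>
        dif A j \<cdot> a' = a \<cdot> q \<and> (f j \<cdot> a') \<^bold>+ (b \<cdot> q) = dif B (j + 1) \<cdot> b'"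
  shows "exact_at E K j"
  unfolding exact_at_def
proof (intro allI impI, elim conjE)
  fix T z assume z: "z \<in> Hom E T (ent K j)" "dif K j \<cdot> z = Zero E T (ent K (j - 1))"
  note ty = biproductD[OF coneD(5)[OF c]] cplxD[OF coneD(2)[OF c]] cplxD[OF coneD(3)[OF c]]
    cplxD[OF coneD(4)[OF c]] chain_mapD(3-7)[OF coneD(1)[OF c]] z(1)[unfolded Hom_def, simplified]
    Hom_obj[OF z(1)]
  have "Neg E (dif A (j - 1) \<cdot> (p1 j \<cdot> z)) = Zero E T (ent A (j - 2))"
    using cone_simps(3)[OF c, of "j - 1" j z] z(2) by (simp add: ty add_simps)
  then have 1: "dif A (j - 1) \<cdot> (p1 j \<cdot> z) = Zero E T (ent A (j - 2))"
    using neg_neg[of "dif A (j - 1) \<cdot> (p1 j \<cdot> z)"] by (simp add: ty add_simps)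
  have 2: "(f (j - 1) \<cdot> (p1 j \<cdot> z)) \<^bold>+ (dif B j \<cdot> (p2 j \<cdot> z)) = Zero E T (ent B (j - 1))"
    using cone_simps(4)[OF c, of "j - 1" j z] z(2) by (simp add: ty add_simps)
  obtain T' q a b where q: "q \<in> Hom E T' T" "adm_epic E q" and a: "a \<in> Hom E T' (ent A j)"
    and b: "b \<in> Hom E T' (ent B (j + 1))"
    and e: "dif A j \<cdot> a = (p1 j \<cdot> z) \<cdot> q" "(f j \<cdot> a) \<^bold>+ ((p2 j \<cdot> z) \<cdot> q) = dif B (j + 1) \<cdot> b"
    using ex[OF _ _ 1 2] by (auto simp: Hom_def ty add_simps)
  note ty2 = ty Hom_obj[OF q(1)] q(1)[unfolded Hom_def, simplified]
      a[unfolded Hom_def, simplified] b[unfolded Hom_def, simplified]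
  define y where "y = (i1 (j + 1) \<cdot> Neg E a) \<^bold>+ (i2 (j + 1) \<cdot> b)"
  have y: "y \<in> Hom E T' (ent K (j + 1))" by (simp add: y_def Hom_def ty2 add_simps)
  have "dif K (j + 1) \<cdot> y = z \<cdot> q"
    by (rule biproduct_eq_in[OF coneD(5)[OF c, of j]])
      (use e in \<open>simp_all add: Hom_def y_def ty2 add_simps cone_simps[OF c] e(2)[symmetric]\<close>)
  then show "\<exists>T' q y. q \<in> Hom E T' T \<and> adm_epic E q \<and> y \<in> Hom E T' (ent K (j + 1)) \<and>
      dif K (j + 1) \<cdot> y = z \<cdot> q"
    using q y by blast
qed

text \<open>Same sign convention as in \<open>cone_exactI\<close>: the bounding \<open>a'\<close> is
  minus the first coordinate of the element supplied by exactness.\<close>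

lemma cone_exactD:
  assumes c: "is_cone E A B f K i1 i2 p1 p2" and ex: "exact_at E K j"
    and a: "a \<in> Hom E T (ent A (j - 1))" and b: "b \<in> Hom E T (ent B j)"
    and e: "dif A (j - 1) \<cdot> a = Zero E T (ent A (j - 2))"
      "(f (j - 1) \<cdot> a) \<^bold>+ (dif B j \<cdot> b) = Zero E T (ent B (j - 1))"
  shows "\<exists>T' q a' b'. q \<in> Hom E T' T \<and> adm_epic E q \<and> a' \<in> Hom E T' (ent A j) \<and>
      b' \<in> Hom E T' (ent B (j + 1)) \<and>
        dif A j \<cdot> a' = a \<cdot> q \<and> (f j \<cdot> a') \<^bold>+ (b \<cdot> q) = dif B (j + 1) \<cdot> b'"
proof -
  note ty = biproductD[OF coneD(5)[OF c]] cplxD[OF coneD(2)[OF c]] cplxD[OF coneD(3)[OF c]]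
    cplxD[OF coneD(4)[OF c]] chain_mapD(3-7)[OF coneD(1)[OF c]] a[unfolded Hom_def, simplified]
    b[unfolded Hom_def, simplified] Hom_obj[OF a]
  define z where "z = (i1 j \<cdot> a) \<^bold>+ (i2 j \<cdot> b)"
  have z: "z \<in> Hom E T (ent K j)" by (simp add: z_def ty add_simps Hom_def)
  have "dif K j \<cdot> z = Zero E T (ent K (j - 1))"
    by (rule biproduct_eq_in[OF coneD(5)[OF c, of "j - 1"]])
      (simp_all add: Hom_def z_def ty add_simps cone_simps[OF c] e)
  with ex z obtain T' q y where q: "q \<in> Hom E T' T" "adm_epic E q"
      and y: "y \<in> Hom E T' (ent K (j + 1))"
    and dy: "dif K (j + 1) \<cdot> y = z \<cdot> q"
    unfolding exact_at_def by blast
  note ty2 = ty Hom_obj[OF q(1)] q(1)[unfolded Hom_def, simplified] y[unfolded Hom_def, simplified]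
  have 1: "Neg E (dif A j \<cdot> (p1 (j + 1) \<cdot> y)) = a \<cdot> q"
    using arg_cong[OF dy, of "\<lambda>x. p1 j \<cdot> x"] by (simp add: z_def ty2 add_simps cone_simps[OF c])
  have 2: "(f j \<cdot> (p1 (j + 1) \<cdot> y)) \<^bold>+ (dif B (j + 1) \<cdot> (p2 (j + 1) \<cdot> y)) = b \<cdot> q"
    using arg_cong[OF dy, of "\<lambda>x. p2 j \<cdot> x"] by (simp add: z_def ty2 add_simps cone_simps[OF c])
  show ?thesis
    using q
    by (intro exI[of _ T'] exI[of _ q] exI[of _ "Neg E (p1 (j + 1) \<cdot> y)"]
        exI[of _ "p2 (j + 1) \<cdot> y"])
       (simp add: Hom_def ty2 add_simps 1 2[symmetric])
qed

end


section \<open>Local lifting\<close>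

text \<open>\<open>local_lift E B X f j\<close> for all \<open>j\<close> characterizes the degreewise admissible epimorphic
  quasi-isomorphisms \<open>f : B \<rightarrow> X\<close>, and is easier to propagate than acyclicity of the cone.\<close>

definition local_lift ::
  "('o, 'm, 'z) excat_scheme \<Rightarrow> ('o, 'm) cplx \<Rightarrow> ('o, 'm) cplx \<Rightarrow> (int \<Rightarrow> 'm) \<Rightarrow> int \<Rightarrow> bool" where
  "local_lift E B X f j \<longleftrightarrow>
     (\<forall>T x b. x \<in> Hom E T (ent X j) \<and> b \<in> Hom E T (ent B (j - 1)) \<and>
        dif X j \<cdot>\<^bsub>E\<^esub> x = f (j - 1) \<cdot>\<^bsub>E\<^esub> b \<and> dif B (j - 1) \<cdot>\<^bsub>E\<^esub> b = Zero E T (ent B (j - 2)) \<longrightarrow>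
        (\<exists>T' q c. q \<in> Hom E T' T \<and> adm_epic E q \<and> c \<in> Hom E T' (ent B j) \<and>
           f j \<cdot>\<^bsub>E\<^esub> c = x \<cdot>\<^bsub>E\<^esub> q \<and> dif B j \<cdot>\<^bsub>E\<^esub> c = b \<cdot>\<^bsub>E\<^esub> q))"

text \<open>The shift without the customary sign on the differential. It only serves to move degree
  bounds, since AB4-k is normalized to the bound 0.\<close>

definition reindex :: "int \<Rightarrow> ('o, 'm) cplx \<Rightarrow> ('o, 'm) cplx" where
  "reindex N X = \<lparr>ent = \<lambda>j. ent X (j + N), dif = \<lambda>j. dif X (j + N)\<rparr>"

lemma reindex_simps [simp]: "ent (reindex N X) j = ent X (j + N)" "dif (reindex N X) j =
    dif X (j + N)"
  by (simp_all add: reindex_def)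

context additive_category
begin

lemma reindex_complex: "is_complex C X \<Longrightarrow> is_complex C (reindex N X)"
  unfolding is_complex_def
  by (auto simp: Hom_def add_diff_eq diff_add_eq)

lemma reindex_chain_map:
  assumes "is_chain_map C (X, Y, f)"
  shows "is_chain_map C (reindex N X, reindex N Y, \<lambda>j. f (j + N))"
proof -
  have *: "n - 1 + N = n + N - 1" for n by simp
  show ?thesis
  using chain_mapD[OF assms]
  by (intro chain_mapI) (auto simp: reindex_complex Hom_def *)
qed

lemma zero_objI:
  assumes "S \<in> Obj C" "Ident C S = Zero C S S"
  shows "is_zero_obj C S"
  unfolding is_zero_obj_def
proof (intro conjI ballI assms(1))
  fix T assume T: "T \<in> Obj C"
  have "f = Zero C S T" if "f \<in> Hom C S T" for f
    using id_right[of f S] assms that comp_zero[of f S S] by (auto simp: Hom_def)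
  then show "\<exists>!f. f \<in> Hom C S T" using T assms
      by (intro ex1I[of _ "Zero C S T"]) (auto simp: Hom_def add_simps)
  have "f = Zero C T S" if "f \<in> Hom C T S" for f
    using id_left[of f S] assms that zero_comp[of f S S] by (auto simp: Hom_def)
  then show "\<exists>!f. f \<in> Hom C T S" using T assms
      by (intro ex1I[of _ "Zero C T S"]) (auto simp: Hom_def add_simps)
qed

lemma zero_obj_id: "is_zero_obj C S \<Longrightarrow> Ident C S = Zero C S S"
  using zero_objD(3)[of S "Ident C S"] zero_objD(1)[of S] by (simp add: add_simps)

lemma biproduct_zero:
  assumes "is_biproduct C A B S i1 i2 p1 p2" "is_zero_obj C A" "is_zero_obj C B"
  shows "is_zero_obj C S"
proof (rule zero_objI)
  note b = biproductD[OF assms(1)]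
  show S: "S \<in> Obj C" by fact
  have "p1 = Zero C S A" "p2 = Zero C S B" using zero_objD(2)[OF assms(2), of p1]
      zero_objD(2)[OF assms(3), of p2] b by auto
  then show "Ident C S = Zero C S S"
    using biproduct_sum[OF assms(1)] b by (simp add: add_simps)
qed

section \<open>Closure properties of \<open>P\<close>\<close>

lemma closed_coproduct:
  fixes I :: "nat set"
  assumes "closed_under_countable_coproducts C P" "\<And>i. i \<in> I \<Longrightarrow> A i \<in> P"
  shows "\<exists>S \<iota>. is_coproduct C I A S \<iota>" "is_coproduct C I A S \<iota> \<Longrightarrow> S \<in> P"
proof -
  have "(\<forall>i\<in>I. A i \<in> P) \<longrightarrow>
      (\<exists>S \<iota>. is_coproduct C I A S \<iota>) \<and> (\<forall>S \<iota>. is_coproduct C I A S \<iota> \<longrightarrow> S \<in> P)"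
    by (rule spec[OF spec[OF assms(1)[unfolded closed_under_countable_coproducts_def]]])
  then show "\<exists>S \<iota>. is_coproduct C I A S \<iota>" "is_coproduct C I A S \<iota> \<Longrightarrow> S \<in> P"
    using assms(2) by blast+
qed

text \<open>A zero object is the coproduct over the empty index set.\<close>

lemma closed_zero:
  assumes "closed_under_countable_coproducts C P" "is_zero_obj C Z"
  shows "Z \<in> P"
proof (rule closed_coproduct(2)[OF assms(1), of "{}"])
  show "is_coproduct C ({} :: nat set) (\<lambda>_. Z) Z (\<lambda>_. Ident C Z)"
    using assms(2) by (simp add: is_coproduct_def is_zero_obj_def)
qed simp

lemma biproduct_coproduct:
  assumes "is_biproduct C A B S i1 i2 p1 p2"
  shows "is_coproduct C {0, 1 :: nat} (\<lambda>n. if n = 0 then A else B) S (\<lambda>n. if n = 0 then i1 else i2)"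
proof -
  note b = biproductD[OF assms]
  have "\<exists>!h. h \<in> Hom C S T \<and> h \<cdot> i1 = f 0 \<and> h \<cdot> i2 = f 1"
    if f: "f 0 \<in> Hom C A T" "f 1 \<in> Hom C B T" for T and f :: "nat \<Rightarrow> 'b"
  proof -
    note ty = b f[unfolded Hom_def, simplified]
    show ?thesis
    proof (rule ex1I[of _ "(f 0 \<cdot> p1) \<^bold>+ (f 1 \<cdot> p2)"])
      show 1: "f 0 \<cdot> p1 \<^bold>+ f 1 \<cdot> p2 \<in> Hom C S T \<and> (f 0 \<cdot> p1 \<^bold>+ f 1 \<cdot> p2) \<cdot> i1 = f 0 \<and>
          (f 0 \<cdot> p1 \<^bold>+ f 1 \<cdot> p2) \<cdot> i2 = f 1"
        using Hom_obj[OF f(1)] by (auto simp: Hom_def ty add_simps)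
      fix h assume h: "h \<in> Hom C S T \<and> h \<cdot> i1 = f 0 \<and> h \<cdot> i2 = f 1"
      show "h = f 0 \<cdot> p1 \<^bold>+ f 1 \<cdot> p2"
        by (rule biproduct_eq_out[OF assms]) (use h 1 in auto)
    qed
  qed
  moreover have "i1 \<in> Hom C A S" "i2 \<in> Hom C B S" using b by (simp_all add: Hom_def)
  ultimately show ?thesis using b(3) by (simp add: is_coproduct_def)
qed

lemma closed_biproduct:
  assumes "closed_under_countable_coproducts C P" "is_biproduct C A B S i1 i2 p1 p2" "A \<in> P" "B \<in> P"
  shows "S \<in> P"
  by (rule closed_coproduct(2)[OF assms(1) _ biproduct_coproduct[OF assms(2)]]) (use assms(3,4) in
      auto)

text \<open>Makes relative cones admissible inputs for AB4-k. The entry \<open>A\<close> at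
  \<open>n - 1\<close> vanishes already for \<open>n < M\<close>, so \<open>min M N\<close> is a
  common bound.\<close>

lemma cone_Ch_plus:
  assumes c: "is_cone C A B f K i1 i2 p1 p2" and P: "closed_under_countable_coproducts C P"
    and "A \<in> Ch_plus_in C P" "B \<in> Ch_plus_in C P"
  shows "K \<in> Ch_plus_in C P"
proof -
  from assms(3,4) obtain M N where A: "\<And>n. ent A n \<in> P" "\<And>n. n < M \<Longrightarrow> is_zero_obj C (ent A n)"
    and B: "\<And>n. ent B n \<in> P" "\<And>n. n < N \<Longrightarrow> is_zero_obj C (ent B n)"
    by (auto simp: Ch_plus_in_def Ch_in_def)
  have "ent K n \<in> P" for n using closed_biproduct[OF P coneD(5)[OF c]] A B by blast
  moreover have "is_zero_obj C (ent K n)" if "n < min M N" for n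
    by (rule biproduct_zero[OF coneD(5)[OF c]]) (use that A(2)[of "n - 1"] B(2)[of n] in auto)
  ultimately show ?thesis using coneD(2)[OF c] unfolding Ch_plus_in_def Ch_in_def by blast
qed

end

section \<open>Exactness of cones and local lifting\<close>

context exact_category_with_kernels
begin

lemma reindex_exact_at: "exact_at E (reindex N X) j \<longleftrightarrow> exact_at E X (j + N)"
  by (simp add: exact_at_def add_diff_eq diff_add_eq add.assoc add.commute[of 1 N])

text \<open>AB4-k is applied to the complexes reindexed by \<open>N\<close>, and its coproduct is
  reindexed back. That coproduct lives in \<open>Ch E\<close>; evaluating it degreewise is what
  makes it usable in the telescope.\<close>

lemma AB4_coproduct:
  fixes B :: "nat \<Rightarrow> ('a, 'b) cplx"
  assumes AB4: "AB4 E k P" and B: "\<And>n. B n \<in> Ch_plus_in E P"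
    and ex: "\<And>n j. N \<le> j \<Longrightarrow> exact_at E (B n) j"
  shows "\<exists>S \<kappa>. (\<forall>n. is_chain_map E (B n, S, \<kappa> n)) \<and>
     (\<forall>j. is_coproduct E UNIV (\<lambda>n. ent (B n) j) (ent S j) (\<lambda>n. \<kappa> n j)) \<and>
         (\<forall>j \<ge> N - k + 1. exact_at E S j)"
proof -
  have Bc: "is_complex E (B n)" for n using B by (simp add: Ch_plus_in_def Ch_in_def)
  have "reindex N (B n) \<in> Ch_plus_in E P" for n
  proof -
    from B[of n] obtain M where "\<And>j. ent (B n) j \<in> P" "\<And>j. j < M \<Longrightarrow> is_zero_obj E (ent (B n) j)"
      by (auto simp: Ch_plus_in_def Ch_in_def)
    then show ?thesis unfolding Ch_plus_in_def Ch_in_def using reindex_complex[OF Bc]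
      by (auto intro!: exI[of _ "M - N"])
  qed
  moreover have "homologically_le E 0 (reindex N (B n))" for n
    by (rule homologically_leI[OF reindex_complex[OF Bc]]) (simp add: reindex_exact_at ex)
  ultimately obtain S \<iota> where S: "is_coproduct (Ch E) UNIV (\<lambda>n. reindex N (B n)) S \<iota>"
      and h: "homologically_le E (- k + 1) S"
    using AB4[unfolded AB4_def, rule_format, of "\<lambda>n. reindex N (B n)"] by blast
  have \<iota>: "is_chain_map E (reindex N (B n), S, cmpt (\<iota> n))" for n
  proof -
    have "\<exists>g. \<iota> n = (reindex N (B n), S, g) \<and> is_chain_map E (reindex N (B n), S, g)"
      using S by (simp add: is_coproduct_def Hom_Ch)
    then show ?thesis by force
  qed
  have "reindex (- N) (reindex N X) = X" for X :: "('a, 'b) cplx" by (simp add: reindex_def)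
  with reindex_chain_map[OF \<iota>, of "- N"] have 1: "is_chain_map E (B n, reindex (- N) S, \<lambda>j. cmpt
      (\<iota> n) (j + - N))" for n
    by simp
  have 2: "is_coproduct E UNIV (\<lambda>n. ent (B n) j) (ent (reindex (- N) S) j) (\<lambda>n. cmpt (\<iota> n) (j + -
      N))" for j
    using coproduct_Ch_degreewise[OF S, of "j + - N"] by simp
  have 3: "exact_at E (reindex (- N) S) j" if "j \<ge> N - k + 1" for j
    unfolding reindex_exact_at by (rule homologically_le_imp_exact_at[OF h]) (use that in simp)
  show ?thesis
    by (rule exI[of _ "reindex (- N) S"], rule exI[of _ "\<lambda>n j. cmpt (\<iota> n) (j + - N)"]) (intro
        conjI allI impI 1 2 3)
qed

text \<open>For a cycle \<open>(a, b)\<close> of the cone, lifting the pair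
  \<open>(- f b, a)\<close> to \<open>A\<close> in degree \<open>j\<close> bounds \<open>a\<close>
  by some \<open>a'\<close>. Then \<open>\<phi> a' + b\<close> is a cycle killed by
  \<open>f\<close>, and lifting in degree \<open>j + 1\<close> for \<open>B\<close> bounds
  it.\<close>

lemma cone_exact_of_lift:
  assumes f0: "is_chain_map E (A, X, f0)" and f: "is_chain_map E (B, X, f)"
      and ff: "\<And>n. f n \<cdot> \<phi> n = f0 n"
    and c: "is_cone E A B \<phi> K i1 i2 p1 p2" and l: "local_lift E A X f0 j"
        "local_lift E B X f (j + 1)"
  shows "exact_at E K j"
proof (rule cone_exactI[OF c])
  fix T a b assume a: "a \<in> Hom E T (ent A (j - 1))" and b: "b \<in> Hom E T (ent B j)"
    and da: "dif A (j - 1) \<cdot> a = Zero E T (ent A (j - 2))"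
    and e: "\<phi> (j - 1) \<cdot> a \<^bold>+ dif B j \<cdot> b = Zero E T (ent B (j - 1))"
  note ty = cplxD[OF coneD(3)[OF c]] cplxD[OF coneD(4)[OF c]] cplxD[OF chain_mapD(2)[OF f]]
      chain_mapD(3-7)[OF f0]
    chain_mapD(3-7)[OF f] chain_mapD(3-7)[OF coneD(1)[OF c]] Hom_obj[OF a]
        a[unfolded Hom_def, simplified]
    b[unfolded Hom_def, simplified]
  have ff': "h \<in> Arr E \<Longrightarrow> Cod E h = ent A n \<Longrightarrow> f n \<cdot> (\<phi> n \<cdot> h) = f0 n \<cdot> h" for h n
    using comp_reassoc[OF ff, of n h] by (simp add: ty)
  have "dif B j \<cdot> b = Neg E (\<phi> (j - 1) \<cdot> a)"
    using e by (rule eq_neg) (simp_all add: ty add_simps)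
  then have "dif X j \<cdot> Neg E (f j \<cdot> b) = f0 (j - 1) \<cdot> a"
    by (simp add: ty add_simps ff')
  then obtain T1 q1 a' where q1: "q1 \<in> Hom E T1 T" "adm_epic E q1" and a': "a' \<in> Hom E T1 (ent A j)"
    and e1: "f0 j \<cdot> a' = Neg E (f j \<cdot> b) \<cdot> q1" "dif A j \<cdot> a' = a \<cdot> q1"
    using l(1)[unfolded local_lift_def, rule_format, of "Neg E (f j \<cdot> b)" T a] a da
        by (auto simp: ty Hom_def add_simps)
  note ty2 = ty Hom_obj[OF q1(1)] q1(1)[unfolded Hom_def, simplified]
      a'[unfolded Hom_def, simplified]
  have "dif B j \<cdot> ((\<phi> j \<cdot> a') \<^bold>+ (b \<cdot> q1)) = ((\<phi> (j - 1) \<cdot> a) \<^bold>+ (dif B j \<cdot> b)) \<cdot> q1"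
    by (simp add: ty2 add_simps e1)
  also have "\<dots> = Zero E T1 (ent B (j - 1))" unfolding e by (simp add: ty2 add_simps)
  finally have "dif B j \<cdot> ((\<phi> j \<cdot> a') \<^bold>+ (b \<cdot> q1)) = Zero E T1 (ent B (j - 1))" .
  moreover have "f j \<cdot> ((\<phi> j \<cdot> a') \<^bold>+ (b \<cdot> q1)) = Zero E T1 (ent X j)"
    by (simp add: ty2 add_simps ff' e1)
  \<comment> \<open>Local lifting for the pair with first component zero: a cycle in the kernel of
    \<open>f\<close> becomes a boundary.\<close>
  ultimately obtain T2 q2 b' where q2: "q2 \<in> Hom E T2 T1" "adm_epic E q2"
      and b': "b' \<in> Hom E T2 (ent B (j + 1))"
    and e2: "dif B (j + 1) \<cdot> b' = ((\<phi> j \<cdot> a') \<^bold>+ (b \<cdot> q1)) \<cdot> q2"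
    using l(2)[unfolded local_lift_def, rule_format, of "Zero E T1 (ent X (j + 1))"
        T1 "(\<phi> j \<cdot> a') \<^bold>+ (b \<cdot> q1)"]
    by (auto simp: ty2 Hom_def add_simps)
  note ty3 = ty2 q2(1)[unfolded Hom_def, simplified] b'[unfolded Hom_def, simplified]
  show "\<exists>T' q a' b'. q \<in> Hom E T' T \<and> adm_epic E q \<and> a' \<in> Hom E T' (ent A j) \<and>
      b' \<in> Hom E T' (ent B (j + 1)) \<and>
        dif A j \<cdot> a' = a \<cdot> q \<and> \<phi> j \<cdot> a' \<^bold>+ b \<cdot> q = dif B (j + 1) \<cdot> b'"
    using adm_epic_comp_hom[OF q1 q2] comp_reassoc[OF e1(2), of q2]
    by (intro exI[of _ T2] exI[of _ "q1 \<cdot> q2"] exI[of _ "a' \<cdot> q2"] exI[of _ b'])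
       (simp add: Hom_def ty3 add_simps e2)
qed

text \<open>For a pair \<open>(x, z)\<close>, exactness of the cone at \<open>(0, z)\<close> gives
  locally \<open>\<phi> a + z = d b\<close> with \<open>a\<close> a cycle of \<open>A\<close>. The
  pair \<open>(f b - x, a)\<close> lifts to some \<open>a'\<close> in \<open>A\<close>, and
  \<open>b - \<phi> a'\<close> is the required lift.\<close>

lemma lift_of_cone_exact:
  assumes f0: "is_chain_map E (A, X, f0)" and f: "is_chain_map E (Q, X, f)"
      and ff: "\<And>n. f n \<cdot> \<phi> n = f0 n"
    and c: "is_cone E A Q \<phi> K i1 i2 p1 p2" and l: "local_lift E A X f0 j"
        and ex: "exact_at E K (j - 1)"
  shows "local_lift E Q X f j"
  unfolding local_lift_def
proof (intro allI impI, elim conjE)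
  fix T x z assume x: "x \<in> Hom E T (ent X j)" and z: "z \<in> Hom E T (ent Q (j - 1))"
    and dx: "dif X j \<cdot> x = f (j - 1) \<cdot> z" and dz: "dif Q (j - 1) \<cdot> z = Zero E T (ent Q (j - 2))"
  note ty = cplxD[OF coneD(3)[OF c]] cplxD[OF coneD(4)[OF c]] cplxD[OF chain_mapD(2)[OF f]]
      chain_mapD(3-7)[OF f0]
    chain_mapD(3-7)[OF f] chain_mapD(3-7)[OF coneD(1)[OF c]] Hom_obj[OF x]
        x[unfolded Hom_def, simplified]
    z[unfolded Hom_def, simplified]
  have ff': "h \<in> Arr E \<Longrightarrow> Cod E h = ent A n \<Longrightarrow> f n \<cdot> (\<phi> n \<cdot> h) = f0 n \<cdot> h" for h n
    using comp_reassoc[OF ff, of n h] by (simp add: ty)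
  obtain T1 q1 a b where q1: "q1 \<in> Hom E T1 T" "adm_epic E q1" and a: "a \<in> Hom E T1 (ent A (j - 1))"
    and b: "b \<in> Hom E T1 (ent Q j)" and da: "dif A (j - 1) \<cdot> a = Zero E T1 (ent A (j - 2))"
    and e: "\<phi> (j - 1) \<cdot> a \<^bold>+ z \<cdot> q1 = dif Q j \<cdot> b"
    using cone_exactD[OF c ex, of "Zero E T (ent A (j - 2))" T z] z dz
        by (auto simp: ty Hom_def add_simps)
  note ty2 = ty Hom_obj[OF q1(1)] q1(1)[unfolded Hom_def, simplified]
      a[unfolded Hom_def, simplified] b[unfolded Hom_def, simplified]
  have "dif X j \<cdot> (f j \<cdot> b) = f (j - 1) \<cdot> (\<phi> (j - 1) \<cdot> a \<^bold>+ z \<cdot> q1)"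
    unfolding e by (simp add: ty2 add_simps)
  also have "\<dots> = f0 (j - 1) \<cdot> a \<^bold>+ dif X j \<cdot> (x \<cdot> q1)"
    using comp_reassoc[OF dx, of q1] by (simp add: ty2 add_simps ff')
  finally have "dif X j \<cdot> ((f j \<cdot> b) \<^bold>+ Neg E (x \<cdot> q1)) = f0 (j - 1) \<cdot> a"
    by (simp add: ty2 add_simps)
  then obtain T2 q2 a' where q2: "q2 \<in> Hom E T2 T1" "adm_epic E q2"
      and a': "a' \<in> Hom E T2 (ent A j)"
    and e1: "f0 j \<cdot> a' = ((f j \<cdot> b) \<^bold>+ Neg E (x \<cdot> q1)) \<cdot> q2" "dif A j \<cdot> a' = a \<cdot> q2"
    using l[unfolded local_lift_def, rule_format, of "(f j \<cdot> b) \<^bold>+ Neg E (x \<cdot> q1)" T1 a] a da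
        by (auto simp: ty2 Hom_def add_simps)
  note ty3 = ty2 Hom_obj[OF q2(1)] q2(1)[unfolded Hom_def, simplified]
      a'[unfolded Hom_def, simplified]
  define y where "y = Neg E (\<phi> j \<cdot> a') \<^bold>+ (b \<cdot> q2)"
  have "dif Q j \<cdot> (b \<cdot> q2) = (\<phi> (j - 1) \<cdot> a \<^bold>+ z \<cdot> q1) \<cdot> q2"
    using comp_reassoc[OF e[symmetric], of q2] by (simp add: ty3)
  then have "dif Q j \<cdot> y = z \<cdot> (q1 \<cdot> q2)"
    by (simp add: y_def ty3 add_simps e1(2))
  moreover have "f j \<cdot> y = x \<cdot> (q1 \<cdot> q2)"
    by (simp add: y_def ty3 add_simps ff' e1(1) add_comm[of "x \<cdot> (q1 \<cdot> q2)"])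
  ultimately show "\<exists>T' q c. q \<in> Hom E T' T \<and> adm_epic E q \<and> c \<in> Hom E T' (ent Q j) \<and> f j \<cdot> c =
      x \<cdot> q \<and> dif Q j \<cdot> c = z \<cdot> q"
    using adm_epic_comp_hom[OF q1 q2]
    by (intro exI[of _ T2] exI[of _ "q1 \<cdot> q2"] exI[of _ y]) (simp add: Hom_def y_def ty3 add_simps)
qed

text \<open>A cycle \<open>(a, b)\<close> of the cone is bounded by a lift of the pair
  \<open>(- b, a)\<close>; the second coordinate of the bounding element can be zero.\<close>

lemma quasi_iso_of_lift:
  assumes f: "is_chain_map E (Q, X, f)" and l: "\<And>j. local_lift E Q X f j"
  shows "quasi_iso E (Q, X, f)"
proof -
  obtain K i1 i2 p1 p2 where c: "is_cone E Q X f K i1 i2 p1 p2" using cone_exists[OF f] by blast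
  have "exact_at E K j" for j
  proof (rule cone_exactI[OF c])
    fix T a b assume a: "a \<in> Hom E T (ent Q (j - 1))" and b: "b \<in> Hom E T (ent X j)"
      and da: "dif Q (j - 1) \<cdot> a = Zero E T (ent Q (j - 2))"
      and e: "f (j - 1) \<cdot> a \<^bold>+ dif X j \<cdot> b = Zero E T (ent X (j - 1))"
    note ty = cplxD[OF coneD(3)[OF c]] cplxD[OF coneD(4)[OF c]] chain_mapD(3-7)[OF f]
      Hom_obj[OF a] a[unfolded Hom_def, simplified] b[unfolded Hom_def, simplified]
    have "dif X j \<cdot> b = Neg E (f (j - 1) \<cdot> a)"
      using e by (rule eq_neg) (simp_all add: ty add_simps)
    then have "dif X j \<cdot> Neg E b = f (j - 1) \<cdot> a"
      by (simp add: ty add_simps)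
    then obtain T1 q1 a' where q1: "q1 \<in> Hom E T1 T" "adm_epic E q1"
        and a': "a' \<in> Hom E T1 (ent Q j)"
      and e1: "f j \<cdot> a' = Neg E b \<cdot> q1" "dif Q j \<cdot> a' = a \<cdot> q1"
      using l[of j, unfolded local_lift_def, rule_format, of "Neg E b" T a] a da
          by (auto simp: ty Hom_def add_simps)
    note ty2 = ty Hom_obj[OF q1(1)] q1(1)[unfolded Hom_def, simplified]
        a'[unfolded Hom_def, simplified]
    show "\<exists>T' q a' b'. q \<in> Hom E T' T \<and> adm_epic E q \<and> a' \<in> Hom E T' (ent Q j) \<and>
        b' \<in> Hom E T' (ent X (j + 1)) \<and>
        dif Q j \<cdot> a' = a \<cdot> q \<and> f j \<cdot> a' \<^bold>+ b \<cdot> q = dif X (j + 1) \<cdot> b'"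
      using q1 by (intro exI[of _ T1] exI[of _ q1] exI[of _ a']
          exI[of _ "Zero E T1 (ent X (j + 1))"])
       (simp add: Hom_def ty2 add_simps e1)
  qed
  from acyclicI[OF coneD(2)[OF c] this] show ?thesis
    unfolding quasi_iso_def mapping_cone_iff using c by blast
qed

text \<open>The identity of \<open>ent X j\<close> is lifted in two stages. Its boundary
  \<open>dif X j\<close> with the zero cycle lifts in degree \<open>j - 1\<close> to a cycle
  \<open>c\<close>, and then \<open>(q, c)\<close> is a pair that lifts in degree \<open>j\<close>.
  So an admissible epimorphism factors through \<open>f j\<close>.\<close>

lemma adm_epic_of_lift:
  assumes f: "is_chain_map E (Q, X, f)" and l: "local_lift E Q X f j" "local_lift E Q X f (j - 1)"
  shows "adm_epic E (f j)"
proof -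
  note ty = cplxD[OF chain_mapD(1)[OF f]] cplxD[OF chain_mapD(2)[OF f]] chain_mapD(3-7)[OF f]
  obtain T q c where q: "q \<in> Hom E T (ent X j)" "adm_epic E q" and c: "c \<in> Hom E T (ent Q (j - 1))"
    and e: "f (j - 1) \<cdot> c = dif X j \<cdot> q" "dif Q (j - 1) \<cdot> c = Zero E T (ent Q (j - 2))"
    using l(2)[unfolded local_lift_def, rule_format, of "dif X j" "ent X j"
        "Zero E (ent X j) (ent Q (j - 2))"]
    by (auto simp: ty Hom_def add_simps)
  obtain T' q' y where q': "q' \<in> Hom E T' T" "adm_epic E q'"
      and y: "y \<in> Hom E T' (ent Q j)" "f j \<cdot> y = q \<cdot> q'"
    using l(1)[unfolded local_lift_def, rule_format, of q T c] q c e by auto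
  show ?thesis
    using adm_epic_cancel_right[of "f j" y] adm_epic_comp_hom[OF q q'] y by (simp add: ty Hom_def)
qed

text \<open>Origin of \<open>N - k + 3\<close>: the cones of \<open>A 0 \<rightarrow> A n\<close>
  are exact from degree \<open>N\<close> on, hence their coproduct from \<open>N - k + 1\<close> on;
  exactness of the colimit cone in degree \<open>j - 1\<close>, which lifting in degree
  \<open>j\<close> requires, uses the coproduct in degrees \<open>j - 1\<close> and
  \<open>j - 2\<close>.\<close>

lemma colim_local_lift:
  assumes AB4: "AB4 E k P" and P: "closed_under_countable_coproducts E P"
    and A: "\<And>n. A n \<in> Ch_plus_in E P"
    and \<alpha>: "\<And>n. is_chain_map E (A n, A (Suc n), \<alpha> n)" and \<iota>: "\<And>n. is_chain_map E (A n, Q, \<iota> n)"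
    and t: "\<And>n j. t n j \<in> Hom E (ent (A (Suc n)) j) (ent (A n) j)"
    and ta: "\<And>n j. t n j \<cdot> \<alpha> n j = Ident E (ent (A n) j)"
    and Q: "\<And>j. seq_colim E (\<lambda>n. ent (A n) j) (\<lambda>n. \<alpha> n j) (ent Q j) (\<lambda>n. \<iota> n j)"
    and f: "\<And>n. is_chain_map E (A n, X, f n)" and F: "is_chain_map E (Q, X, F)"
    and Ff: "\<And>n j. F j \<cdot> \<iota> n j = f n j"
    and l: "\<And>n j. N \<le> j \<Longrightarrow> local_lift E (A n) X (f n) j"
    and j: "N \<le> j" "N - k + 3 \<le> j"
  shows "local_lift E Q X F j"
proof -
  note ty = cplxD(1-4)[OF chain_mapD(1)[OF \<alpha>]] cplxD(1-4)[OF chain_mapD(2)[OF \<iota>]]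
      cplxD(1-4)[OF chain_mapD(2)[OF F]]
    chain_mapD(3-5)[OF \<alpha>] chain_mapD(3-5)[OF \<iota>] chain_mapD(3-5)[OF f] chain_mapD(3-5)[OF F]
        t[unfolded Hom_def, simplified]
  have fa: "f (Suc n) j \<cdot> \<alpha> n j = f n j" for n j
    unfolding Ff[symmetric] using seq_colimD(5)[OF Q, of n j] by (simp add: ty add_simps)
  define \<psi> where "\<psi> = rec_nat (\<lambda>j. Ident E (ent (A 0) j)) (\<lambda>n p j. \<alpha> n j \<cdot> p j)"
  have \<psi>: "\<psi> 0 = (\<lambda>j. Ident E (ent (A 0) j))" "\<psi> (Suc n) = (\<lambda>j. \<alpha> n j \<cdot> \<psi> n j)" for n
    by (simp_all add: \<psi>_def)
  have \<psi>c: "is_chain_map E (A 0, A n, \<psi> n)" for n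
  proof (induction n)
    case 0
    show ?case by (rule chain_mapI) (auto simp: \<psi> ty add_simps Hom_def chain_mapD(1)[OF \<alpha>])
  next
    case (Suc n)
    note ty2 = ty chain_mapD(3-5)[OF Suc]
    show ?case
      by (rule chain_mapI) (auto simp: \<psi> ty2 add_simps Hom_def chain_mapD(1)[OF \<alpha>]
          chain_mapD(6,7)[OF \<alpha>] chain_mapD(6)[OF Suc])
  qed
  have f\<psi>: "f n j \<cdot> \<psi> n j = f 0 j" for n j
  proof (induction n)
    case (Suc n)
    then show ?case using comp_reassoc[OF fa, of n j "\<psi> n j"]
        by (simp add: \<psi> ty chain_mapD(3-5)[OF \<psi>c])
  qed (simp add: \<psi> ty add_simps)
  have \<iota>\<psi>: "\<iota> n j \<cdot> \<psi> n j = \<iota> 0 j" for n j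
  proof (induction n)
    case (Suc n)
    then show ?case using comp_reassoc[OF seq_colimD(5)[OF Q], of n j "\<psi> n j"]
        by (simp add: \<psi> ty chain_mapD(3-5)[OF \<psi>c])
  qed (simp add: \<psi> ty add_simps)
  have "\<forall>n. \<exists>K i1 i2 p1 p2. is_cone E (A 0) (A n) (\<psi> n) K i1 i2 p1 p2"
      using cone_exists[OF \<psi>c] by blast
  then obtain K i1 i2 p1 p2 where K: "\<And>n. is_cone E (A 0) (A n) (\<psi> n) (K n) (i1 n) (i2 n) (p1 n)
      (p2 n)" by metis
  obtain M j1 j2 r1 r2 where M: "is_cone E (A 0) Q (\<iota> 0) M j1 j2 r1 r2"
      using cone_exists[OF \<iota>] by blast
  \<comment> \<open>Uses lifting for \<open>A 0\<close> in degree \<open>i\<close> and for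
    \<open>A n\<close> in degree \<open>i + 1\<close>. The bound is the same for all
    \<open>n\<close>, as AB4-k demands.\<close>
  have "exact_at E (K n) i" if "N \<le> i" for n i
    by (rule cone_exact_of_lift[OF f f f\<psi> K]) (use l that in auto)
  from AB4_coproduct[of k P K N, OF AB4 cone_Ch_plus[OF K P A A] this]
  obtain S \<kappa> where S: "\<And>n. is_chain_map E (K n, S, \<kappa> n)"
    "\<And>j. is_coproduct E UNIV (\<lambda>n. ent (K n) j) (ent S j) (\<lambda>n. \<kappa> n j)" "\<And>j. j \<ge> N - k + 1 \<Longrightarrow>
        exact_at E S j"
    by blast
  have \<alpha>h: "\<alpha> n j \<in> Hom E (ent (A n) j) (ent (A (Suc n)) j)" for n j by (simp add: ty Hom_def)
  note b = biproductD[OF coneD(5)[OF K]]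
  have "exact_at E M (j - 1)"
  proof (rule telescope_exact[OF cone_map[OF K K \<alpha>] cone_map[OF K M \<iota>] _ _ _ S(1,2)])
    show "\<alpha> n j \<cdot> \<psi> n j = \<psi> (Suc n) j" for n j by (simp add: \<psi>)
    show "\<iota> n j \<cdot> \<psi> n j = \<iota> 0 j" for n j by fact
    \<comment> \<open>The degreewise retraction of the map of cones: the identity on the constant
      summand and \<open>t n j\<close> on the other.\<close>
    show "(i1 n j \<cdot> p1 (Suc n) j) \<^bold>+ (i2 n j \<cdot> (t n j \<cdot> p2 (Suc n) j)) \<in> Hom E (ent (K (Suc n)) j)
        (ent (K n) j)" for n j
      by (simp add: Hom_def ty b add_simps)
    have tt: "h \<in> Arr E \<Longrightarrow> Cod E h = ent (A n) j \<Longrightarrow> t n j \<cdot> (\<alpha> n j \<cdot> h) = h" for h n j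
      using comp_reassoc[OF ta, of n j h] by (simp add: ty add_simps)
    show "(i1 n j \<cdot> p1 (Suc n) j \<^bold>+ i2 n j \<cdot> t n j \<cdot> p2 (Suc n) j) \<cdot> (i1 (Suc n) j \<cdot> p1 n j \<^bold>+ i2
        (Suc n) j \<cdot> \<alpha> n j \<cdot> p2 n j) =
       Ident E (ent (K n) j)" for n j
      using biproduct_sum[OF coneD(5)[OF K], of n j] by (simp add: ty b add_simps tt)
    show "seq_colim E (\<lambda>n. ent (K n) j) (\<lambda>n. i1 (Suc n) j \<cdot> p1 n j \<^bold>+ i2 (Suc n) j \<cdot> \<alpha> n j \<cdot> p2 n
        j) (ent M j)
          (\<lambda>n. j1 j \<cdot> p1 n j \<^bold>+ j2 j \<cdot> \<iota> n j \<cdot> p2 n j)" for j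
      by (rule seq_colim_biproduct[OF Q \<alpha>h coneD(5)[OF K] coneD(5)[OF M]])
    show "exact_at E S (j - 1)" "exact_at E S (j - 1 - 1)" using S(3) j by auto
  qed
  then show ?thesis
    by (rule lift_of_cone_exact[OF f F Ff M l[OF j(1)]])
qed

end


section \<open>Attaching one layer\<close>

text \<open>The data chosen in one degree of an extension \<open>A \<rightarrow> B\<close> over \<open>X\<close>: the entry \<open>stB\<close> of \<open>B\<close>,
  its biproduct decomposition (\<open>sti\<close>, \<open>sts\<close>, \<open>stt\<close>, \<open>stp\<close>) into the entry of \<open>A\<close> and the new
  object \<open>stC\<close>, the differential \<open>std\<close> out of \<open>stB\<close>, and the map \<open>stf\<close> to \<open>X\<close>.\<close>

record ('o, 'm) stage =
  stB :: 'o
  stC :: 'o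
  std :: 'm
  stf :: 'm
  sti :: 'm
  sts :: 'm
  stt :: 'm
  stp :: 'm

locale covered_exact_category = exact_category_with_kernels +
  fixes P :: "'a set"
  assumes covers: "\<And>Y. Y \<in> Obj E \<Longrightarrow> \<exists>A \<in> P. \<exists>p \<in> Hom E A Y. adm_epic E p"
    and closed: "closed_under_countable_coproducts E P"
begin

text \<open>\<open>C\<close> covers the kernel of \<open>(x, b) \<mapsto> (dx x - f b, d b)\<close>
  from \<open>X1 \<oplus> B1\<close> to \<open>X0 \<oplus> B0\<close>, which is the object of
  liftable pairs. Every pair factors through this kernel and lifts locally along the cover.\<close>

lemma cover_cycles:
  assumes dx: "dx \<in> Hom E X1 X0" and f: "f \<in> Hom E B1 X0" and d: "d \<in> Hom E B1 B0"
  shows "\<exists>C x b. C \<in> P \<and> x \<in> Hom E C X1 \<and> b \<in> Hom E C B1 \<and> dx \<cdot> x = f \<cdot> b \<and> d \<cdot> b = Zero E C B0 \<and>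
    (\<forall>T u v. u \<in> Hom E T X1 \<and> v \<in> Hom E T B1 \<and> dx \<cdot> u = f \<cdot> v \<and> d \<cdot> v = Zero E T B0 \<longrightarrow>
      (\<exists>T' q c. q \<in> Hom E T' T \<and> adm_epic E q \<and> c \<in> Hom E T' C \<and> x \<cdot> c = u \<cdot> q \<and> b \<cdot> c = v \<cdot> q))"
proof -
  note ob = Hom_obj[OF dx] Hom_obj[OF f] Hom_obj[OF d]
  obtain S i1 i2 p1 p2 where S: "is_biproduct E X1 B1 S i1 i2 p1 p2"
      using biproduct_exists ob by blast
  obtain R j1 j2 r1 r2 where R: "is_biproduct E X0 B0 R j1 j2 r1 r2"
      using biproduct_exists ob by blast
  note ty = biproductD[OF S] biproductD[OF R] ob dx[unfolded Hom_def, simplified]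
      f[unfolded Hom_def, simplified] d[unfolded Hom_def, simplified]
  define m where "m = (j1 \<cdot> ((dx \<cdot> p1) \<^bold>+ Neg E (f \<cdot> p2))) \<^bold>+ (j2 \<cdot> (d \<cdot> p2))"
  have m: "m \<in> Arr E" "Dom E m = S" "Cod E m = R" by (simp_all add: m_def ty add_simps)
  obtain \<kappa> where \<kappa>: "is_kernel E m \<kappa>" using kernel_ex m by blast
  note k = kernelD(2-4)[OF \<kappa>, unfolded m]
  obtain C p where C: "C \<in> P" and p: "p \<in> Hom E C (Dom E \<kappa>)" "adm_epic E p"
      using covers[of "Dom E \<kappa>"] k dom_obj by blast
  note ty2 = ty k(1,2) p(1)[unfolded Hom_def, simplified] Hom_obj[OF p(1)]
  define x b where "x = p1 \<cdot> (\<kappa> \<cdot> p)" and "b = p2 \<cdot> (\<kappa> \<cdot> p)"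
  have mk: "m \<cdot> (\<kappa> \<cdot> p) = Zero E C R" using comp_reassoc[OF k(3), of p]
      by (simp add: ty2 m add_simps)
  have mk': "m \<cdot> (\<kappa> \<cdot> p) = (j1 \<cdot> ((dx \<cdot> x) \<^bold>+ Neg E (f \<cdot> b))) \<^bold>+ (j2 \<cdot> (d \<cdot> b))"
    by (simp add: m_def x_def b_def ty2 add_simps)
  have xb: "x \<in> Hom E C X1" "b \<in> Hom E C B1" by (simp_all add: x_def b_def Hom_def ty2 add_simps)
  note ty3 = ty2 xb[unfolded Hom_def, simplified]
  have "(dx \<cdot> x) \<^bold>+ Neg E (f \<cdot> b) = Zero E C X0"
    using arg_cong[OF mk[unfolded mk'], of "\<lambda>z. r1 \<cdot> z"] by (simp add: ty3 add_simps)
  then have 1: "dx \<cdot> x = f \<cdot> b"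
    using eq_neg[of "Neg E (f \<cdot> b)" "dx \<cdot> x" C X0] add_comm[of "Neg E (f \<cdot> b)" "dx \<cdot> x"]
        by (simp add: ty3 add_simps)
  have 2: "d \<cdot> b = Zero E C B0"
    using arg_cong[OF mk[unfolded mk'], of "\<lambda>z. r2 \<cdot> z"] by (simp add: ty3 add_simps)
  have 3: "\<exists>T' q c. q \<in> Hom E T' T \<and> adm_epic E q \<and> c \<in> Hom E T' C \<and> x \<cdot> c = u \<cdot> q \<and> b \<cdot> c = v \<cdot> q"
    if u: "u \<in> Hom E T X1" and v: "v \<in> Hom E T B1" and e: "dx \<cdot> u = f \<cdot> v" "d \<cdot> v = Zero E T B0"
        for T u v
  proof -
    note ty4 = ty3 u[unfolded Hom_def, simplified] v[unfolded Hom_def, simplified] Hom_obj[OF u]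
    define w where "w = (i1 \<cdot> u) \<^bold>+ (i2 \<cdot> v)"
    have w: "w \<in> Hom E T S" by (simp add: w_def Hom_def ty4 add_simps)
    have "m \<cdot> w = Zero E T R" by (simp add: m_def w_def ty4 add_simps e)
    then obtain h where h: "h \<in> Hom E T (Dom E \<kappa>)" "\<kappa> \<cdot> h = w"
        using kernel_lift[OF \<kappa>, of w T] w m by auto
    obtain T' q y where q: "q \<in> Hom E T' T" "adm_epic E q" and y: "y \<in> Hom E T' C" "p \<cdot> y = h \<cdot> q"
      using adm_epic_lift[OF p(2,1) h(1)] by metis
    note ty5 = ty4 q(1)[unfolded Hom_def, simplified] y(1)[unfolded Hom_def, simplified]
        h(1)[unfolded Hom_def, simplified]
      w[unfolded Hom_def, simplified] Hom_obj[OF q(1)]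
    have "\<kappa> \<cdot> (p \<cdot> y) = w \<cdot> q" unfolding y(2) using comp_reassoc[OF h(2), of q] by (simp add: ty5)
    then have "x \<cdot> y = u \<cdot> q" "b \<cdot> y = v \<cdot> q"
      by (simp_all add: x_def b_def ty5 add_simps) (simp_all add: w_def ty5 add_simps)
    with q y show ?thesis by blast
  qed
  show ?thesis
    by (rule exI[of _ C], rule exI[of _ x], rule exI[of _ b]) (use C xb 1 2 3 in blast)
qed

text \<open>The new entry is the old one plus an object covering the pairs; on the new summand
  \<open>f'\<close> and \<open>d'\<close> are the two components of the cover. The last assumption
  gives \<open>d \<cdot> d' = 0\<close> on the old summand, the cycle condition gives it on the new
  one.\<close>

lemma extend_one_degree:
  assumes g: "is_chain_map E (A, X, g)"
    and b: "is_biproduct E (ent A j) C B \<phi> s t p"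
    and f: "f \<in> Hom E B (ent X j)" and f\<phi>: "f \<cdot> \<phi> = g j"
    and d: "d \<in> Hom E B B0" and d\<phi>: "d \<cdot> (\<phi> \<cdot> dif A (j + 1)) = Zero E (ent A (j + 1)) B0"
  shows "\<exists>C' B' \<phi>' s' t' p' f' d'. C' \<in> P \<and> is_biproduct E (ent A (j + 1)) C' B' \<phi>' s' t' p' \<and>
    f' \<in> Hom E B' (ent X (j + 1)) \<and> f' \<cdot> \<phi>' = g (j + 1) \<and> d' \<in> Hom E B' B \<and>
    d' \<cdot> \<phi>' = \<phi> \<cdot> dif A (j + 1) \<and> d \<cdot> d' = Zero E B' B0 \<and> dif X (j + 1) \<cdot> f' = f \<cdot> d' \<and>
    (\<forall>T u v. u \<in> Hom E T (ent X (j + 1)) \<and> v \<in> Hom E T B \<and> dif X (j + 1) \<cdot> u = f \<cdot> v \<and> d \<cdot> v =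
        Zero E T B0 \<longrightarrow>
      (\<exists>T' q c. q \<in> Hom E T' T \<and> adm_epic E q \<and> c \<in> Hom E T' B' \<and> f' \<cdot> c = u \<cdot> q \<and> d' \<cdot> c = v \<cdot> q))"
proof -
  note gD = chain_mapD[OF g]
  have dX: "dif X (j + 1) \<in> Hom E (ent X (j + 1)) (ent X j)"
      using cplxD[OF gD(2)] by (simp add: Hom_def)
  obtain C' x y where C': "C' \<in> P" and x: "x \<in> Hom E C' (ent X (j + 1))" and y: "y \<in> Hom E C' B"
    and dxy: "dif X (j + 1) \<cdot> x = f \<cdot> y" and dy: "d \<cdot> y = Zero E C' B0"
    and cov: "\<And>T u v. u \<in> Hom E T (ent X (j + 1)) \<Longrightarrow> v \<in> Hom E T B \<Longrightarrow> dif X (j + 1) \<cdot> u = f \<cdot> v \<Longrightarrow>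
        d \<cdot> v = Zero E T B0 \<Longrightarrow>
      (\<exists>T' q c. q \<in> Hom E T' T \<and> adm_epic E q \<and> c \<in> Hom E T' C' \<and> x \<cdot> c = u \<cdot> q \<and> y \<cdot> c = v \<cdot> q)"
    using cover_cycles[OF dX f d] by metis
  note ty = biproductD(1-15)[OF b] cplxD[OF gD(1)] cplxD[OF gD(2)] gD(3-7)
      dX[unfolded Hom_def, simplified] f[unfolded Hom_def, simplified]
     d[unfolded Hom_def, simplified] x[unfolded Hom_def, simplified]
         y[unfolded Hom_def, simplified] Hom_obj[OF x] Hom_obj[OF d]
  obtain B' \<phi>' s' t' p' where b': "is_biproduct E (ent A (j + 1)) C' B' \<phi>' s' t' p'"
    using biproduct_exists[of "ent A (j + 1)" C'] ty by blast
  note ty2 = ty biproductD[OF b']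
  define f' d' where "f' = (g (j + 1) \<cdot> t') \<^bold>+ (x \<cdot> p')"
      and "d' = (\<phi> \<cdot> (dif A (j + 1) \<cdot> t')) \<^bold>+ (y \<cdot> p')"
  have h: "f' \<in> Hom E B' (ent X (j + 1))" "d' \<in> Hom E B' B"
      by (simp_all add: f'_def d'_def Hom_def ty2 add_simps)
  have 1: "f' \<cdot> \<phi>' = g (j + 1)" by (simp add: f'_def ty2 add_simps)
  have 2: "d' \<cdot> \<phi>' = \<phi> \<cdot> dif A (j + 1)" by (simp add: d'_def ty2 add_simps)
  have "d \<cdot> (\<phi> \<cdot> (dif A (j + 1) \<cdot> t')) = Zero E B' B0"
    using comp_reassoc[OF d\<phi>, of t'] by (simp add: ty2 add_simps)
  moreover have "d \<cdot> (y \<cdot> p') = Zero E B' B0"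
      using comp_reassoc[OF dy, of p'] by (simp add: ty2 add_simps)
  ultimately have 3: "d \<cdot> d' = Zero E B' B0" by (simp add: d'_def ty2 add_simps)
  have "dif X (j + 1) \<cdot> (x \<cdot> p') = f \<cdot> (y \<cdot> p')"
      using comp_reassoc[OF dxy, of p'] by (simp add: ty2 add_simps)
  moreover have "f \<cdot> (\<phi> \<cdot> (dif A (j + 1) \<cdot> t')) = g j \<cdot> (dif A (j + 1) \<cdot> t')"
    using comp_reassoc[OF f\<phi>, of "dif A (j + 1) \<cdot> t'"] by (simp add: ty2 add_simps)
  ultimately have 4: "dif X (j + 1) \<cdot> f' = f \<cdot> d'" by (simp add: f'_def d'_def ty2 add_simps)
  have 5: "\<exists>T' q c. q \<in> Hom E T' T \<and> adm_epic E q \<and> c \<in> Hom E T' B' \<and> f' \<cdot> c = u \<cdot> q \<and> d' \<cdot> c =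
      v \<cdot> q"
    if uv: "u \<in> Hom E T (ent X (j + 1))" "v \<in> Hom E T B" "dif X (j + 1) \<cdot> u = f \<cdot> v"
        "d \<cdot> v = Zero E T B0" for T u v
  proof -
    from cov[OF uv] obtain T' q c where q: "q \<in> Hom E T' T" "adm_epic E q"
        and c: "c \<in> Hom E T' C'" "x \<cdot> c = u \<cdot> q" "y \<cdot> c = v \<cdot> q"
      by blast
    note ty3 = ty2 c(1)[unfolded Hom_def, simplified] q(1)[unfolded Hom_def, simplified]
        Hom_obj[OF q(1)]
      uv(1,2)[unfolded Hom_def, simplified]
    \<comment> \<open>The lift is placed entirely in the new summand.\<close>
    show ?thesis
      using q c(2,3) by (intro exI[of _ T'] exI[of _ q] exI[of _ "s' \<cdot> c"]) (simp add: Hom_def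
          f'_def d'_def ty3 add_simps)
  qed
  show ?thesis
    by (rule exI[of _ C'], rule exI[of _ B'], rule exI[of _ \<phi>'], rule exI[of _ s'], rule
        exI[of _ t'], rule exI[of _ p'],
       rule exI[of _ f'], rule exI[of _ d'], intro conjI C' b' h 1 2 3 4 allI impI) (rule 5, auto)
qed

text \<open>The entry below is not part of a stage; the codomain of \<open>std s\<close> stands in
  for it. The last clause is the consequence of \<open>d d = 0\<close> that the next degree
  needs.\<close>

definition stage_inv :: "('a, 'b) cplx \<Rightarrow> ('a, 'b) cplx \<Rightarrow> (int \<Rightarrow> 'b) \<Rightarrow> int \<Rightarrow> ('a, 'b) stage \<Rightarrow> bool"
    where
  "stage_inv A X g j s \<longleftrightarrow> stC s \<in> P \<and>
     is_biproduct E (ent A j) (stC s) (stB s) (sti s) (sts s) (stt s) (stp s) \<and>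
     stf s \<in> Hom E (stB s) (ent X j) \<and> stf s \<cdot> sti s = g j \<and> std s \<in> Hom E (stB s) (Cod E (std s)) \<and>
     std s \<cdot> (sti s \<cdot> dif A (j + 1)) = Zero E (ent A (j + 1)) (Cod E (std s))"

text \<open>Here \<open>s\<close> belongs to degree \<open>j - 1\<close> and \<open>s'\<close> to
  degree \<open>j\<close>; the clauses are exactly those that involve two neighbouring
  degrees.\<close>

definition stage_rel :: "('a, 'b) cplx \<Rightarrow> ('a, 'b) cplx \<Rightarrow> int \<Rightarrow> ('a, 'b) stage \<Rightarrow> ('a, 'b) stage \<Rightarrow>
    bool" where
  "stage_rel A X j s s' \<longleftrightarrow> std s' \<in> Hom E (stB s') (stB s) \<and> std s' \<cdot> sti s' = sti s \<cdot> dif A j \<and>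
     std s \<cdot> std s' = Zero E (stB s') (Cod E (std s)) \<and> dif X j \<cdot> stf s' = stf s \<cdot> std s'"

definition stage_lift :: "('a, 'b) cplx \<Rightarrow> int \<Rightarrow> ('a, 'b) stage \<Rightarrow> ('a, 'b) stage \<Rightarrow> bool" where
  "stage_lift X j s s' \<longleftrightarrow>
     (\<forall>T u v. u \<in> Hom E T (ent X j) \<and> v \<in> Hom E T (stB s) \<and> dif X j \<cdot> u = stf s \<cdot> v \<and>
        std s \<cdot> v = Zero E T (Cod E (std s)) \<longrightarrow>
      (\<exists>T' q c. q \<in> Hom E T' T \<and> adm_epic E q \<and> c \<in> Hom E T' (stB s') \<and> stf s' \<cdot> c = u \<cdot> q \<and>
          std s' \<cdot> c = v \<cdot> q))"

lemma extend_stage: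
  assumes g: "is_chain_map E (A, X, g)" and inv: "stage_inv A X g j s"
  shows "\<exists>s'. stage_inv A X g (j + 1) s' \<and> stage_rel A X (j + 1) s s' \<and> stage_lift X (j + 1) s s'"
proof -
  note i = inv[unfolded stage_inv_def]
  have b: "is_biproduct E (ent A j) (stC s) (stB s) (sti s) (sts s) (stt s) (stp s)"
      using i by blast
  note gD = chain_mapD[OF g]
  obtain C' B' \<phi>' s' t' p' f' d' where C: "C' \<in> P"
      and b': "is_biproduct E (ent A (j + 1)) C' B' \<phi>' s' t' p'"
    and h: "f' \<in> Hom E B' (ent X (j + 1))" "f' \<cdot> \<phi>' = g (j + 1)" "d' \<in> Hom E B' (stB s)"
    "d' \<cdot> \<phi>' = sti s \<cdot> dif A (j + 1)" "std s \<cdot> d' = Zero E B' (Cod E (std s))"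
        "dif X (j + 1) \<cdot> f' = stf s \<cdot> d'"
    and l: "\<forall>T u v. u \<in> Hom E T (ent X (j + 1)) \<and> v \<in> Hom E T (stB s) \<and> dif X (j + 1) \<cdot> u =
        stf s \<cdot> v \<and>
      std s \<cdot> v = Zero E T (Cod E (std s)) \<longrightarrow>
      (\<exists>T' q c. q \<in> Hom E T' T \<and> adm_epic E q \<and> c \<in> Hom E T' B' \<and> f' \<cdot> c = u \<cdot> q \<and> d' \<cdot> c = v \<cdot> q)"
    using extend_one_degree[OF g b, of "stf s" "std s" "Cod E (std s)"] i by metis
  let ?s = "\<lparr>stB = B', stC = C', std = d', stf = f', sti = \<phi>', sts = s', stt = t', stp = p'\<rparr>"
  note ty = biproductD(1-15)[OF b] biproductD(1-15)[OF b'] h(1)[unfolded Hom_def, simplified]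
      h(3)[unfolded Hom_def, simplified]
    cplxD(1-4)[OF gD(1)]
  have "d' \<cdot> (\<phi>' \<cdot> dif A (j + 1 + 1)) = sti s \<cdot> (dif A (j + 1) \<cdot> dif A (j + 1 + 1))"
    using comp_reassoc[OF h(4), of "dif A (j + 1 + 1)"]
        by (simp add: ty add_simps add.commute[of 1 j])
  also have "dif A (j + 1) \<cdot> dif A (j + 1 + 1) = Zero E (ent A (j + 1 + 1)) (ent A j)"
    using cplxD(5)[OF gD(1), of "j + 1" "j + 1 + 1"] by simp
  finally have "d' \<cdot> (\<phi>' \<cdot> dif A (j + 1 + 1)) = Zero E (ent A (j + 1 + 1)) (Cod E d')"
    by (simp add: ty add_simps)
  then have "stage_inv A X g (j + 1) ?s" using C b' h by (simp add: stage_inv_def Hom_def)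
  moreover have "stage_rel A X (j + 1) s ?s" using h by (simp add: stage_rel_def)
  moreover have "stage_lift X (j + 1) s ?s" using l by (simp add: stage_lift_def)
  ultimately show ?thesis by blast
qed

text \<open>The choice has to proceed upwards, because the object attached in degree
  \<open>j\<close> covers pairs whose second component lies in the already enlarged entry in degree
  \<open>j - 1\<close>. One layer therefore achieves lifting in all degrees from \<open>N\<close>
  on.\<close>

lemma extend_resolution:
  assumes g: "is_chain_map E (A, X, g)"
  shows "\<exists>B f \<phi> s t p C. is_chain_map E (A, B, \<phi>) \<and> is_chain_map E (B, X, f) \<and> (\<forall>j. f j \<cdot> \<phi> j =
      g j) \<and>
    (\<forall>j. C j \<in> P) \<and> (\<forall>j < N. is_zero_obj E (C j)) \<and>
    (\<forall>j. is_biproduct E (ent A j) (C j) (ent B j) (\<phi> j) (s j) (t j) (p j)) \<and>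
    (\<forall>j \<ge> N. local_lift E B X f j)"
proof -
  note gD = chain_mapD[OF g]
  note ty = cplxD[OF gD(1)] cplxD[OF gD(2)] gD(3-7)
  obtain Zo where Zo: "is_zero_obj E Zo" using zero_obj_exists by blast
  note Zo' = zero_objD(1)[OF Zo] zero_obj_id[OF Zo]
  define base where "base j = \<lparr>stB = ent A j, stC = Zo, std = dif A j, stf = g j, sti =
      Ident E (ent A j),
    sts = Zero E Zo (ent A j), stt = Ident E (ent A j), stp = Zero E (ent A j) Zo\<rparr>" for j
  have base_inv: "stage_inv A X g j (base j)" for j
    using closed_zero[OF closed Zo] by (simp add: stage_inv_def base_def is_biproduct_def Hom_def
        ty add_simps Zo')
  have base_rel: "stage_rel A X j (base (j - 1)) (base j)" for j
    by (simp add: stage_rel_def base_def Hom_def ty add_simps)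
  \<comment> \<open>The recursion starts with the untouched entry in degree \<open>N - 1\<close>, so
    the first attached object sits in degree \<open>N\<close>.\<close>
  define deg where "deg n = N - 1 + int n" for n
  have "\<exists>\<sigma>. \<forall>n. (stage_inv A X g (deg n) (\<sigma> n) \<and> (n = 0 \<longrightarrow> \<sigma> n = base (N - 1))) \<and>
      (stage_rel A X (deg (Suc n)) (\<sigma> n) (\<sigma> (Suc n)) \<and> stage_lift X (deg (Suc n)) (\<sigma> n) (\<sigma> (Suc
          n)))"
  proof (rule dependent_nat_choice)
    show "\<exists>x. stage_inv A X g (deg 0) x \<and> (0 = 0 \<longrightarrow> x = base (N - 1))"
        using base_inv by (simp add: deg_def)
    fix s n assume "stage_inv A X g (deg n) s \<and> (n = 0 \<longrightarrow> s = base (N - 1))"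
    moreover have "deg (Suc n) = deg n + 1" by (simp add: deg_def)
    ultimately show "\<exists>y. (stage_inv A X g (deg (Suc n)) y \<and> (Suc n = 0 \<longrightarrow> y = base (N - 1))) \<and>
        stage_rel A X (deg (Suc n)) s y \<and> stage_lift X (deg (Suc n)) s y"
      using extend_stage[OF g, of "deg n" s] by simp
  qed
  then obtain \<sigma> where \<sigma>: "\<And>n. stage_inv A X g (deg n) (\<sigma> n)" "\<sigma> 0 = base (N - 1)"
    "\<And>n. stage_rel A X (deg (Suc n)) (\<sigma> n) (\<sigma> (Suc n))"
        "\<And>n. stage_lift X (deg (Suc n)) (\<sigma> n) (\<sigma> (Suc n))" by blast
  \<comment> \<open>At the seam \<open>\<sigma> 0\<close> is \<open>base (N - 1)\<close>, so
    \<open>stage_rel\<close> also holds between degrees \<open>N - 1\<close> and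
    \<open>N\<close>.\<close>
  define G where "G j = (if j < N then base j else \<sigma> (nat (j - N + 1)))" for j
  have G1: "G j = \<sigma> (Suc (nat (j - N))) \<and> G (j - 1) = \<sigma> (nat (j - N)) \<and> deg (Suc (nat (j - N))) =
      j" if "N \<le> j" for j
  proof -
    define i where "i = nat (j - N)"
    have j: "j = N + int i" using that by (simp add: i_def)
    have "nat (j - N + 1) = Suc i" unfolding j by simp
    then have 1: "G j = \<sigma> (Suc i)" using that by (simp add: G_def)
    have 2: "G (j - 1) = \<sigma> i"
    proof (cases "i = 0")
      case True
      then show ?thesis using \<sigma>(2) j by (simp add: G_def)
    next
      case False
      then have "\<not> j - 1 < N" "nat (j - 1 - N + 1) = i" unfolding j by simp_all
      then show ?thesis by (simp add: G_def)
    qed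
    have 3: "deg (Suc i) = j" by (simp add: deg_def j)
    show ?thesis using 1 2 3 by (simp add: i_def)
  qed
  have G0: "G j = base j" "G (j - 1) = base (j - 1)" if "j < N"
      for j using that by (simp_all add: G_def)
  have inv: "stage_inv A X g j (G j)" for j
  proof (cases "j < N")
    case False
    then show ?thesis using \<sigma>(1)[of "Suc (nat (j - N))"] G1[of j] by simp
  qed (simp add: G0 base_inv)
  have rel: "stage_rel A X j (G (j - 1)) (G j)" for j
  proof (cases "j < N")
    case False
    then show ?thesis using \<sigma>(3)[of "nat (j - N)"] G1[of j] by simp
  qed (simp add: G0 base_rel)
  have lift: "stage_lift X j (G (j - 1)) (G j)" if "N \<le> j" for j
    using \<sigma>(4)[of "nat (j - N)"] G1[OF that] by simp
  note I = inv[unfolded stage_inv_def] and R = rel[unfolded stage_rel_def]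
  have b: "is_biproduct E (ent A j) (stC (G j)) (stB (G j)) (sti (G j)) (sts (G j)) (stt (G j))
      (stp (G j))" for j
    using I by blast
  have cod: "Cod E (std (G j)) = stB (G (j - 1))" for j using R[of j] by (simp add: Hom_def)
  define B where "B = \<lparr>ent = \<lambda>j. stB (G j), dif = \<lambda>j. std (G j)\<rparr>"
  have Bc: "is_complex E B"
    unfolding is_complex_def B_def using biproductD(3)[OF b] R cod R[of "j - 1" for j]
    by (simp add: Hom_def)
  have \<phi>: "is_chain_map E (A, B, \<lambda>j. sti (G j))"
    by (rule chain_mapI[OF gD(1) Bc]) (use R biproductD(4-6)[OF b] in \<open>auto simp: B_def Hom_def\<close>)
  have f: "is_chain_map E (B, X, \<lambda>j. stf (G j))"
    by (rule chain_mapI[OF Bc gD(2)]) (use R I in \<open>auto simp: B_def Hom_def\<close>)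
  have l: "local_lift E B X (\<lambda>j. stf (G j)) j" if "N \<le> j" for j
    using lift[OF that] cod[of "j - 1"] unfolding stage_lift_def local_lift_def B_def by simp
  have z: "is_zero_obj E (stC (G j))" if "j < N" for j using that Zo by (simp add: G_def base_def)
  have b': "is_biproduct E (ent A j) (stC (G j)) (ent B j) (sti (G j)) (sts (G j)) (stt (G j))
      (stp (G j))" for j
    using b by (simp add: B_def)
  have C: "stC (G j) \<in> P" and fg: "stf (G j) \<cdot> sti (G j) = g j" for j using I[of j] by blast+
  show ?thesis
    by (rule exI[of _ B], rule exI[of _ "\<lambda>j. stf (G j)"], rule exI[of _ "\<lambda>j. sti (G j)"],
      rule exI[of _ "\<lambda>j. sts (G j)"], rule exI[of _ "\<lambda>j. stt (G j)"], rule
          exI[of _ "\<lambda>j. stp (G j)"],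
      rule exI[of _ "\<lambda>j. stC (G j)"]) (intro conjI allI impI \<phi> f b' C fg z l)
qed

end


section \<open>The direct system and its colimit\<close>

context additive_category
begin

text \<open>The complement \<open>D\<close> need not be a subcomplex, but as the quotient by the
  image of \<open>\<phi>\<close> it inherits the differential \<open>p d s\<close>. The projections
  \<open>p\<close> form a chain map since \<open>p d \<phi> = p \<phi> d = 0\<close>; their sections
  \<open>s\<close> are used only degreewise.\<close>

lemma split_cokernel:
  assumes \<phi>: "is_chain_map C (A, B, \<phi>)"
    and b: "\<And>j. is_biproduct C (ent A j) (D j) (ent B j) (\<phi> j) (s j) (t j) (p j)"
  defines "K \<equiv> \<lparr>ent = D, dif = \<lambda>j. p (j - 1) \<cdot> (dif B j \<cdot> s j)\<rparr>"
  shows "is_complex C K" "monic (Ch C) (A, B, \<phi>)" "is_cokernel (Ch C) (A, B, \<phi>) (B, K, p)"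
    "split_exact C (\<phi> j) (p j)"
proof -
  note \<phi>D = chain_mapD[OF \<phi>]
  note ty = biproductD[OF b] cplxD[OF \<phi>D(1)] cplxD[OF \<phi>D(2)] \<phi>D(3-7)
  have dp: "(p (j - 1) \<cdot> (dif B j \<cdot> s j)) \<cdot> p j = p (j - 1) \<cdot> dif B j" for j
    by (rule biproduct_eq_out[OF b[of j]]) (simp_all add: Hom_def ty add_simps)
  have Kd: "dif K j \<in> Hom C (ent K j) (ent K (j - 1))"
      for j by (simp add: K_def Hom_def ty add_simps)
  have "dif K (j - 1) \<cdot> dif K j = (dif K (j - 1) \<cdot> p (j - 1)) \<cdot> (dif B j \<cdot> s j)" for j
    by (simp add: K_def ty add_simps)
  also have "\<dots> j = (p (j - 1 - 1) \<cdot> dif B (j - 1)) \<cdot> (dif B j \<cdot> s j)" for j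
    using dp[of "j - 1"] by (simp add: K_def)
  also have "\<dots> j = Zero C (ent K j) (ent K (j - 2))" for j
    by (simp add: K_def ty add_simps)
  finally show K: "is_complex C K"
    unfolding is_complex_def using Kd ty by (simp add: K_def)
  have p: "is_chain_map C (B, K, p)"
    by (rule chain_mapI[OF \<phi>D(2) K]) (use dp in \<open>auto simp: K_def Hom_def ty\<close>)
  show "split_exact C (\<phi> j) (p j)" unfolding split_exact_def using b[of j] ty(5,6,15) by auto
  have t\<phi>: "g j = h j" if "is_chain_map C (T, A, g)" "is_chain_map C (T, A, h)" "\<phi> j \<cdot> g j =
      \<phi> j \<cdot> h j" for T g h j
    using arg_cong[OF that(3), of "\<lambda>x. t j \<cdot> x"] chain_mapD(3-5)[OF that(1)]
        chain_mapD(3-5)[OF that(2)] by (simp add: ty)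
  show "monic (Ch C) (A, B, \<phi>)"
    unfolding monic_def using \<phi> t\<phi> by (auto simp: Ch_simps Hom_Ch fun_eq_iff)
  have univ: "\<exists>!h. h \<in> Hom (Ch C) K T \<and> h \<cdot>\<^bsub>Ch C\<^esub> (B, K, p) = u"
    if u: "u \<in> Hom (Ch C) B T" "u \<cdot>\<^bsub>Ch C\<^esub> (A, B, \<phi>) = Zero (Ch C) A T" for T u
  proof -
    from u(1) obtain v where uv: "u = (B, T, v)" and v: "is_chain_map C (B, T, v)"
        by (auto simp: Hom_Ch)
    from u(2) have v0: "v j \<cdot> \<phi> j = Zero C (ent A j) (ent T j)" for j
      by (simp add: uv Ch_simps fun_eq_iff)
    note ty2 = ty chain_mapD(3-7)[OF v] cplxD[OF chain_mapD(2)[OF v]]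
    have vsp: "(v j \<cdot> s j) \<cdot> p j = v j" for j
      by (rule biproduct_eq_out[OF b[of j]]) (simp_all add: Hom_def ty2 add_simps v0)
    have c: "is_chain_map C (K, T, \<lambda>j. v j \<cdot> s j)"
    proof (rule chain_mapI[OF K chain_mapD(2)[OF v]])
      fix j
      show "v j \<cdot> s j \<in> Hom C (ent K j) (ent T j)" by (simp add: K_def Hom_def ty2 add_simps)
      have "(v (j - 1) \<cdot> s (j - 1)) \<cdot> dif K j = v (j - 1) \<cdot> (dif B j \<cdot> s j)"
        using arg_cong[OF vsp[of "j - 1"], of "\<lambda>x. x \<cdot> (dif B j \<cdot> s j)"]
            by (simp add: K_def ty2 add_simps)
      then show "dif T j \<cdot> v j \<cdot> s j = (v (j - 1) \<cdot> s (j - 1)) \<cdot> dif K j"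
          by (simp add: ty2 add_simps)
    qed
    show ?thesis
    proof (rule ex1I[of _ "(K, T, \<lambda>j. v j \<cdot> s j)"])
      show "(K, T, \<lambda>j. v j \<cdot> s j) \<in> Hom (Ch C) K T \<and> (K, T, \<lambda>j. v j \<cdot> s j) \<cdot>\<^bsub>Ch C\<^esub> (B, K, p) = u"
        using c vsp by (simp add: Hom_Ch Ch_simps uv)
      fix h assume h: "h \<in> Hom (Ch C) K T \<and> h \<cdot>\<^bsub>Ch C\<^esub> (B, K, p) = u"
      then obtain g where hg: "h = (K, T, g)" "is_chain_map C (K, T, g)" by (auto simp: Hom_Ch)
      from h have gp: "g j \<cdot> p j = v j" for j by (simp add: hg(1) Ch_simps uv fun_eq_iff)
      have "g j = v j \<cdot> s j" for j
        using arg_cong[OF gp[of j], of "\<lambda>x. x \<cdot> s j"] chain_mapD(3-5)[OF hg(2), of j]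
            by (simp add: K_def ty2 add_simps)
      then show "h = (K, T, \<lambda>j. v j \<cdot> s j)" by (simp add: hg(1) fun_eq_iff)
    qed
  qed
  have "p j \<cdot> \<phi> j = Zero C (ent A j) (ent K j)" for j by (simp add: ty K_def)
  then have dom: "Dom (Ch C) (A, B, \<phi>) = A" "Cod (Ch C) (A, B, \<phi>) = B" "Dom (Ch C) (B, K, p) = B"
    "Cod (Ch C) (B, K, p) = K" "(A, B, \<phi>) \<in> Arr (Ch C)" "(B, K, p) \<in> Arr (Ch C)"
    "(B, K, p) \<cdot>\<^bsub>Ch C\<^esub> (A, B, \<phi>) = Zero (Ch C) A K"
    using \<phi> p by (simp_all add: Ch_simps)
  show "is_cokernel (Ch C) (A, B, \<phi>) (B, K, p)"
    unfolding is_cokernel_def dom by (intro conjI ballI impI univ dom(5-7) refl)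
qed

text \<open>Each \<open>A n\<close> is the sum of \<open>A 0\<close> and \<open>D 0\<close> up to
  \<open>D (n - 1)\<close>, so the colimit is the coproduct of \<open>A 0\<close> and all
  \<open>D n\<close>. Summand 0 is \<open>A 0\<close> and summand \<open>Suc n\<close> is
  \<open>D n\<close>.\<close>

lemma seq_colim_of_coproduct:
  assumes b: "\<And>n. is_biproduct C (A n) (D n) (A (Suc n)) (\<alpha> n) (s n) (t n) (p n)"
    and S: "is_coproduct C UNIV (case_nat (A 0) D) S \<kappa>"
  shows "\<exists>\<iota>. seq_colim C A \<alpha> S \<iota>"
proof -
  have k: "S \<in> Obj C" "\<kappa> n \<in> Arr C" "Dom C (\<kappa> 0) = A 0" "Dom C (\<kappa> (Suc n)) = D n" "Cod C (\<kappa> n) =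
      S" for n
    using coproductD(1)[OF S] coproductD(2,4)[OF S, of n] coproductD(3)[OF S, of 0]
        coproductD(3)[OF S, of "Suc n"] by auto
  note ty = biproductD[OF b] k
  \<comment> \<open>On \<open>A (Suc n)\<close> the old part follows the previous leg, and the part
    in \<open>D n\<close> enters its own summand.\<close>
  define \<iota> where "\<iota> = rec_nat (\<kappa> 0) (\<lambda>n x. (x \<cdot> t n) \<^bold>+ (\<kappa> (Suc n) \<cdot> p n))"
  have \<iota>: "\<iota> 0 = \<kappa> 0" "\<iota> (Suc n) = (\<iota> n \<cdot> t n) \<^bold>+ (\<kappa> (Suc n) \<cdot> p n)" for n by (simp_all add: \<iota>_def)
  have \<iota>h: "\<iota> n \<in> Arr C \<and> Dom C (\<iota> n) = A n \<and> Cod C (\<iota> n) = S" for n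
    by (induction n) (simp_all add: \<iota> ty add_simps)
  note ty2 = ty \<iota>h
  have \<iota>\<alpha>: "\<iota> (Suc n) \<cdot> \<alpha> n = \<iota> n" "\<iota> (Suc n) \<cdot> s n = \<kappa> (Suc n)"
      for n by (simp_all add: \<iota>(2) ty2 add_simps)
  have "\<exists>!h. h \<in> Hom C S T \<and> (\<forall>n. h \<cdot> \<iota> n = f n)"
    if T: "T \<in> Obj C" and f: "\<And>n. f n \<in> Hom C (A n) T" "\<And>n. f (Suc n) \<cdot> \<alpha> n = f n" for T f
  proof -
    have fh: "f n \<in> Arr C" "Dom C (f n) = A n" "Cod C (f n) = T"
        for n using f(1)[of n] by (auto simp: Hom_def)
    have "case_nat (f 0) (\<lambda>n. f (Suc n) \<cdot> s n) n \<in> Hom C (case_nat (A 0) D n) T" for n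
      by (auto split: nat.split simp: Hom_def ty2 fh add_simps)
    then obtain h where h: "h \<in> Hom C S T" "\<And>n. h \<cdot> \<kappa> n = case_nat (f 0) (\<lambda>n. f (Suc n) \<cdot> s n) n"
      using coproduct_desc[OF S T, of "case_nat (f 0) (\<lambda>n. f (Suc n) \<cdot> s n)"] by auto
    have h1: "h \<cdot> \<kappa> 0 = f 0" "h \<cdot> \<kappa> (Suc n) = f (Suc n) \<cdot> s n"
        for n using h(2)[of 0] h(2)[of "Suc n"] by simp_all
    note ty3 = ty2 fh h(1)[unfolded Hom_def, simplified]
    have h2: "h \<cdot> \<iota> n = f n" for n
    proof (induction n)
      case (Suc n)
      show ?case
        by (rule biproduct_eq_out[OF b[of n]])
          (simp_all add: Hom_def ty3 add_simps \<iota>\<alpha> Suc f(2) h1)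
    qed (simp add: \<iota> h1)
    have "k = h" if k: "k \<in> Hom C S T" "\<And>n. k \<cdot> \<iota> n = f n" for k
    proof (rule coproduct_eqI[OF S k(1) h(1)])
      fix n
      note ty4 = ty3 k(1)[unfolded Hom_def, simplified]
      show "k \<cdot> \<kappa> n = h \<cdot> \<kappa> n"
      proof (cases n)
        case 0
        then show ?thesis using k(2)[of 0] h1 \<iota>(1) by simp
      next
        case (Suc m)
        then show ?thesis
          using arg_cong[OF k(2)[of "Suc m"], of "\<lambda>x. x \<cdot> s m"] by (simp add: ty4 add_simps \<iota>\<alpha> h1)
      qed
    qed
    with h(1) h2 show ?thesis by blast
  qed
  moreover have "\<iota> n \<in> Hom C (A n) S" for n using \<iota>h by (simp add: Hom_def)
  ultimately have "seq_colim C A \<alpha> S \<iota>" unfolding seq_colim_def using k(1) \<iota>\<alpha>(1) by blast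
  then show ?thesis by blast
qed

section \<open>Sequential colimits of complexes\<close>

lemma seq_colim_chain_desc:
  assumes \<alpha>: "\<And>n. is_chain_map C (A n, A (Suc n), \<alpha> n)" and \<iota>: "\<And>n. is_chain_map C (A n, Q, \<iota> n)"
    and Q: "\<And>j. seq_colim C (\<lambda>n. ent (A n) j) (\<lambda>n. \<alpha> n j) (ent Q j) (\<lambda>n. \<iota> n j)"
    and f: "\<And>n. is_chain_map C (A n, X, f n)" and fa: "\<And>n j. f (Suc n) j \<cdot> \<alpha> n j = f n j"
  shows "\<exists>F. is_chain_map C (Q, X, F) \<and> (\<forall>n j. F j \<cdot> \<iota> n j = f n j)"
proof -
  have "\<exists>h. h \<in> Hom C (ent Q j) (ent X j) \<and> (\<forall>n. h \<cdot> \<iota> n j = f n j)" for j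
    using seq_colim_desc[OF Q, of "\<lambda>n. f n j" j "ent X j"] chain_mapD(3-5)[OF f] fa
        by (auto simp: Hom_def Bex_def)
  then obtain F where F: "\<And>j. F j \<in> Hom C (ent Q j) (ent X j)" "\<And>n j. F j \<cdot> \<iota> n j = f n j" by metis
  note ty = chain_mapD(3-7)[OF \<alpha>] chain_mapD(3-7)[OF \<iota>] chain_mapD(3-7)[OF f]
      cplxD(1-4)[OF chain_mapD(1)[OF \<alpha>]]
    cplxD(1-4)[OF chain_mapD(2)[OF \<iota>]] cplxD(1-4)[OF chain_mapD(2)[OF f]]
        F(1)[unfolded Hom_def, simplified]
  have F': "h \<in> Arr C \<Longrightarrow> Cod C h = ent (A n) j \<Longrightarrow> F j \<cdot> (\<iota> n j \<cdot> h) = f n j \<cdot> h" for h n j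
    using comp_reassoc[OF F(2), of n j h] by (simp add: ty)
  have \<alpha>h: "\<alpha> n j \<in> Hom C (ent (A n) j) (ent (A (Suc n)) j)" for n j by (simp add: ty Hom_def)
  have "is_chain_map C (Q, X, F)"
  proof (rule chain_mapI[OF chain_mapD(2)[OF \<iota>] chain_mapD(2)[OF f] F(1)])
    fix j
    show "dif X j \<cdot> F j = F (j - 1) \<cdot> dif Q j"
      by (rule seq_colim_eqI[OF Q[of j] \<alpha>h]) (simp_all add: Hom_def ty add_simps F F')
  qed
  with F show ?thesis by blast
qed

text \<open>The differentials of the \<open>A n\<close> form a cocone that induces the one on the
  colimit. Keeping \<open>ent Q = L\<close> as an equality preserves what is known about the chosen
  objects \<open>L j\<close>, namely membership in \<open>P\<close>.\<close>

lemma seq_colim_complex: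
  assumes \<alpha>: "\<And>n. is_chain_map C (A n, A (Suc n), \<alpha> n)"
    and Q: "\<And>j. seq_colim C (\<lambda>n. ent (A n) j) (\<lambda>n. \<alpha> n j) (L j) (\<lambda>n. \<iota> n j)"
  shows "\<exists>Q. ent Q = L \<and> (\<forall>n. is_chain_map C (A n, Q, \<iota> n))"
proof -
  note l = seq_colimD[OF Q]
  note ty = l(1-4) chain_mapD(3-5)[OF \<alpha>] cplxD[OF chain_mapD(1)[OF \<alpha>]]
  have la: "h \<in> Arr C \<Longrightarrow> Cod C h = ent (A n) j \<Longrightarrow> \<iota> (Suc n) j \<cdot> (\<alpha> n j \<cdot> h) = \<iota> n j \<cdot> h" for h n j
    using comp_reassoc[OF l(5), of n j h] by (simp add: ty)
  have \<alpha>h: "\<alpha> n j \<in> Hom C (ent (A n) j) (ent (A (Suc n)) j)" for n j by (simp add: ty Hom_def)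
  have "\<exists>h. h \<in> Hom C (L j) (L (j - 1)) \<and> (\<forall>n. h \<cdot> \<iota> n j = \<iota> n (j - 1) \<cdot> dif (A n) j)" for j
    using seq_colim_desc[OF Q, of "\<lambda>n. \<iota> n (j - 1) \<cdot> dif (A n) j" j "L (j - 1)"]
    by (auto simp: Hom_def Bex_def ty add_simps chain_mapD(6)[OF \<alpha>] la)
  then obtain d where d: "\<And>j. d j \<in> Hom C (L j) (L (j - 1))" "\<And>n j. d j \<cdot> \<iota> n j =
      \<iota> n (j - 1) \<cdot> dif (A n) j" by metis
  note ty2 = ty d(1)[unfolded Hom_def, simplified]
  have d': "h \<in> Arr C \<Longrightarrow> Cod C h = ent (A n) j \<Longrightarrow> d j \<cdot> (\<iota> n j \<cdot> h) =
      \<iota> n (j - 1) \<cdot> (dif (A n) j \<cdot> h)" for h n j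
    using comp_reassoc[OF d(2), of n j h] by (simp add: ty2 add_simps)
  have dd: "d (j - 1) \<cdot> d j = Zero C (L j) (L (j - 2))" for j
    by (rule seq_colim_eqI[OF Q[of j] \<alpha>h]) (simp_all add: Hom_def ty2 add_simps d(2) d')
  have "is_complex C \<lparr>ent = L, dif = d\<rparr>"
    unfolding is_complex_def using l(1) d(1) dd by simp
  then have "is_chain_map C (A n, \<lparr>ent = L, dif = d\<rparr>, \<iota> n)" for n
    by (rule chain_mapI[OF chain_mapD(1)[OF \<alpha>]]) (simp_all add: Hom_def ty2 d(2))
  then show ?thesis by (intro exI[of _ "\<lparr>ent = L, dif = d\<rparr>"]) simp
qed

text \<open>Junk value for \<open>n < m\<close>: the identity of \<open>A n\<close>.\<close>

primrec transition :: "(nat \<Rightarrow> ('a, 'b) cplx) \<Rightarrow> (nat \<Rightarrow> int \<Rightarrow> 'b) \<Rightarrow> nat \<Rightarrow> nat \<Rightarrow> int \<Rightarrow> 'b" where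
  "transition A \<alpha> m 0 = (\<lambda>j. Ident C (ent (A 0) j))"
| "transition A \<alpha> m (Suc n) =
     (\<lambda>j. if m \<le> n then \<alpha> n j \<cdot> transition A \<alpha> m n j else Ident C (ent (A (Suc n)) j))"

lemma transition_refl: "transition A \<alpha> n n = (\<lambda>j. Ident C (ent (A n) j))"
  by (cases n) simp_all

lemma transition_chain_map:
  assumes \<alpha>: "\<And>n. is_chain_map C (A n, A (Suc n), \<alpha> n)"
  shows "m \<le> n \<Longrightarrow> is_chain_map C (A m, A n, transition A \<alpha> m n)"
proof (induction n)
  note ty = cplxD(1-4)[OF chain_mapD(1)[OF \<alpha>]] chain_mapD(3-5)[OF \<alpha>]
  have id: "is_chain_map C (A n, A n, \<lambda>j. Ident C (ent (A n) j))" for n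
    by (rule chain_mapI) (auto simp: ty add_simps Hom_def chain_mapD(1)[OF \<alpha>])
  {
    case 0
    then show ?case using id by simp
  next
    case (Suc n)
    show ?case
    proof (cases "m \<le> n")
      case True
      note ty2 = ty chain_mapD(3-5)[OF Suc.IH[OF True]]
      show ?thesis
        by (rule chain_mapI)
          (use True in \<open>auto simp: ty2 add_simps Hom_def chain_mapD(1)[OF \<alpha>] chain_mapD(6,7)[OF \<alpha>]
              chain_mapD(6)[OF Suc.IH[OF True]]\<close>)
    next
      case False
      then have "m = Suc n" using Suc.prems by simp
      then show ?thesis using id by (simp add: transition_refl del: transition.simps)
    qed
  }
qed

lemma transition_comp:
  assumes \<alpha>: "\<And>n. is_chain_map C (A n, A (Suc n), \<alpha> n)" and lm: "l \<le> m"
  shows "m \<le> n \<Longrightarrow> transition A \<alpha> m n j \<cdot> transition A \<alpha> l m j = transition A \<alpha> l n j"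
proof (induction n)
  note ty = cplxD(1-4)[OF chain_mapD(1)[OF \<alpha>]] chain_mapD(3-5)[OF \<alpha>]
      chain_mapD(3-5)[OF transition_chain_map[of A \<alpha>, OF \<alpha>]]
  {
    case 0
    then show ?case using lm by (simp add: ty add_simps)
  next
    case (Suc n)
    show ?case
    proof (cases "m \<le> n")
      case True
      then show ?thesis using Suc.IH lm by (simp add: ty add_simps)
    next
      case False
      then have "m = Suc n" using Suc.prems by simp
      then show ?thesis using lm by (simp add: transition_refl ty add_simps del: transition.simps)
    qed
  }
qed

lemma cocone_transition:
  assumes \<alpha>: "\<And>n. is_chain_map C (A n, A (Suc n), \<alpha> n)"
    and f: "\<And>n. is_chain_map C (A n, X, f n)" and fa: "\<And>n j. f (Suc n) j \<cdot> \<alpha> n j = f n j"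
  shows "m \<le> n \<Longrightarrow> f n j \<cdot> transition A \<alpha> m n j = f m j"
proof (induction n)
  note ty = cplxD(1-4)[OF chain_mapD(1)[OF \<alpha>]] chain_mapD(3-5)[OF \<alpha>] chain_mapD(3-5)[OF f]
      chain_mapD(3-5)[OF transition_chain_map[of A \<alpha>, OF \<alpha>]]
  {
    case 0
    then show ?case by (simp add: ty add_simps)
  next
    case (Suc n)
    show ?case
    proof (cases "m \<le> n")
      case True
      then show ?thesis using Suc.IH comp_reassoc[OF fa, of n j "transition A \<alpha> m n j"]
          by (simp add: ty)
    next
      case False
      then have "m = Suc n" using Suc.prems by simp
      then show ?thesis by (simp add: transition_refl ty add_simps del: transition.simps)
    qed
  }
qed

lemma transition_Suc:
  assumes \<alpha>: "\<And>n. is_chain_map C (A n, A (Suc n), \<alpha> n)"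
  shows "transition A \<alpha> n (Suc n) = \<alpha> n"
  using chain_mapD(3-5)[OF \<alpha>] by (simp add: fun_eq_iff transition_refl add_simps)

lemma direct_system_transition:
  assumes \<alpha>: "\<And>n. is_chain_map C (A n, A (Suc n), \<alpha> n)"
  shows "direct_system (Ch C) UNIV {(m, n). m \<le> n} A (\<lambda>m n. (A m, A n, transition A \<alpha> m n))"
  unfolding direct_system_def
  using chain_mapD(1)[OF \<alpha>] transition_chain_map[of A \<alpha>, OF \<alpha>] transition_comp[of A \<alpha>, OF \<alpha>]
  by (simp add: Ch_simps Hom_Ch transition_refl)

text \<open>A cocone over the full order is already governed by its compatibility with consecutive
  maps, which reduces the claim to the degreewise sequential colimits.\<close>

lemma direct_limit_transition:
  assumes \<alpha>: "\<And>n. is_chain_map C (A n, A (Suc n), \<alpha> n)" and \<iota>: "\<And>n. is_chain_map C (A n, Q, \<iota> n)"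
    and Q: "\<And>j. seq_colim C (\<lambda>n. ent (A n) j) (\<lambda>n. \<alpha> n j) (ent Q j) (\<lambda>n. \<iota> n j)"
  shows "is_direct_limit (Ch C) UNIV {(m, n). m \<le> n} A (\<lambda>m n. (A m, A n, transition A \<alpha> m n)) Q
      (\<lambda>n. (A n, Q, \<iota> n))"
  unfolding is_direct_limit_def
proof (intro conjI allI impI)
  note l = seq_colimD[OF Q]
  show "is_cocone (Ch C) UNIV {(m, n). m \<le> n} A (\<lambda>m n. (A m, A n, transition A \<alpha> m n)) Q (\<lambda>n. (A
      n, Q, \<iota> n))"
    unfolding is_cocone_def using chain_mapD(2)[OF \<iota>] \<iota> cocone_transition[of A \<alpha>, OF \<alpha> \<iota> l(5)]
    by (simp add: Ch_simps Hom_Ch)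
  fix T f assume f: "is_cocone (Ch C) UNIV {(m, n). m \<le> n} A (\<lambda>m n. (A m, A n, transition A \<alpha> m
      n)) T f"
  have "\<exists>g. f n = (A n, T, g) \<and> is_chain_map C (A n, T, g)"
      for n using f by (simp add: is_cocone_def Hom_Ch)
  then obtain g where fg: "\<And>n. f n = (A n, T, g n)" and g: "\<And>n. is_chain_map C (A n, T, g n)"
      by metis
  have "f (Suc n) \<cdot>\<^bsub>Ch C\<^esub> (A n, A (Suc n), transition A \<alpha> n (Suc n)) = f n" for n
    using f by (simp add: is_cocone_def del: transition.simps)
  then have ga: "g (Suc n) j \<cdot> \<alpha> n j = g n j" for n j
    by (simp add: fg transition_Suc[of A \<alpha>, OF \<alpha>] Ch_simps fun_eq_iff del: transition.simps)
  obtain F where F: "is_chain_map C (Q, T, F)" "\<And>n j. F j \<cdot> \<iota> n j = g n j"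
    using seq_colim_chain_desc[of A \<alpha>, OF \<alpha> \<iota> Q g ga] by blast
  have \<alpha>h: "\<alpha> n j \<in> Hom C (ent (A n) j) (ent (A (Suc n)) j)"
      for n j using chain_mapD(3-5)[OF \<alpha>] by (simp add: Hom_def)
  have u: "F' = F" if F': "is_chain_map C (Q, T, F')" "\<And>n j. F' j \<cdot> \<iota> n j = g n j" for F'
  proof
    fix j
    show "F' j = F j"
      by (rule seq_colim_eqI[OF Q[of j] \<alpha>h])
        (use chain_mapD(3-5)[OF F(1)] chain_mapD(3-5)[OF F'(1)] F(2) F'(2) in \<open>auto simp: Hom_def\<close>)
  qed
  show "\<exists>!h. h \<in> Hom (Ch C) Q T \<and> (\<forall>n\<in>UNIV. h \<cdot>\<^bsub>Ch C\<^esub> (A n, Q, \<iota> n) = f n)"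
  proof (rule ex1I[of _ "(Q, T, F)"])
    show "(Q, T, F) \<in> Hom (Ch C) Q T \<and> (\<forall>n\<in>UNIV. (Q, T, F) \<cdot>\<^bsub>Ch C\<^esub> (A n, Q, \<iota> n) = f n)"
      using F by (simp add: Hom_Ch Ch_simps fg)
    fix h assume h: "h \<in> Hom (Ch C) Q T \<and> (\<forall>n\<in>UNIV. h \<cdot>\<^bsub>Ch C\<^esub> (A n, Q, \<iota> n) = f n)"
    then obtain F' where hF: "h = (Q, T, F')" "is_chain_map C (Q, T, F')" by (auto simp: Hom_Ch)
    have "F' j \<cdot> \<iota> n j = g n j" for n j using h by (simp add: hF(1) Ch_simps fg fun_eq_iff)
    from u[OF hF(2) this] show "h = (Q, T, F)" by (simp add: hF(1))
  qed
qed

lemma special_direct_system_transition: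
  assumes \<alpha>: "\<And>n. is_chain_map C (A n, A (Suc n), \<alpha> n)" and A0: "\<And>j. is_zero_obj C (ent (A 0) j)"
    and b: "\<And>n j. is_biproduct C (ent (A n) j) (D n j) (ent (A (Suc n)) j) (\<alpha> n j) (s n j) (t n j)
        (p n j)"
    and D: "\<And>n j. D n j \<in> P" "\<And>n. \<exists>N. \<forall>j < N. is_zero_obj C (D n j)"
  shows "special_direct_system C (Ch_plus_in C P) UNIV {(m, n). m \<le> n} A (\<lambda>m n. (A m, A n,
      transition A \<alpha> m n))"
  unfolding special_direct_system_def
proof (intro conjI ballI allI impI)
  show "direct_system (Ch C) UNIV {(m, n). m \<le> n} A (\<lambda>m n. (A m, A n, transition A \<alpha> m n))"
    by (rule direct_system_transition[of A \<alpha>, OF \<alpha>])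
  show "well_order_on UNIV {(m, n :: nat). m \<le> n}"
      using natLeq_Well_order unfolding Field_natLeq by (simp add: natLeq_def)
next
  fix n :: nat assume n: "\<nexists>m. is_predecessor UNIV {(m, n). m \<le> n} m n"
  \<comment> \<open>Only 0 lacks a predecessor, so the limit condition reduces to \<open>A 0\<close>
    being initial, that is, a colimit of the empty system.\<close>
  have "is_predecessor UNIV {(m, n). m \<le> n} (n - 1) n" if "n \<noteq> 0"
    using that unfolding is_predecessor_def by auto
  then have n0: "n = 0" using n by blast
  have u: "underS {(m, n). m \<le> n} (0 :: nat) = {}" by (auto simp: underS_def)
  have Ac: "is_complex C (A 0)" using chain_mapD(1)[OF \<alpha>] .
  have "\<exists>!h. h \<in> Hom (Ch C) (A 0) T" if T: "is_complex C T" for T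
  proof (rule ex1I[of _ "(A 0, T, \<lambda>j. Zero C (ent (A 0) j) (ent T j))"])
    note ty = cplxD[OF Ac] cplxD[OF T]
    have "is_chain_map C (A 0, T, \<lambda>j. Zero C (ent (A 0) j) (ent T j))"
      by (rule chain_mapI[OF Ac T]) (simp_all add: Hom_def ty add_simps)
    then show "(A 0, T, \<lambda>j. Zero C (ent (A 0) j) (ent T j)) \<in> Hom (Ch C) (A 0) T"
        by (simp add: Hom_Ch)
    fix h assume "h \<in> Hom (Ch C) (A 0) T"
    then obtain g where h: "h = (A 0, T, g)" and g: "is_chain_map C (A 0, T, g)"
        by (auto simp: Hom_Ch)
    have "g j = Zero C (ent (A 0) j) (ent T j)" for j
      using zero_objD(3)[OF A0, of "g j" j] chain_mapD(3-5)[OF g] by simp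
    then show "h = (A 0, T, \<lambda>j. Zero C (ent (A 0) j) (ent T j))" by (auto simp: h)
  qed
  then show "is_direct_limit (Ch C) (underS {(m, n). m \<le> n} n) {(m, n). m \<le> n} A
      (\<lambda>m n. (A m, A n, transition A \<alpha> m n)) (A n) (\<lambda>m. (A m, A n, transition A \<alpha> m n))"
    unfolding n0 u is_direct_limit_def is_cocone_def using Ac by (simp add: Ch_simps)
next
  fix m n :: nat assume "is_predecessor UNIV {(m, n). m \<le> n} m n"
  then have "m \<le> n" "m \<noteq> n" "\<forall>l. l \<le> n \<and> l \<noteq> n \<longrightarrow> l \<le> m" by (auto simp: is_predecessor_def)
  from this(1,2) this(3)[rule_format, of "n - 1"] have n: "n = Suc m" by linarith
  note sc = split_cokernel[OF \<alpha> b, of m]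
  show "monic (Ch C) (A m, A n, transition A \<alpha> m n)" unfolding n transition_Suc[of A \<alpha>, OF \<alpha>]
      by (rule sc(2))
  let ?K = "\<lparr>ent = D m, dif = \<lambda>j. p m (j - 1) \<cdot> (dif (A (Suc m)) j \<cdot> s m j)\<rparr>"
  have "?K \<in> Ch_plus_in C P" unfolding Ch_plus_in_def Ch_in_def using sc(1) D by simp
  then show "\<exists>q. is_cokernel (Ch C) (A m, A n, transition A \<alpha> m n) q \<and> tgt q \<in> Ch_plus_in C P \<and>
      (\<forall>j. split_exact C (cmpt (A m, A n, transition A \<alpha> m n) j) (cmpt q j))"
    unfolding n transition_Suc[of A \<alpha>, OF \<alpha>] using sc(3,4)
        by (intro exI[of _ "(A (Suc m), ?K, p m)"]) simp
qed

end

section \<open>The resolution of a complex\<close>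

context covered_exact_category
begin

text \<open>The dependent choice runs over pairs of a complex and its map to X; the remaining data
  of a layer depend on two consecutive pairs and are chosen afterwards.\<close>

definition resolution_step ::
  "('a, 'b) cplx \<Rightarrow> int \<Rightarrow> ('a, 'b) cplx \<times> (int \<Rightarrow> 'b) \<Rightarrow> ('a, 'b) cplx \<times> (int \<Rightarrow> 'b) \<Rightarrow>
   (int \<Rightarrow> 'b) \<Rightarrow> (int \<Rightarrow> 'b) \<Rightarrow> (int \<Rightarrow> 'b) \<Rightarrow> (int \<Rightarrow> 'b) \<Rightarrow> (int \<Rightarrow> 'a) \<Rightarrow> bool" where
  "resolution_step X N Ag Bf \<phi> s t p D \<longleftrightarrow> (case (Ag, Bf) of ((A, g), (B, f)) \<Rightarrow> is_chain_map E (A,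
      B, \<phi>) \<and> is_chain_map E (B, X, f) \<and>
    (\<forall>j. f j \<cdot> \<phi> j = g j) \<and> (\<forall>j. D j \<in> P) \<and> (\<forall>j < N. is_zero_obj E (D j)) \<and>
    (\<forall>j. is_biproduct E (ent A j) (D j) (ent B j) (\<phi> j) (s j) (t j) (p j)) \<and>
    (\<forall>j \<ge> N. local_lift E B X f j))"

text \<open>Layer \<open>n\<close> reaches down to degree \<open>- n\<close> only: every stage
  remains bounded below, while the range of degrees with lifting exhausts the integers.\<close>

lemma resolution_sequence:
  assumes X: "is_complex E X"
  shows "\<exists>A f \<alpha> s t p D. (\<forall>j. is_zero_obj E (ent (A 0) j)) \<and>
    (\<forall>n. is_chain_map E (A n, A (Suc n), \<alpha> n)) \<and> (\<forall>n. is_chain_map E (A n, X, f n)) \<and>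
    (\<forall>n j. f (Suc n) j \<cdot> \<alpha> n j = f n j) \<and> (\<forall>n j. D n j \<in> P) \<and>
        (\<forall>n. \<forall>j < - int n. is_zero_obj E (D n j)) \<and>
    (\<forall>n j. is_biproduct E (ent (A n) j) (D n j) (ent (A (Suc n)) j) (\<alpha> n j) (s n j) (t n j) (p n
        j)) \<and>
    (\<forall>n. \<forall>j \<ge> - int n. local_lift E (A (Suc n)) X (f (Suc n)) j)"
proof -
  obtain Zo where Zo: "is_zero_obj E Zo" using zero_obj_exists by blast
  note Zo' = zero_objD(1)[OF Zo]
  define Z0 where "Z0 = \<lparr>ent = \<lambda>_ :: int. Zo, dif = \<lambda>_ :: int. Zero E Zo Zo\<rparr>"
  have Z0: "is_chain_map E (Z0, X, \<lambda>j. Zero E Zo (ent X j))"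
  proof (rule chain_mapI[OF _ X])
    show "is_complex E Z0" by (simp add: is_complex_def Z0_def Hom_def add_simps Zo')
  qed (simp_all add: Z0_def Hom_def add_simps Zo' cplxD[OF X])
  have "\<exists>S. \<forall>n. (is_chain_map E (fst (S n), X, snd (S n)) \<and> (n = 0 \<longrightarrow> S n =
      (Z0, \<lambda>j. Zero E Zo (ent X j)))) \<and>
    (\<exists>\<phi> s t p D. resolution_step X (- int n) (S n) (S (Suc n)) \<phi> s t p D)"
  proof (rule dependent_nat_choice)
    show "\<exists>x. is_chain_map E (fst x, X, snd x) \<and> (0 = 0 \<longrightarrow> x = (Z0, \<lambda>j. Zero E Zo (ent X j)))"
      using Z0 by simp
    fix x and n :: nat
    assume "is_chain_map E (fst x, X, snd x) \<and> (n = 0 \<longrightarrow> x = (Z0, \<lambda>j. Zero E Zo (ent X j)))"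
    then have "is_chain_map E (fst x, X, snd x)" by blast
    from extend_resolution[OF this, of "- int n"] obtain B f \<phi> s t p D
      where "resolution_step X (- int n) x (B, f) \<phi> s t p D"
      unfolding resolution_step_def by (auto simp: split_beta)
    moreover from this have "is_chain_map E (B, X, f)" by (simp add: resolution_step_def split_beta)
    ultimately show "\<exists>y. (is_chain_map E (fst y, X, snd y) \<and> (Suc n = 0 \<longrightarrow> y =
        (Z0, \<lambda>j. Zero E Zo (ent X j)))) \<and>
       (\<exists>\<phi> s t p D. resolution_step X (- int n) x y \<phi> s t p D)"
      by (intro exI[of _ "(B, f)"] conjI; (unfold fst_conv snd_conv)?; blast)
  qed
  then obtain S where S': "\<forall>n. (is_chain_map E (fst (S n), X, snd (S n)) \<and> (n = 0 \<longrightarrow> S n =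
      (Z0, \<lambda>j. Zero E Zo (ent X j)))) \<and>
    (\<exists>\<phi> s t p D. resolution_step X (- int n) (S n) (S (Suc n)) \<phi> s t p D)" ..
  have S: "is_chain_map E (fst (S n), X, snd (S n))" "S 0 = (Z0, \<lambda>j. Zero E Zo (ent X j))" for n
    using S'[rule_format, of n] S'[rule_format, of 0] by simp_all
  have SR: "\<forall>n. \<exists>\<phi> s t p D. resolution_step X (- int n) (S n) (S (Suc n)) \<phi> s t p D"
    using S' by (rule all_forward) (rule conjunct2)
  from SR obtain \<phi> s t p D where "\<And>n. resolution_step X (- int n) (S n) (S (Suc n)) (\<phi> n) (s n) (t
      n) (p n) (D n)"
    by metis
  note R = this[unfolded resolution_step_def, simplified split_beta prod.case fst_conv snd_conv]
  have Z: "is_zero_obj E (ent (fst (S 0)) j)" for j using S(2) Zo by (simp add: Z0_def)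
  show ?thesis
    by (rule exI[of _ "\<lambda>n. fst (S n)"], rule exI[of _ "\<lambda>n. snd (S n)"], rule exI[of _ \<phi>], rule
        exI[of _ s], rule exI[of _ t],
      rule exI[of _ p], rule exI[of _ D]) (use Z S(1) R in simp)
qed

lemma special_resolution:
  assumes AB4: "AB4 E k P" and X: "is_complex E X"
  shows "\<exists>Q f. Q \<in> Ch_in E P \<and> f \<in> Hom (Ch E) Q X \<and> (\<forall>n. adm_epic E (cmpt f n)) \<and> quasi_iso E f \<and>
    (\<exists>(J :: nat set) r S \<phi> \<iota>. special_direct_system E (Ch_plus_in E P) J r S \<phi> \<and>
        is_direct_limit (Ch E) J r S \<phi> Q \<iota>)"
proof -
  obtain A f \<alpha> s t p D where A0: "\<And>j. is_zero_obj E (ent (A 0) j)"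
    and \<alpha>: "\<And>n. is_chain_map E (A n, A (Suc n), \<alpha> n)" and f: "\<And>n. is_chain_map E (A n, X, f n)"
    and f\<alpha>: "\<And>n j. f (Suc n) j \<cdot> \<alpha> n j = f n j"
        and D: "\<And>n j. D n j \<in> P" "\<And>n j. j < - int n \<Longrightarrow> is_zero_obj E (D n j)"
    and b: "\<And>n j. is_biproduct E (ent (A n) j) (D n j) (ent (A (Suc n)) j) (\<alpha> n j) (s n j) (t n j)
        (p n j)"
    and l: "\<And>n j. j \<ge> - int n \<Longrightarrow> local_lift E (A (Suc n)) X (f (Suc n)) j"
    using resolution_sequence[OF X] by blast
  have AP: "ent (A n) j \<in> P" for n j
    by (induction n) (use closed_zero[OF closed A0] closed_biproduct[OF closed b] D in blast)+
  have Az: "j < - int n \<Longrightarrow> is_zero_obj E (ent (A n) j)" for n j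
  proof (induction n)
    case (Suc n)
    then show ?case using biproduct_zero[OF b Suc.IH D(2)] by simp
  qed (simp add: A0)
  have Ap: "A n \<in> Ch_plus_in E P" for n
    unfolding Ch_plus_in_def Ch_in_def using AP Az chain_mapD(1)[OF \<alpha>] by blast
  \<comment> \<open>The entries of the colimit are obtained as coproducts of the layers, which
    closure of \<open>P\<close> provides inside \<open>P\<close>.\<close>
  have "\<exists>S \<kappa>. is_coproduct E (UNIV :: nat set) (case_nat (ent (A 0) j) (\<lambda>n. D n j)) S \<kappa> \<and> S \<in> P"
      for j
  proof -
    have *: "case_nat (ent (A 0) j) (\<lambda>n. D n j) n \<in> P" for n using AP D by (simp split: nat.split)
    show ?thesis using closed_coproduct[OF closed, of UNIV "case_nat (ent (A 0) j) (\<lambda>n. D n j)"] *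
        by blast
  qed
  then obtain L \<kappa> where L: "\<And>j. is_coproduct E (UNIV :: nat set) (case_nat (ent (A 0) j) (\<lambda>n. D n
      j)) (L j) (\<kappa> j)" "\<And>j. L j \<in> P"
    by metis
  have "\<exists>i. seq_colim E (\<lambda>n. ent (A n) j) (\<lambda>n. \<alpha> n j) (L j) i" for j
    by (rule seq_colim_of_coproduct[where A = "\<lambda>n. ent (A n) j" and D = "\<lambda>n. D n j", OF b L(1)])
  then obtain i where "\<And>j. seq_colim E (\<lambda>n. ent (A n) j) (\<lambda>n. \<alpha> n j) (L j) (i j)" by metis
  then have "\<exists>\<iota>. \<forall>j. seq_colim E (\<lambda>n. ent (A n) j) (\<lambda>n. \<alpha> n j) (L j) (\<lambda>n. \<iota> n j)"
    by (intro exI[of _ "\<lambda>n j. i j n"]) simp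
  then obtain \<iota> where "\<And>j. seq_colim E (\<lambda>n. ent (A n) j) (\<lambda>n. \<alpha> n j) (L j) (\<lambda>n. \<iota> n j)" by blast
  with seq_colim_complex[of A \<alpha>, OF \<alpha> this] obtain Q where QL: "ent Q = L"
      and \<iota>: "\<And>n. is_chain_map E (A n, Q, \<iota> n)"
    and Q: "\<And>j. seq_colim E (\<lambda>n. ent (A n) j) (\<lambda>n. \<alpha> n j) (ent Q j) (\<lambda>n. \<iota> n j)" by metis
  obtain F where F: "is_chain_map E (Q, X, F)" and Ff: "\<And>n j. F j \<cdot> \<iota> n j = f n j"
    using seq_colim_chain_desc[of A \<alpha>, OF \<alpha> \<iota> Q f f\<alpha>] by blast
  have \<alpha>h: "\<alpha> n j \<in> Hom E (ent (A n) j) (ent (A (Suc n)) j)"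
      for n j using chain_mapD(3-5)[OF \<alpha>] by (simp add: Hom_def)
  have lift: "local_lift E Q X F j" for j
  proof -
    \<comment> \<open>Large enough for both degree bounds of \<open>colim_local_lift\<close> with
      \<open>N = - int m\<close>. The system is restarted at stage \<open>Suc m\<close>, the result
      of layer \<open>m\<close>, because lifting down to degree \<open>- m\<close> is available from
      there on.\<close>
    define m where "m = nat (max (- j) (3 - k - j))"
    have m: "- int m \<le> j" "- int m - k + 3 \<le> j" unfolding m_def by linarith+
    show ?thesis
    proof (rule colim_local_lift[where A = "\<lambda>n. A (n + Suc m)" and \<alpha> = "\<lambda>n. \<alpha> (n + Suc m)"
        and \<iota> = "\<lambda>n. \<iota> (n + Suc m)"
          and t = "\<lambda>n. t (n + Suc m)" and f = "\<lambda>n. f (n + Suc m)"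
              and N = "- int m", OF AB4 closed Ap])
      show "seq_colim E (\<lambda>n. ent (A (n + Suc m)) j) (\<lambda>n. \<alpha> (n + Suc m) j) (ent Q j) (\<lambda>n. \<iota> (n +
          Suc m) j)" for j
        by (rule seq_colim_tail[OF Q \<alpha>h])
      show "local_lift E (A (n + Suc m)) X (f (n + Suc m)) j" if "- int m \<le> j" for n j
        using l[of "n + m" j] that by simp
      show "t (n + Suc m) j \<cdot> \<alpha> (n + Suc m) j = Ident E (ent (A (n + Suc m)) j)" for n j
        using biproductD(16)[OF b] .
      show "t (n + Suc m) j \<in> Hom E (ent (A (Suc n + Suc m)) j) (ent (A (n + Suc m)) j)" for n j
        using biproductD(10-12)[OF b[of "n + Suc m" j]] by (simp add: Hom_def)
      show "is_chain_map E (A (n + Suc m), A (Suc n + Suc m), \<alpha> (n + Suc m))" for n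
        using \<alpha>[of "n + Suc m"] by simp
    qed (use \<iota> f F Ff m in auto)
  qed
  have "special_direct_system E (Ch_plus_in E P) UNIV {(m, n). m \<le> n} A (\<lambda>m n. (A m, A n,
      transition A \<alpha> m n))"
    by (rule special_direct_system_transition[of A \<alpha>, OF \<alpha> A0 b D(1)]) (use D(2) in blast)
  moreover have "Q \<in> Ch_in E P" using chain_mapD(1)[OF F] L(2) by (simp add: Ch_in_def QL)
  moreover have "(Q, X, F) \<in> Hom (Ch E) Q X" using F by (simp add: Hom_Ch)
  moreover have "\<forall>n. adm_epic E (cmpt (Q, X, F) n)" using adm_epic_of_lift[OF F lift lift] by simp
  ultimately show ?thesis
    using quasi_iso_of_lift[OF F lift] direct_limit_transition[of A \<alpha>, OF \<alpha> \<iota> Q] by blast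
qed

end

theorem theorem1:
  fixes E :: "('o, 'm) excat"
    and P :: "'o set"
    and k :: int
    and X :: "('o, 'm) cplx"
  assumes "exact_category E"
    and "has_kernels E"
    and "P \<subseteq> Obj E"
    and "\<And>Y. Y \<in> Obj E \<Longrightarrow> \<exists>A \<in> P. \<exists>p \<in> Hom E A Y. adm_epic E p"
    and "closed_under_countable_coproducts E P"
    and "AB4 E k P"
    and "X \<in> Obj (Ch E)"
  shows "\<exists>Q f. Q \<in> Ch_in E P \<and> f \<in> Hom (Ch E) Q X \<and>
           (\<forall>n. adm_epic E (cmpt f n)) \<and> quasi_iso E f \<and>
           (\<exists>(J :: nat set) r S \<phi> \<iota>.
              special_direct_system E (Ch_plus_in E P) J r S \<phi> \<and>
              is_direct_limit (Ch E) J r S \<phi> Q \<iota>)"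
proof -
  interpret exact_category E by fact
  interpret covered_exact_category E P
    by unfold_locales (use assms in auto)
  show ?thesis
    by (rule special_resolution[OF assms(6)]) (use assms(7) in \<open>simp add: Ch_simps\<close>)
qed

end
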